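(* Let $K$ be a commutative ring with unit that is both a $\mathbb{Q}$-ring (contains $\mathbb{Q}$ as a subring) and an integral domain, and let $\chi=(\chi_d\colon W_d\to U(K))_{d\ge1}$ be an $\omega$-invariant sequence of characters. (i) If $E$ is a $K$-module with basis $(e_\ell)_{\ell\in L}$, then the family $(e_j)_{j\in J(\chi,T(E))}$ is a basis of the semi-symmetric algebra $[\chi](E)$ of weight $\chi$, considered as a $K$-module. (ii) If $E$ is a $K$-module with finite basis $(e_\ell)_{\ell=1}^n$, then the family $(e_j)_{j\in J(\chi,n)}$ is a basis of $[\chi](E)$, considered as a $K$-module. If $j\in J(\chi,n,d)$ and $k\in J(\chi,n,e)$, then the multiplication table of the $K$-algebra $[\chi](E)$ is given by $$e_j\chi e_k=\begin{cases}0 & \text{if }(j,k)\in I_0(\chi,n,d+e),\\ \zeta(j,k)\,e_{\ell m(j,k)} & \text{if }(j,k)\in I(\chi,n,d+e),\end{cases}$$ where $(j,k)$ denotes the concatenated sequence of length $d+e$.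
   Context: $S_\infty$ is the group of permutations of the positive integers fixing all but finitely many elements, $S_d\le S_\infty$ the subgroup fixing all $t>d$, and $\omega\colon S_\infty\to S_\infty$ the injective endomorphism $(\omega(\sigma))(1)=1$, $(\omega(\sigma))(t)=\sigma(t-1)+1$ for $t\ge2$. A sequence of group homomorphisms $\chi=(\chi_d\colon W_d\to U(K))_{d\ge1}$ ($U(K)$ the group of units of $K$) is $\omega$-invariant if $W_d\le S_d$, $W_d\le W_{d+1}$, $\omega(W_d)\le W_{d+1}$, and $\chi_{d+1}|_{W_d}=\chi_d=\chi_{d+1}\circ\omega|_{W_d}$ for all $d\ge1$. $S_d$ acts on $T^d(E)$ by $\sigma(x_1\otimes\cdots\otimes x_d)=x_{\sigma^{-1}(1)}\otimes\cdots\otimes x_{\sigma^{-1}(d)}$. $[\chi]^d(E)$ is the quotient of $T^d(E)$ by the submodule generated by all $\chi_d(\sigma)^{-1}z-\sigma z$, $\sigma\in W_d$, $z\in T^d(E)$; $[\chi]^0(E)=K$; the image of $x_1\otimes\cdots\otimes x_d$ is $x_1\chi\ldots\chi x_d$. The semi-symmetric algebra is $[\chi](E)=\coprod_{d\ge0}[\chi]^d(E)$, an associative graded $K$-algebra with product (also denoted by $\chi$) $(x_1\chi\ldots\chi x_d)\chi(y_1\chi\ldots\chi y_e)=x_1\chi\ldots\chi x_d\chi y_1\chi\ldots\chi y_e$. Given a basis $(e_\ell)_{\ell\in L}$ of $E$, $e_i=e_{i_1}\chi\ldots\chi e_{i_d}$ for $i\in L^d$. $W_d$ acts on $L^d$ by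 $(\sigma i)_t=i_{\sigma^{-1}(t)}$, with stabilizers $(W_d)_i$. $I(\chi,T^d(E))=\{i\in L^d\mid\chi_d=1\text{ on }(W_d)_i\}$, $I_0(\chi,T^d(E))$ is its complement in $L^d$, and $J(\chi,T^d(E))$ consists of exactly one element of each $W_d$-orbit contained in $I(\chi,T^d(E))$. For $d=0$: $J(\chi,T^0(E))=\{\emptyset\}$, $e_\emptyset=1$. $J(\chi,T(E))=\bigcup_{d\ge0}J(\chi,T^d(E))$. When $L=\{1,\ldots,n\}$, these sets are denoted $I(\chi,n,d)$, $I_0(\chi,n,d)$, $J(\chi,n,d)$, $J(\chi,n)=\bigcup_{d\ge 0} J(\chi,n,d)$, and the elements of $J(\chi,n,d)$ are chosen lexicographically minimal in their $W_d$-orbits. For $i\in I(\chi,n,d)$, $\ell m(i)$ is the lexicographically minimal element of the $W_d$-orbit of $i$, and $\zeta(i)=\chi_d(\sigma)$ where $\sigma\in W_d$ is any element with $\sigma i=\ell m(i)$ (independent of the choice of $\sigma$). *)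

theory Defs
  imports Complex_Main "HOL-Algebra.Module" "HOL-Algebra.Group_Action" "HOL-Algebra.Sym_Groups" "HOL-Algebra.QuotRing"
begin

section \<open>Modules\<close>

definition rat_ring :: "rat ring" where
  "rat_ring = \<lparr>carrier = UNIV, monoid.mult = (*), one = 1, zero = 0, add = (+)\<rparr>"

definition rat_algebra :: "('k, 'm) ring_scheme \<Rightarrow> bool" where
  "rat_algebra K \<longleftrightarrow> (\<exists>\<phi>. \<phi> \<in> ring_hom rat_ring K \<and> inj \<phi>)"

definition generated_submodule ::
    "('k, 'm) ring_scheme \<Rightarrow> ('k, 'a, 'n) module_scheme \<Rightarrow> 'a set \<Rightarrow> 'a set" where
  "generated_submodule K M S = (\<lambda>N. submodule N K M) hull S"

locale module_basis = module K M
  for K :: "('k, 'm) ring_scheme" (structure) and M :: "('k, 'a, 'n) module_scheme" (structure)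
    and I :: "'i set" and b :: "'i \<Rightarrow> 'a" +
  assumes in_carrier: "b \<in> I \<rightarrow> carrier M"
    and independent: "\<And>F c i. \<lbrakk> finite F; F \<subseteq> I; c \<in> F \<rightarrow> carrier K;
          (\<Oplus>\<^bsub>M\<^esub>j\<in>F. c j \<odot>\<^bsub>M\<^esub> b j) = \<zero>\<^bsub>M\<^esub>; i \<in> F \<rbrakk> \<Longrightarrow> c i = \<zero>\<^bsub>K\<^esub>"
    and generates: "generated_submodule K M (b ` I) = carrier M"

text \<open>The record type of modules extends that of rings; in a record that is used only as a
  module the fields \<open>mult\<close> and \<open>one\<close> are left undefined.\<close>

definition free_module :: "('k, 'm) ring_scheme \<Rightarrow> 'a set \<Rightarrow> ('k, 'a \<Rightarrow> 'k) module" where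
  "free_module K A =
     \<lparr>carrier = {f. (\<forall>a\<in>A. f a \<in> carrier K) \<and> (\<forall>a. a \<notin> A \<longrightarrow> f a = \<zero>\<^bsub>K\<^esub>)
                  \<and> finite {a. f a \<noteq> \<zero>\<^bsub>K\<^esub>}},
      monoid.mult = undefined, one = undefined,
      zero = (\<lambda>a. \<zero>\<^bsub>K\<^esub>), add = (\<lambda>f g a. f a \<oplus>\<^bsub>K\<^esub> g a),
      smult = (\<lambda>c f a. c \<otimes>\<^bsub>K\<^esub> f a)\<rparr>"

definition free_gen :: "('k, 'm) ring_scheme \<Rightarrow> 'a \<Rightarrow> 'a \<Rightarrow> 'k" where
  "free_gen K x = (\<lambda>a. if a = x then \<one>\<^bsub>K\<^esub> else \<zero>\<^bsub>K\<^esub>)"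

text \<open>Elements of a quotient are cosets. A map on the quotient induced by a map \<open>g\<close> on
  representatives is written as the union of the cosets \<open>N +> g x\<close> over all representatives
  \<open>x\<close>, as for \<^const>\<open>rcoset_mult\<close>.\<close>

definition quot_module ::
    "('k, 'a, 'n) module_scheme \<Rightarrow> 'a set \<Rightarrow> ('k, 'a set) module" where
  "quot_module M N =
     \<lparr>carrier = a_rcosets\<^bsub>M\<^esub> N, monoid.mult = undefined, one = undefined,
      zero = N, add = set_add M,
      smult = (\<lambda>c A. \<Union>x\<in>A. N +>\<^bsub>M\<^esub> (c \<odot>\<^bsub>M\<^esub> x))\<rparr>"


section \<open>\<open>\<omega>\<close>-invariant sequences of characters\<close>

text \<open>Permutations of the positive integers are functions on \<^typ>\<open>nat\<close> fixing \<open>0\<close>.\<close>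

definition omega :: "(nat \<Rightarrow> nat) \<Rightarrow> nat \<Rightarrow> nat" where
  "omega \<sigma> = (\<lambda>t. if t \<le> 1 then t else \<sigma> (t - 1) + 1)"

abbreviation perm_group :: "(nat \<Rightarrow> (nat \<Rightarrow> nat) set) \<Rightarrow> nat \<Rightarrow> (nat \<Rightarrow> nat) monoid" where
  "perm_group W d \<equiv> (sym_group d)\<lparr>carrier := W d\<rparr>"

text \<open>The index \<open>d = 0\<close> is included. Since \<open>S\<^sub>0\<close> is trivial, the conditions force
  \<open>W 0 = {id}\<close> and \<open>chi 0 id = \<one>\<close>, and those involving \<open>d = 0\<close> then hold automatically;
  so this is the notion for sequences indexed by \<open>d \<ge> 1\<close>, with the degree \<open>0\<close> conventions
  built in.\<close>

definition omega_invariant ::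
    "('k, 'm) ring_scheme \<Rightarrow> (nat \<Rightarrow> (nat \<Rightarrow> nat) set) \<Rightarrow> (nat \<Rightarrow> (nat \<Rightarrow> nat) \<Rightarrow> 'k) \<Rightarrow> bool"
  where
  "omega_invariant K W chi \<longleftrightarrow>
     (\<forall>d. subgroup (W d) (sym_group d)
        \<and> chi d \<in> hom (perm_group W d) (units_of K)
        \<and> W d \<subseteq> W (Suc d)
        \<and> omega ` W d \<subseteq> W (Suc d)
        \<and> (\<forall>\<sigma>\<in>W d. chi (Suc d) \<sigma> = chi d \<sigma> \<and> chi (Suc d) (omega \<sigma>) = chi d \<sigma>))"


section \<open>Tuples\<close>

definition tuples :: "'a set \<Rightarrow> nat \<Rightarrow> 'a list set" where
  "tuples A d = {xs. set xs \<subseteq> A \<and> length xs = d}"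

text \<open>\<open>(\<sigma> x)\<^sub>t = x\<^bsub>\<sigma>\<^sup>-\<^sup>1(t)\<^esub>\<close> for \<open>1 \<le> t \<le> d\<close>, where \<open>x\<^sub>t\<close> is \<open>xs ! (t - 1)\<close>.\<close>

definition perm_tuple :: "(nat \<Rightarrow> nat) \<Rightarrow> 'a list \<Rightarrow> 'a list" where
  "perm_tuple \<sigma> xs = map (\<lambda>t. xs ! (inv' \<sigma> t - 1)) [1..<Suc (length xs)]"


section \<open>Tensor powers\<close>

definition tensor_relators ::
    "('k, 'm) ring_scheme \<Rightarrow> ('k, 'e, 'n) module_scheme \<Rightarrow> nat \<Rightarrow> ('e list \<Rightarrow> 'k) set" where
  "tensor_relators K E d =
     (let F = free_module K (tuples (carrier E) d) in
        {free_gen K (xs[t := x \<oplus>\<^bsub>E\<^esub> y]) \<ominus>\<^bsub>F\<^esub> (free_gen K (xs[t := x]) \<oplus>\<^bsub>F\<^esub> free_gen K (xs[t := y])) |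
           xs t x y. xs \<in> tuples (carrier E) d \<and> t < d \<and> x \<in> carrier E \<and> y \<in> carrier E}
      \<union> {free_gen K (xs[t := c \<odot>\<^bsub>E\<^esub> x]) \<ominus>\<^bsub>F\<^esub> (c \<odot>\<^bsub>F\<^esub> free_gen K (xs[t := x])) |
           xs t c x. xs \<in> tuples (carrier E) d \<and> t < d \<and> c \<in> carrier K \<and> x \<in> carrier E})"

definition tensor_rel ::
    "('k, 'm) ring_scheme \<Rightarrow> ('k, 'e, 'n) module_scheme \<Rightarrow> nat \<Rightarrow> ('e list \<Rightarrow> 'k) set" where
  "tensor_rel K E d =
     generated_submodule K (free_module K (tuples (carrier E) d)) (tensor_relators K E d)"

definition tensor_coset ::
    "('k, 'm) ring_scheme \<Rightarrow> ('k, 'e, 'n) module_scheme \<Rightarrow> nat \<Rightarrow> ('e list \<Rightarrow> 'k) \<Rightarrow> ('e list \<Rightarrow> 'k) set"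
  where
  "tensor_coset K E d f = tensor_rel K E d +>\<^bsub>free_module K (tuples (carrier E) d)\<^esub> f"

definition tensor_power ::
    "('k, 'm) ring_scheme \<Rightarrow> ('k, 'e, 'n) module_scheme \<Rightarrow> nat \<Rightarrow> ('k, ('e list \<Rightarrow> 'k) set) module"
  where
  "tensor_power K E d = quot_module (free_module K (tuples (carrier E) d)) (tensor_rel K E d)"

text \<open>\<open>x\<^sub>1 \<otimes> \<dots> \<otimes> x\<^sub>d\<close>\<close>

definition pure_tensor ::
    "('k, 'm) ring_scheme \<Rightarrow> ('k, 'e, 'n) module_scheme \<Rightarrow> 'e list \<Rightarrow> ('e list \<Rightarrow> 'k) set" where
  "pure_tensor K E xs = tensor_coset K E (length xs) (free_gen K xs)"

text \<open>The function \<open>\<lambda>xs. f (perm_tuple (inv' \<sigma>) xs)\<close> is the image of \<open>f\<close> under the linear map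
  sending the generator at \<open>xs\<close> to the generator at \<open>perm_tuple \<sigma> xs\<close>. Similarly, in
  \<open>tensor_mult\<close> the product of the generators at \<open>xs\<close> and \<open>ys\<close> is the generator
  at \<open>xs @ ys\<close>.\<close>

definition perm_tensor ::
    "('k, 'm) ring_scheme \<Rightarrow> ('k, 'e, 'n) module_scheme \<Rightarrow> nat \<Rightarrow> (nat \<Rightarrow> nat)
      \<Rightarrow> ('e list \<Rightarrow> 'k) set \<Rightarrow> ('e list \<Rightarrow> 'k) set" where
  "perm_tensor K E d \<sigma> z = (\<Union>f\<in>z. tensor_coset K E d (\<lambda>xs. f (perm_tuple (inv' \<sigma>) xs)))"

definition tensor_mult ::
    "('k, 'm) ring_scheme \<Rightarrow> ('k, 'e, 'n) module_scheme \<Rightarrow> nat \<Rightarrow> nat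
      \<Rightarrow> ('e list \<Rightarrow> 'k) set \<Rightarrow> ('e list \<Rightarrow> 'k) set \<Rightarrow> ('e list \<Rightarrow> 'k) set" where
  "tensor_mult K E p q y z =
     (\<Union>f\<in>y. \<Union>g\<in>z. tensor_coset K E (p + q) (\<lambda>xs. f (take p xs) \<otimes>\<^bsub>K\<^esub> g (drop p xs)))"


section \<open>The semi-symmetric algebra\<close>

definition semisym_rel ::
    "('k, 'm) ring_scheme \<Rightarrow> (nat \<Rightarrow> (nat \<Rightarrow> nat) set) \<Rightarrow> (nat \<Rightarrow> (nat \<Rightarrow> nat) \<Rightarrow> 'k)
      \<Rightarrow> ('k, 'e, 'n) module_scheme \<Rightarrow> nat \<Rightarrow> ('e list \<Rightarrow> 'k) set set" where
  "semisym_rel K W chi E d =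
     (let T = tensor_power K E d in
        generated_submodule K T
          {(inv\<^bsub>K\<^esub> (chi d \<sigma>) \<odot>\<^bsub>T\<^esub> z) \<ominus>\<^bsub>T\<^esub> perm_tensor K E d \<sigma> z | \<sigma> z. \<sigma> \<in> W d \<and> z \<in> carrier T})"

definition semisym_coset ::
    "('k, 'm) ring_scheme \<Rightarrow> (nat \<Rightarrow> (nat \<Rightarrow> nat) set) \<Rightarrow> (nat \<Rightarrow> (nat \<Rightarrow> nat) \<Rightarrow> 'k)
      \<Rightarrow> ('k, 'e, 'n) module_scheme \<Rightarrow> nat \<Rightarrow> ('e list \<Rightarrow> 'k) set \<Rightarrow> ('e list \<Rightarrow> 'k) set set" where
  "semisym_coset K W chi E d z = semisym_rel K W chi E d +>\<^bsub>tensor_power K E d\<^esub> z"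

definition semisym_power ::
    "('k, 'm) ring_scheme \<Rightarrow> (nat \<Rightarrow> (nat \<Rightarrow> nat) set) \<Rightarrow> (nat \<Rightarrow> (nat \<Rightarrow> nat) \<Rightarrow> 'k)
      \<Rightarrow> ('k, 'e, 'n) module_scheme \<Rightarrow> nat \<Rightarrow> ('k, ('e list \<Rightarrow> 'k) set set) module" where
  "semisym_power K W chi E d = quot_module (tensor_power K E d) (semisym_rel K W chi E d)"

definition semisym_mult ::
    "('k, 'm) ring_scheme \<Rightarrow> (nat \<Rightarrow> (nat \<Rightarrow> nat) set) \<Rightarrow> (nat \<Rightarrow> (nat \<Rightarrow> nat) \<Rightarrow> 'k)
      \<Rightarrow> ('k, 'e, 'n) module_scheme \<Rightarrow> nat \<Rightarrow> nat
      \<Rightarrow> ('e list \<Rightarrow> 'k) set set \<Rightarrow> ('e list \<Rightarrow> 'k) set set \<Rightarrow> ('e list \<Rightarrow> 'k) set set" where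
  "semisym_mult K W chi E p q Y Z =
     (\<Union>y\<in>Y. \<Union>z\<in>Z. semisym_coset K W chi E (p + q) (tensor_mult K E p q y z))"

text \<open>\<open>x\<^sub>1 \<chi> \<dots> \<chi> x\<^sub>d\<close>, as an element of the direct sum of all semi-symmetric powers.\<close>

definition semisym_prod ::
    "('k, 'm) ring_scheme \<Rightarrow> (nat \<Rightarrow> (nat \<Rightarrow> nat) set) \<Rightarrow> (nat \<Rightarrow> (nat \<Rightarrow> nat) \<Rightarrow> 'k)
      \<Rightarrow> ('k, 'e, 'n) module_scheme \<Rightarrow> 'e list \<Rightarrow> nat \<Rightarrow> ('e list \<Rightarrow> 'k) set set" where
  "semisym_prod K W chi E xs =
     (\<lambda>d. if d = length xs then semisym_coset K W chi E d (pure_tensor K E xs)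
          else \<zero>\<^bsub>semisym_power K W chi E d\<^esub>)"

definition semisym_algebra ::
    "('k, 'm) ring_scheme \<Rightarrow> (nat \<Rightarrow> (nat \<Rightarrow> nat) set) \<Rightarrow> (nat \<Rightarrow> (nat \<Rightarrow> nat) \<Rightarrow> 'k)
      \<Rightarrow> ('k, 'e, 'n) module_scheme \<Rightarrow> ('k, nat \<Rightarrow> ('e list \<Rightarrow> 'k) set set) module" where
  "semisym_algebra K W chi E =
     (let P = semisym_power K W chi E in
      \<lparr>carrier = {u. (\<forall>d. u d \<in> carrier (P d)) \<and> finite {d. u d \<noteq> \<zero>\<^bsub>P d\<^esub>}},
       monoid.mult = (\<lambda>u v d. \<Oplus>\<^bsub>P d\<^esub>p\<in>{..d}. semisym_mult K W chi E p (d - p) (u p) (v (d - p))),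
       one = semisym_prod K W chi E [],
       zero = (\<lambda>d. \<zero>\<^bsub>P d\<^esub>),
       add = (\<lambda>u v d. u d \<oplus>\<^bsub>P d\<^esub> v d),
       smult = (\<lambda>c u d. c \<odot>\<^bsub>P d\<^esub> u d)\<rparr>)"


section \<open>Index sets\<close>

definition index_I ::
    "('k, 'm) ring_scheme \<Rightarrow> (nat \<Rightarrow> (nat \<Rightarrow> nat) set) \<Rightarrow> (nat \<Rightarrow> (nat \<Rightarrow> nat) \<Rightarrow> 'k)
      \<Rightarrow> 'l set \<Rightarrow> nat \<Rightarrow> 'l list set" where
  "index_I K W chi L d =
     {i \<in> tuples L d. \<forall>\<sigma>\<in>stabilizer (perm_group W d) perm_tuple i. chi d \<sigma> = \<one>\<^bsub>K\<^esub>}"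

definition index_I0 ::
    "('k, 'm) ring_scheme \<Rightarrow> (nat \<Rightarrow> (nat \<Rightarrow> nat) set) \<Rightarrow> (nat \<Rightarrow> (nat \<Rightarrow> nat) \<Rightarrow> 'k)
      \<Rightarrow> 'l set \<Rightarrow> nat \<Rightarrow> 'l list set" where
  "index_I0 K W chi L d = tuples L d - index_I K W chi L d"

definition is_index_J ::
    "('k, 'm) ring_scheme \<Rightarrow> (nat \<Rightarrow> (nat \<Rightarrow> nat) set) \<Rightarrow> (nat \<Rightarrow> (nat \<Rightarrow> nat) \<Rightarrow> 'k)
      \<Rightarrow> 'l set \<Rightarrow> nat \<Rightarrow> 'l list set \<Rightarrow> bool" where
  "is_index_J K W chi L d J \<longleftrightarrow>
     J \<subseteq> index_I K W chi L d \<and>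
     (\<forall>B\<in>orbits (perm_group W d) (tuples L d) perm_tuple.
        B \<subseteq> index_I K W chi L d \<longrightarrow> (\<exists>!j. j \<in> J \<inter> B))"

definition lex_min :: "(nat \<Rightarrow> (nat \<Rightarrow> nat) set) \<Rightarrow> nat list \<Rightarrow> nat list" where
  "lex_min W i =
     (THE j. j \<in> orbit (perm_group W (length i)) perm_tuple i \<and>
        (\<forall>k\<in>orbit (perm_group W (length i)) perm_tuple i. k = j \<or> (j, k) \<in> lex less_than))"

definition zeta ::
    "(nat \<Rightarrow> (nat \<Rightarrow> nat) set) \<Rightarrow> (nat \<Rightarrow> (nat \<Rightarrow> nat) \<Rightarrow> 'k) \<Rightarrow> nat list \<Rightarrow> 'k" where
  "zeta W chi i = chi (length i) (SOME \<sigma>. \<sigma> \<in> W (length i) \<and> perm_tuple \<sigma> i = lex_min W i)"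

definition lex_J ::
    "('k, 'm) ring_scheme \<Rightarrow> (nat \<Rightarrow> (nat \<Rightarrow> nat) set) \<Rightarrow> (nat \<Rightarrow> (nat \<Rightarrow> nat) \<Rightarrow> 'k)
      \<Rightarrow> nat \<Rightarrow> nat \<Rightarrow> nat list set" where
  "lex_J K W chi n d = {j \<in> index_I K W chi {1..n} d. lex_min W j = j}"

end

theory Submission
  imports Defs
begin

text \<open>The elements \<open>e\<^sub>i\<close>, \<open>i \<in> L\<^sup>d\<close>, generate the \<open>d\<close>-th semi-symmetric power, and \<open>e\<^sub>i\<close> is a unit
  multiple of \<open>e\<^bsub>\<sigma>i\<^esub>\<close> for \<open>\<sigma> \<in> W\<^sub>d\<close>. If \<open>\<sigma>\<close> stabilizes \<open>i\<close> and \<open>\<zeta> = \<chi>(\<sigma>) \<noteq> 1\<close>, then \<open>\<zeta> e\<^sub>i = e\<^sub>i\<close>, and as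
  \<open>\<zeta>\<close> is a root of unity in a domain containing the rationals, \<open>e\<^sub>i = 0\<close>; hence the \<open>e\<^sub>j\<close> with \<open>j \<in> J\<close>
  generate. They are independent because averaging the coordinate functional \<open>\<Phi>\<^sub>j\<close> of the tensor
  power, \<open>z \<mapsto> \<Sum>\<^bsub>\<tau> \<in> W\<^esub> \<chi>(\<tau>) \<Phi>\<^sub>j(\<tau> z)\<close>, gives a functional on the semi-symmetric power that vanishes
  at \<open>e\<^sub>k\<close> for \<open>k\<close> outside the orbit of \<open>j\<close> and takes the value \<open>|W\<^sub>j| \<noteq> 0\<close> at \<open>e\<^sub>j\<close>, where \<open>W\<^sub>j\<close> is the
  stabilizer of \<open>j\<close>.\<close>

section \<open>Modules, linear maps and quotients\<close>

text \<open>Each power is a quotient of a quotient of a free module, and its operations are unions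
  over representatives, so the recurring obstacle is well-definedness. It is settled once for linear
  and once for bilinear maps between quotients by generated submodules, where only generators have
  to be checked. Functionals on a power come from its universal property.

  The weights \<chi>(\<tau>) in the average are forced: in the power, e at \<sigma>x equals
  \<chi>(\<sigma>)^-1 times e at x, and a functional has to reproduce this factor. Independence asks
  only that each functional be nonzero at its own basis element, so the value |W_j| does not have to
  be normalized.

  The two hypotheses on K share the work in e_i = 0: in a domain s = 1 + \<zeta> + ... +
  \<zeta>^(n-1) vanishes, while s acts on e_i as the integer n, which the rationals make invertible.
  Invertibility is what counts, since the power is not known to be torsion-free.

  The \<omega>-invariance makes the product exist: inclusion of the groups handles relations in the
  left factor, iterated shifts those in the right one.\<close>

context module
begin

lemma submodule_zero: "submodule N R M \<Longrightarrow> \<zero>\<^bsub>M\<^esub> \<in> N"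
  using subgroup.one_closed[OF submodule.axioms(1)] by force

lemma smult_minus:
  assumes "c \<in> carrier R" "x \<in> carrier M" "y \<in> carrier M"
  shows "c \<odot>\<^bsub>M\<^esub> (x \<ominus>\<^bsub>M\<^esub> y) = c \<odot>\<^bsub>M\<^esub> x \<ominus>\<^bsub>M\<^esub> c \<odot>\<^bsub>M\<^esub> y"
  using assms unfolding a_minus_def by (simp only: smult_r_distr smult_r_minus M.a_inv_closed)

lemma minus_eq_zero_iff:
  assumes "x \<in> carrier M" "y \<in> carrier M"
  shows "x \<ominus>\<^bsub>M\<^esub> y = \<zero>\<^bsub>M\<^esub> \<longleftrightarrow> x = y"
  using assms M.add.inv_equality[of x "\<ominus>\<^bsub>M\<^esub> y"] by (auto simp: a_minus_def M.r_neg)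

text \<open>Closure under scalars already supplies negatives, since -x = (-1) x.\<close>

lemma submoduleI':
  assumes "N \<subseteq> carrier M" "\<zero>\<^bsub>M\<^esub> \<in> N"
    and "\<And>x y. x \<in> N \<Longrightarrow> y \<in> N \<Longrightarrow> x \<oplus>\<^bsub>M\<^esub> y \<in> N"
    and sm: "\<And>c x. c \<in> carrier R \<Longrightarrow> x \<in> N \<Longrightarrow> c \<odot>\<^bsub>M\<^esub> x \<in> N"
  shows "submodule N R M"
proof (rule submoduleI)
  fix x assume x: "x \<in> N"
  then have "\<ominus>\<^bsub>M\<^esub> x = (\<ominus> \<one>) \<odot>\<^bsub>M\<^esub> x"
    using assms(1) by (auto simp: smult_l_minus)
  then show "\<ominus>\<^bsub>M\<^esub> x \<in> N" using sm x by simp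
qed (use assms in auto)

lemma submodule_Inter:
  assumes "\<N> \<noteq> {}" "\<And>N. N \<in> \<N> \<Longrightarrow> submodule N R M"
  shows "submodule (\<Inter>\<N>) R M"
proof (rule submoduleI')
  show "\<Inter>\<N> \<subseteq> carrier M" using assms submoduleE(1) by blast
qed (use assms(2) submoduleE(4,5) submodule_zero in auto)

text \<open>The hull is the intersection of all submodules containing S. The assumption keeps this
  family nonempty, the whole carrier being a member; for any other S the hull would be the entire
  type.\<close>

lemma generated_submodule_submodule:
  assumes "S \<subseteq> carrier M"
  shows "submodule (generated_submodule R M S) R M"
  unfolding generated_submodule_def hull_def
  using assms carrier_is_submodule by (intro submodule_Inter) auto

lemma generated_submodule_incl: "x \<in> S \<Longrightarrow> x \<in> generated_submodule R M S"
  unfolding generated_submodule_def by (rule hull_inc)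

lemma generated_submodule_least:
  "submodule N R M \<Longrightarrow> S \<subseteq> N \<Longrightarrow> generated_submodule R M S \<subseteq> N"
  unfolding generated_submodule_def by (rule hull_minimal)

lemma generated_submodule_closed:
  "S \<subseteq> carrier M \<Longrightarrow> generated_submodule R M S \<subseteq> carrier M"
  by (rule generated_submodule_least[OF carrier_is_submodule])

lemma generated_submodule_eqI:
  assumes "S \<subseteq> carrier M" "\<And>N. submodule N R M \<Longrightarrow> S \<subseteq> N \<Longrightarrow> carrier M \<subseteq> N"
  shows "generated_submodule R M S = carrier M"
  using assms generated_submodule_closed generated_submodule_submodule generated_submodule_incl
  by (meson subsetI subset_antisym)

lemma submodule_abelian_subgroup:
  assumes "submodule N R M" shows "abelian_subgroup N M"
  by (intro abelian_subgroupI3 additive_subgroup.intro submodule.axioms(1)[OF assms]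
      M.abelian_group_axioms)

lemma coset_eq_iff:
  assumes N: "submodule N R M" and x: "x \<in> carrier M" "y \<in> carrier M"
  shows "N +>\<^bsub>M\<^esub> x = N +>\<^bsub>M\<^esub> y \<longleftrightarrow> x \<ominus>\<^bsub>M\<^esub> y \<in> N"
proof -
  interpret N: abelian_subgroup N M by (rule submodule_abelian_subgroup[OF N])
  have "N +>\<^bsub>M\<^esub> x = N +>\<^bsub>M\<^esub> y \<longleftrightarrow> x \<in> N +>\<^bsub>M\<^esub> y"
    using N.a_rcos_self[OF x(1)] N.a_repr_independence'[OF _ x(2)] by blast
  then show ?thesis
    using N.a_rcos_module[OF x(2,1)] by (simp add: a_minus_def)
qed

text \<open>Trades membership in a coset for equality of cosets, the form in which independence of
  the representative is checked when a union over a coset is evaluated.\<close>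

lemma mem_coset_iff:
  assumes N: "submodule N R M" and x: "x \<in> carrier M"
  shows "y \<in> N +>\<^bsub>M\<^esub> x \<longleftrightarrow> y \<in> carrier M \<and> N +>\<^bsub>M\<^esub> y = N +>\<^bsub>M\<^esub> x"
proof -
  interpret N: abelian_subgroup N M by (rule submodule_abelian_subgroup[OF N])
  show ?thesis
    using N.a_rcos_self[of y] N.a_elemrcos_carrier[OF x] N.a_repr_independence'[OF _ x]
    by blast
qed

lemma coset_eq_self_iff:
  assumes N: "submodule N R M" and x: "x \<in> carrier M"
  shows "N +>\<^bsub>M\<^esub> x = N \<longleftrightarrow> x \<in> N"
proof -
  have "N +>\<^bsub>M\<^esub> \<zero>\<^bsub>M\<^esub> = N" using submoduleE(1)[OF N] by (rule a_coset_add_zero)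
  moreover have "x \<ominus>\<^bsub>M\<^esub> \<zero>\<^bsub>M\<^esub> = x" using x by (simp add: a_minus_def)
  ultimately show ?thesis using coset_eq_iff[OF N x M.zero_closed] by simp
qed

end

section \<open>Linear maps between modules\<close>

locale linear_map = M: module K M + N: module K N
  for K :: "('k, 'm) ring_scheme" and M :: "('k, 'a, 'p) module_scheme"
    and N :: "('k, 'b, 'q) module_scheme" +
  fixes h :: "'a \<Rightarrow> 'b"
  assumes closed: "x \<in> carrier M \<Longrightarrow> h x \<in> carrier N"
    and add: "x \<in> carrier M \<Longrightarrow> y \<in> carrier M \<Longrightarrow> h (x \<oplus>\<^bsub>M\<^esub> y) = h x \<oplus>\<^bsub>N\<^esub> h y"
    and smult: "c \<in> carrier K \<Longrightarrow> x \<in> carrier M \<Longrightarrow> h (c \<odot>\<^bsub>M\<^esub> x) = c \<odot>\<^bsub>N\<^esub> h x"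
begin

lemma zero: "h \<zero>\<^bsub>M\<^esub> = \<zero>\<^bsub>N\<^esub>"
  using smult[OF M.R.zero_closed M.zero_closed] closed[OF M.zero_closed] by simp

lemma uminus: "x \<in> carrier M \<Longrightarrow> h (\<ominus>\<^bsub>M\<^esub> x) = \<ominus>\<^bsub>N\<^esub> h x"
  using smult[of "\<ominus>\<^bsub>K\<^esub> \<one>\<^bsub>K\<^esub>" x] closed[of x] by (simp add: M.smult_l_minus N.smult_l_minus)

lemma minus: "x \<in> carrier M \<Longrightarrow> y \<in> carrier M \<Longrightarrow> h (x \<ominus>\<^bsub>M\<^esub> y) = h x \<ominus>\<^bsub>N\<^esub> h y"
  by (simp add: a_minus_def add uminus)

lemma finsum:
  "f \<in> A \<rightarrow> carrier M \<Longrightarrow> h (finsum M f A) = finsum N (\<lambda>a. h (f a)) A"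
proof (induction A rule: infinite_finite_induct)
  case (insert a A)
  then have "finsum M f (insert a A) = f a \<oplus>\<^bsub>M\<^esub> finsum M f A"
    by (intro M.finsum_insert) auto
  moreover have "finsum N (\<lambda>a. h (f a)) (insert a A) = h (f a) \<oplus>\<^bsub>N\<^esub> finsum N (\<lambda>a. h (f a)) A"
    using insert closed by (intro N.finsum_insert) auto
  ultimately show ?case using insert by (simp add: add M.finsum_closed)
qed (auto simp: zero M.finsum_infinite N.finsum_infinite)

lemma vimage_submodule:
  assumes "submodule P K N" shows "submodule {x \<in> carrier M. h x \<in> P} K M"
  using N.submoduleE(4,5)[OF assms] N.submodule_zero[OF assms]
  by (intro M.submoduleI') (auto simp: add smult zero)

lemma kernel_submodule: "submodule {x \<in> carrier M. h x = \<zero>\<^bsub>N\<^esub>} K M"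
  by (intro M.submoduleI') (auto simp: add smult zero)

lemma image_submodule: "submodule (h ` carrier M) K N"
proof (rule N.submoduleI')
  show "\<zero>\<^bsub>N\<^esub> \<in> h ` carrier M" using zero M.zero_closed by (metis imageI)
qed (auto simp: closed simp flip: add smult)

end

lemma linear_map_comp:
  assumes "linear_map K M N h" "linear_map K N P g" shows "linear_map K M P (\<lambda>x. g (h x))"
proof -
  interpret h: linear_map K M N h by fact
  interpret g: linear_map K N P g by fact
  show ?thesis
    by unfold_locales (auto simp: h.closed g.closed h.add g.add h.smult g.smult)
qed

text \<open>The module axioms pass to the image of a map compatible with the operations, so Q does
  not have to be known as a module beforehand. For quotients this replaces a separate verification
  of the axioms.\<close>

lemma module_surj_image:
  assumes "module K M" and onto: "carrier Q = h ` carrier M" and zero: "h \<zero>\<^bsub>M\<^esub> = \<zero>\<^bsub>Q\<^esub>"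
    and add: "\<And>x y. x \<in> carrier M \<Longrightarrow> y \<in> carrier M \<Longrightarrow> h (x \<oplus>\<^bsub>M\<^esub> y) = h x \<oplus>\<^bsub>Q\<^esub> h y"
    and smult: "\<And>c x. c \<in> carrier K \<Longrightarrow> x \<in> carrier M \<Longrightarrow> h (c \<odot>\<^bsub>M\<^esub> x) = c \<odot>\<^bsub>Q\<^esub> h x"
  shows "linear_map K M Q h"
proof -
  interpret M: module K M by fact
  have "abelian_group Q"
  proof (rule abelian_groupI)
    fix x assume "x \<in> carrier Q"
    then obtain a where a: "a \<in> carrier M" "x = h a" using onto by auto
    then have "h (\<ominus>\<^bsub>M\<^esub> a) \<oplus>\<^bsub>Q\<^esub> x = \<zero>\<^bsub>Q\<^esub>" by (simp flip: add zero add: M.l_neg)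
    then show "\<exists>y\<in>carrier Q. y \<oplus>\<^bsub>Q\<^esub> x = \<zero>\<^bsub>Q\<^esub>" using a onto by blast
  qed (auto simp: onto M.a_ac simp flip: add zero)
  then have "module K Q"
    by (intro moduleI M.R.is_cring)
      (auto simp: onto M.smult_l_distr M.smult_r_distr M.smult_assoc1 simp flip: add zero smult)
  then show ?thesis
    using assms by (intro linear_map.intro linear_map_axioms.intro) auto
qed

lemma quot_module_linear:
  assumes "module K M" and N: "submodule N K M"
  shows "linear_map K M (quot_module M N) (\<lambda>x. N +>\<^bsub>M\<^esub> x)"
proof -
  interpret M: module K M by fact
  interpret N: abelian_subgroup N M by (rule M.submodule_abelian_subgroup[OF N])
  show ?thesis
  proof (rule module_surj_image[OF \<open>module K M\<close>])
    fix c x assume c: "c \<in> carrier K" and x: "x \<in> carrier M"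
    \<comment> \<open>Scalar multiplication in \<open>quot_module\<close> is a union over
      representatives; it collapses to one coset because all its members agree.\<close>
    have "N +>\<^bsub>M\<^esub> (c \<odot>\<^bsub>M\<^esub> y) = N +>\<^bsub>M\<^esub> (c \<odot>\<^bsub>M\<^esub> x)" if "y \<in> N +>\<^bsub>M\<^esub> x" for y
    proof -
      have y: "y \<in> carrier M" "y \<ominus>\<^bsub>M\<^esub> x \<in> N"
        using that M.mem_coset_iff[OF N x] M.coset_eq_iff[OF N _ x] by auto
      then have "c \<odot>\<^bsub>M\<^esub> (y \<ominus>\<^bsub>M\<^esub> x) \<in> N" using M.submoduleE(4)[OF N c] by blast
      then show ?thesis
        using M.coset_eq_iff[OF N M.smult_closed[OF c y(1)] M.smult_closed[OF c x]]
        unfolding M.smult_minus[OF c y(1) x] by simp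
    qed
    moreover have "x \<in> N +>\<^bsub>M\<^esub> x" using x M.mem_coset_iff[OF N x] by simp
    ultimately have "(\<Union>y\<in>N +>\<^bsub>M\<^esub> x. N +>\<^bsub>M\<^esub> (c \<odot>\<^bsub>M\<^esub> y)) = N +>\<^bsub>M\<^esub> (c \<odot>\<^bsub>M\<^esub> x)"
      by blast
    then show "N +>\<^bsub>M\<^esub> (c \<odot>\<^bsub>M\<^esub> x) = c \<odot>\<^bsub>quot_module M N\<^esub> (N +>\<^bsub>M\<^esub> x)"
      by (simp add: quot_module_def)
  qed (auto simp: quot_module_def A_RCOSETS_def' N.a_rcos_sum M.coset_eq_self_iff[OF N] M.submodule_zero[OF N])
qed

lemma carrier_quot_module: "carrier (quot_module M N) = (\<lambda>x. N +>\<^bsub>M\<^esub> x) ` carrier M"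
  by (auto simp: quot_module_def A_RCOSETS_def')

lemma zero_quot_module: "\<zero>\<^bsub>quot_module M N\<^esub> = N"
  by (simp add: quot_module_def)

text \<open>The kernel of h is a submodule, so it contains N as soon as it contains the generators
  S. Both quotient steps of \<open>semisym_power_universal\<close> rest on this.\<close>

lemma quot_module_universal:
  assumes lin: "linear_map K M X h" and S: "S \<subseteq> carrier M"
    and ker: "\<And>s. s \<in> S \<Longrightarrow> h s = \<zero>\<^bsub>X\<^esub>"
  defines "N \<equiv> generated_submodule K M S"
  obtains g where "linear_map K (quot_module M N) X g"
    "\<And>x. x \<in> carrier M \<Longrightarrow> g (N +>\<^bsub>M\<^esub> x) = h x"
proof -
  interpret h: linear_map K M X h by fact
  have N: "submodule N K M" unfolding N_def by (rule h.M.generated_submodule_submodule[OF S])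
  have Nker: "h x = \<zero>\<^bsub>X\<^esub>" if "x \<in> N" for x
    using h.M.generated_submodule_least[OF h.kernel_submodule, of S] S ker that
    unfolding N_def by blast
  have eq: "h x = h y" if "x \<in> carrier M" "y \<in> carrier M" "N +>\<^bsub>M\<^esub> x = N +>\<^bsub>M\<^esub> y" for x y
  proof -
    have "h x \<ominus>\<^bsub>X\<^esub> h y = \<zero>\<^bsub>X\<^esub>"
      using Nker[of "x \<ominus>\<^bsub>M\<^esub> y"] that h.M.coset_eq_iff[OF N] by (simp add: h.minus)
    then show ?thesis using h.N.minus_eq_zero_iff h.closed that by blast
  qed
  \<comment> \<open>An arbitrary representative of the coset; \<open>eq\<close> makes the value
    independent of it.\<close>
  define g where "g = (\<lambda>A. h (SOME x. x \<in> carrier M \<and> N +>\<^bsub>M\<^esub> x = A))"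
  have g: "g (N +>\<^bsub>M\<^esub> x) = h x" if "x \<in> carrier M" for x
    unfolding g_def by (rule someI2[of _ x]) (use eq that in blast)+
  interpret q: linear_map K M "quot_module M N" "\<lambda>x. N +>\<^bsub>M\<^esub> x"
    by (rule quot_module_linear[OF h.M.module_axioms N])
  have "linear_map K (quot_module M N) X g"
    by unfold_locales
      (auto simp: carrier_quot_module g h.closed h.add h.smult simp flip: q.add q.smult)
  then show thesis using g by (rule that)
qed

locale bilinear_map = M1: module K M1 + M2: module K M2 + M3: module K M3
  for K :: "('k, 'm) ring_scheme" and M1 :: "('k, 'a, 'p) module_scheme"
    and M2 :: "('k, 'b, 'q) module_scheme" and M3 :: "('k, 'c, 'r) module_scheme" +
  fixes B :: "'a \<Rightarrow> 'b \<Rightarrow> 'c"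
  assumes lin_left: "y \<in> carrier M2 \<Longrightarrow> linear_map K M1 M3 (\<lambda>x. B x y)"
    and lin_right: "x \<in> carrier M1 \<Longrightarrow> linear_map K M2 M3 (B x)"

text \<open>The unions over representatives are the form in which the products of the tensor and
  semi-symmetric powers are defined.\<close>

lemma bilinear_map_quot:
  assumes "bilinear_map K M1 M2 M3 B"
    and S1: "S1 \<subseteq> carrier M1" and S2: "S2 \<subseteq> carrier M2" and N3: "submodule N3 K M3"
    and B1: "\<And>s y. s \<in> S1 \<Longrightarrow> y \<in> carrier M2 \<Longrightarrow> B s y \<in> N3"
    and B2: "\<And>x s. x \<in> carrier M1 \<Longrightarrow> s \<in> S2 \<Longrightarrow> B x s \<in> N3"
  defines "N1 \<equiv> generated_submodule K M1 S1" and "N2 \<equiv> generated_submodule K M2 S2"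
  defines "C \<equiv> \<lambda>Y Z. \<Union>x\<in>Y. \<Union>y\<in>Z. N3 +>\<^bsub>M3\<^esub> B x y"
  shows "bilinear_map K (quot_module M1 N1) (quot_module M2 N2) (quot_module M3 N3) C" (is ?bil)
    and "x \<in> carrier M1 \<Longrightarrow> y \<in> carrier M2 \<Longrightarrow>
      C (N1 +>\<^bsub>M1\<^esub> x) (N2 +>\<^bsub>M2\<^esub> y) = N3 +>\<^bsub>M3\<^esub> B x y"
proof -
  interpret B: bilinear_map K M1 M2 M3 B by fact
  have N1: "submodule N1 K M1" and N2: "submodule N2 K M2"
    unfolding N1_def N2_def
    using B.M1.generated_submodule_submodule[OF S1] B.M2.generated_submodule_submodule[OF S2] by auto
  \<comment> \<open>For fixed y the x with B x y in N3 form a submodule; containing S1, it contains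
    N1. The second argument is treated in the same way.\<close>
  have B1': "B x y \<in> N3" if "x \<in> N1" "y \<in> carrier M2" for x y
    using B.M1.generated_submodule_least[OF linear_map.vimage_submodule[OF B.lin_left N3], of y S1]
      B1 S1 that unfolding N1_def by blast
  have B2': "B x y \<in> N3" if "x \<in> carrier M1" "y \<in> N2" for x y
    using B.M2.generated_submodule_least[OF linear_map.vimage_submodule[OF B.lin_right N3], of x S2]
      B2 S2 that unfolding N2_def by blast
  have cl: "B x y \<in> carrier M3" if "x \<in> carrier M1" "y \<in> carrier M2" for x y
    using linear_map.closed[OF B.lin_left] that by blast
  have eq: "N3 +>\<^bsub>M3\<^esub> B x' y' = N3 +>\<^bsub>M3\<^esub> B x y"
    if x: "x \<in> carrier M1" and y: "y \<in> carrier M2"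
      and x': "x' \<in> N1 +>\<^bsub>M1\<^esub> x" and y': "y' \<in> N2 +>\<^bsub>M2\<^esub> y" for x x' y y'
  proof -
    have xx: "x' \<in> carrier M1" "x' \<ominus>\<^bsub>M1\<^esub> x \<in> N1"
      using x' B.M1.mem_coset_iff[OF N1 x] B.M1.coset_eq_iff[OF N1 _ x] by auto
    have yy: "y' \<in> carrier M2" "y' \<ominus>\<^bsub>M2\<^esub> y \<in> N2"
      using y' B.M2.mem_coset_iff[OF N2 y] B.M2.coset_eq_iff[OF N2 _ y] by auto
    \<comment> \<open>One argument is exchanged at a time: the first with y' held fixed, then the
      second with x held fixed.\<close>
    have "N3 +>\<^bsub>M3\<^esub> B x' y' = N3 +>\<^bsub>M3\<^esub> B x y'"
      using B1'[OF xx(2) yy(1)] B.M3.coset_eq_iff[OF N3 cl cl] xx yy x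
        linear_map.minus[OF B.lin_left[OF yy(1)] xx(1) x] by simp
    also have "\<dots> = N3 +>\<^bsub>M3\<^esub> B x y"
      using B2'[OF x yy(2)] B.M3.coset_eq_iff[OF N3 cl cl] yy x y
        linear_map.minus[OF B.lin_right[OF x] yy(1) y] by simp
    finally show ?thesis .
  qed
  show C: "C (N1 +>\<^bsub>M1\<^esub> x) (N2 +>\<^bsub>M2\<^esub> y) = N3 +>\<^bsub>M3\<^esub> B x y"
    if "x \<in> carrier M1" "y \<in> carrier M2" for x y
  proof -
    have "x \<in> N1 +>\<^bsub>M1\<^esub> x" "y \<in> N2 +>\<^bsub>M2\<^esub> y"
      using that B.M1.mem_coset_iff[OF N1] B.M2.mem_coset_iff[OF N2] by auto
    then show ?thesis using eq[OF that] unfolding C_def by blast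
  qed
  interpret q1: linear_map K M1 "quot_module M1 N1" "\<lambda>x. N1 +>\<^bsub>M1\<^esub> x"
    by (rule quot_module_linear[OF B.M1.module_axioms N1])
  interpret q2: linear_map K M2 "quot_module M2 N2" "\<lambda>x. N2 +>\<^bsub>M2\<^esub> x"
    by (rule quot_module_linear[OF B.M2.module_axioms N2])
  interpret q3: linear_map K M3 "quot_module M3 N3" "\<lambda>x. N3 +>\<^bsub>M3\<^esub> x"
    by (rule quot_module_linear[OF B.M3.module_axioms N3])
  show ?bil
  proof (intro bilinear_map.intro bilinear_map_axioms.intro)
    fix Z assume "Z \<in> carrier (quot_module M2 N2)"
    then obtain z where z: "z \<in> carrier M2" "Z = N2 +>\<^bsub>M2\<^esub> z" by (auto simp: carrier_quot_module)
    interpret b: linear_map K M1 M3 "\<lambda>x. B x z" by (rule B.lin_left[OF z(1)])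
    show "linear_map K (quot_module M1 N1) (quot_module M3 N3) (\<lambda>Y. C Y Z)"
    proof (unfold_locales, unfold z(2) carrier_quot_module[of M1])
      fix Y Y' assume "Y \<in> (\<lambda>x. N1 +>\<^bsub>M1\<^esub> x) ` carrier M1" "Y' \<in> (\<lambda>x. N1 +>\<^bsub>M1\<^esub> x) ` carrier M1"
      then show "C (Y \<oplus>\<^bsub>quot_module M1 N1\<^esub> Y') (N2 +>\<^bsub>M2\<^esub> z) =
          C Y (N2 +>\<^bsub>M2\<^esub> z) \<oplus>\<^bsub>quot_module M3 N3\<^esub> C Y' (N2 +>\<^bsub>M2\<^esub> z)"
        using z by (auto simp: C b.add b.closed simp flip: q1.add q3.add)
    next
      fix c Y assume "c \<in> carrier K" "Y \<in> (\<lambda>x. N1 +>\<^bsub>M1\<^esub> x) ` carrier M1"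
      then show "C (c \<odot>\<^bsub>quot_module M1 N1\<^esub> Y) (N2 +>\<^bsub>M2\<^esub> z) =
          c \<odot>\<^bsub>quot_module M3 N3\<^esub> C Y (N2 +>\<^bsub>M2\<^esub> z)"
        using z by (auto simp: C b.smult b.closed simp flip: q1.smult q3.smult)
    qed (use z in \<open>auto simp: C carrier_quot_module b.closed\<close>)
  next
    fix Y assume "Y \<in> carrier (quot_module M1 N1)"
    then obtain a where a: "a \<in> carrier M1" "Y = N1 +>\<^bsub>M1\<^esub> a" by (auto simp: carrier_quot_module)
    interpret b: linear_map K M2 M3 "B a" by (rule B.lin_right[OF a(1)])
    show "linear_map K (quot_module M2 N2) (quot_module M3 N3) (C Y)"
    proof (unfold_locales, unfold a(2) carrier_quot_module[of M2])
      fix Z Z' assume "Z \<in> (\<lambda>x. N2 +>\<^bsub>M2\<^esub> x) ` carrier M2" "Z' \<in> (\<lambda>x. N2 +>\<^bsub>M2\<^esub> x) ` carrier M2"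
      then show "C (N1 +>\<^bsub>M1\<^esub> a) (Z \<oplus>\<^bsub>quot_module M2 N2\<^esub> Z') =
          C (N1 +>\<^bsub>M1\<^esub> a) Z \<oplus>\<^bsub>quot_module M3 N3\<^esub> C (N1 +>\<^bsub>M1\<^esub> a) Z'"
        using a by (auto simp: C b.add b.closed simp flip: q2.add q3.add)
    next
      fix c Z assume "c \<in> carrier K" "Z \<in> (\<lambda>x. N2 +>\<^bsub>M2\<^esub> x) ` carrier M2"
      then show "C (N1 +>\<^bsub>M1\<^esub> a) (c \<odot>\<^bsub>quot_module M2 N2\<^esub> Z) =
          c \<odot>\<^bsub>quot_module M3 N3\<^esub> C (N1 +>\<^bsub>M1\<^esub> a) Z"
        using a by (auto simp: C b.smult b.closed simp flip: q2.smult q3.smult)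
    qed (use a in \<open>auto simp: C carrier_quot_module b.closed\<close>)
  qed (rule q1.N.module_axioms q2.N.module_axioms q3.N.module_axioms)+
qed

text \<open>The map k obtained from the universal property depends only on the coset, so all members
  of the union defining g are equal and g agrees with k.\<close>

lemma linear_map_quot:
  assumes lin: "linear_map K M M' h" and S: "S \<subseteq> carrier M" and N': "submodule N' K M'"
    and hS: "\<And>s. s \<in> S \<Longrightarrow> h s \<in> N'"
  defines "N \<equiv> generated_submodule K M S"
  defines "g \<equiv> \<lambda>A. \<Union>x\<in>A. N' +>\<^bsub>M'\<^esub> h x"
  shows "linear_map K (quot_module M N) (quot_module M' N') g"
    and "x \<in> carrier M \<Longrightarrow> g (N +>\<^bsub>M\<^esub> x) = N' +>\<^bsub>M'\<^esub> h x"
proof -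
  interpret h: linear_map K M M' h by fact
  have N: "submodule N K M" unfolding N_def by (rule h.M.generated_submodule_submodule[OF S])
  interpret q': linear_map K M' "quot_module M' N'" "\<lambda>x. N' +>\<^bsub>M'\<^esub> x"
    by (rule quot_module_linear[OF h.N.module_axioms N'])
  interpret q: linear_map K M "quot_module M N" "\<lambda>x. N +>\<^bsub>M\<^esub> x"
    by (rule quot_module_linear[OF h.M.module_axioms N])
  have "N' +>\<^bsub>M'\<^esub> h s = \<zero>\<^bsub>quot_module M' N'\<^esub>" if "s \<in> S" for s
    using hS[OF that] S that h.N.coset_eq_self_iff[OF N'] h.closed by (auto simp: zero_quot_module)
  then obtain k where k: "linear_map K (quot_module M N) (quot_module M' N') k"
    "\<And>x. x \<in> carrier M \<Longrightarrow> k (N +>\<^bsub>M\<^esub> x) = N' +>\<^bsub>M'\<^esub> h x"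
    using quot_module_universal[OF linear_map_comp[OF lin q'.linear_map_axioms] S]
    unfolding N_def by blast
  have "N' +>\<^bsub>M'\<^esub> h y = N' +>\<^bsub>M'\<^esub> h x" if "x \<in> carrier M" "y \<in> N +>\<^bsub>M\<^esub> x" for x y
    using that k(2) h.M.mem_coset_iff[OF N] by metis
  moreover have "x \<in> N +>\<^bsub>M\<^esub> x" if "x \<in> carrier M" for x
    using that h.M.mem_coset_iff[OF N] by auto
  ultimately show g: "g (N +>\<^bsub>M\<^esub> x) = N' +>\<^bsub>M'\<^esub> h x" if "x \<in> carrier M" for x
    using that unfolding g_def by blast
  show "linear_map K (quot_module M N) (quot_module M' N') g"
    by unfold_locales
      (auto simp: carrier_quot_module g h.closed h.add h.smult
        simp flip: q.add q.smult q'.add q'.smult)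
qed

section \<open>Free modules and dual coordinates\<close>

lemma free_moduleD:
  assumes "f \<in> carrier (free_module K A)"
  shows "a \<notin> A \<Longrightarrow> f a = \<zero>\<^bsub>K\<^esub>" "finite {a. f a \<noteq> \<zero>\<^bsub>K\<^esub>}"
  using assms by (auto simp: free_module_def)

lemma (in cring) free_module_closed:
  "f \<in> carrier (free_module R A) \<Longrightarrow> f a \<in> carrier R"
  by (cases "a \<in> A") (auto simp: free_module_def)

lemma (in cring) module_free_module: "module R (free_module R A)"
proof -
  have fin: "finite {a. f a \<oplus> g a \<noteq> \<zero>}"
    if "finite {a. f a \<noteq> \<zero>}" "finite {a. g a \<noteq> \<zero>}" for f g :: "_ \<Rightarrow> 'a"
    by (rule finite_subset[OF _ finite_UnI[OF that]]) auto
  have fin': "finite {a. c \<otimes> f a \<noteq> \<zero>}"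
    if "c \<in> carrier R" "finite {a. f a \<noteq> \<zero>}" for c and f :: "_ \<Rightarrow> 'a"
    by (rule finite_subset[OF _ that(2)]) (use that(1) in auto)
  note cl = free_module_closed
  show ?thesis
  proof (rule moduleI)
    show "abelian_group (free_module R A)"
    proof (rule abelian_groupI)
      fix f assume f: "f \<in> carrier (free_module R A)"
      have "{a. \<ominus> f a \<noteq> \<zero>} \<subseteq> {a. f a \<noteq> \<zero>}" by auto
      then have "(\<lambda>a. \<ominus> f a) \<in> carrier (free_module R A)"
        using f finite_subset by (fastforce simp: free_module_def)
      moreover have "(\<lambda>a. \<ominus> f a) \<oplus>\<^bsub>free_module R A\<^esub> f = \<zero>\<^bsub>free_module R A\<^esub>"
        using cl[OF f] by (simp add: free_module_def l_neg)
      ultimately show "\<exists>g\<in>carrier (free_module R A). g \<oplus>\<^bsub>free_module R A\<^esub> f = \<zero>\<^bsub>free_module R A\<^esub>"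
        by blast
    next
      fix f g assume "f \<in> carrier (free_module R A)" "g \<in> carrier (free_module R A)"
      then show "f \<oplus>\<^bsub>free_module R A\<^esub> g \<in> carrier (free_module R A)"
        by (auto simp: free_module_def fin)
      show "f \<oplus>\<^bsub>free_module R A\<^esub> g = g \<oplus>\<^bsub>free_module R A\<^esub> f"
        using cl[OF \<open>f \<in> _\<close>] cl[OF \<open>g \<in> _\<close>] by (simp add: free_module_def fun_eq_iff a_comm)
    next
      fix f g h assume "f \<in> carrier (free_module R A)" "g \<in> carrier (free_module R A)"
        "h \<in> carrier (free_module R A)"
      from this[THEN cl] show "f \<oplus>\<^bsub>free_module R A\<^esub> g \<oplus>\<^bsub>free_module R A\<^esub> h =
          f \<oplus>\<^bsub>free_module R A\<^esub> (g \<oplus>\<^bsub>free_module R A\<^esub> h)"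
        by (simp add: free_module_def fun_eq_iff a_assoc)
    next
      fix f assume "f \<in> carrier (free_module R A)"
      from this[THEN cl] show "\<zero>\<^bsub>free_module R A\<^esub> \<oplus>\<^bsub>free_module R A\<^esub> f = f"
        by (simp add: free_module_def)
    qed (simp add: free_module_def)
  next
    fix c f assume "c \<in> carrier R" "f \<in> carrier (free_module R A)"
    then show "c \<odot>\<^bsub>free_module R A\<^esub> f \<in> carrier (free_module R A)"
      by (auto simp: free_module_def fin')
  next
    fix c d f assume "c \<in> carrier R" "d \<in> carrier R" "f \<in> carrier (free_module R A)"
    with cl[OF this(3)] show
      "(c \<oplus> d) \<odot>\<^bsub>free_module R A\<^esub> f =
        c \<odot>\<^bsub>free_module R A\<^esub> f \<oplus>\<^bsub>free_module R A\<^esub> d \<odot>\<^bsub>free_module R A\<^esub> f"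
      "(c \<otimes> d) \<odot>\<^bsub>free_module R A\<^esub> f = c \<odot>\<^bsub>free_module R A\<^esub> (d \<odot>\<^bsub>free_module R A\<^esub> f)"
      by (simp_all add: free_module_def fun_eq_iff l_distr m_assoc)
  next
    fix c f g assume "c \<in> carrier R" "f \<in> carrier (free_module R A)"
      "g \<in> carrier (free_module R A)"
    with cl[OF this(2)] cl[OF this(3)] show
      "c \<odot>\<^bsub>free_module R A\<^esub> (f \<oplus>\<^bsub>free_module R A\<^esub> g) =
        c \<odot>\<^bsub>free_module R A\<^esub> f \<oplus>\<^bsub>free_module R A\<^esub> c \<odot>\<^bsub>free_module R A\<^esub> g"
      by (simp add: free_module_def fun_eq_iff r_distr)
  next
    fix f assume "f \<in> carrier (free_module R A)"
    from this[THEN cl] show "\<one> \<odot>\<^bsub>free_module R A\<^esub> f = f"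
      by (simp add: free_module_def)
  qed (rule is_cring)
qed

lemma (in cring) free_gen_closed: "x \<in> A \<Longrightarrow> free_gen R x \<in> carrier (free_module R A)"
  by (auto simp: free_module_def free_gen_def)

text \<open>The induction runs over a finite set containing the support instead of the support
  itself: removing the coordinate s leaves the support unchanged if f s is zero, but always shrinks
  the enclosing set.\<close>

lemma (in cring) free_module_generated:
  "generated_submodule R (free_module R A) (free_gen R ` A) = carrier (free_module R A)"
proof -
  let ?F = "free_module R A"
  interpret F: module R ?F by (rule module_free_module)
  show ?thesis
  proof (rule F.generated_submodule_eqI)
    show "free_gen R ` A \<subseteq> carrier ?F" using free_gen_closed by auto
    fix N assume N: "submodule N R ?F" "free_gen R ` A \<subseteq> N"
    have "f \<in> N" if "finite S" "f \<in> carrier ?F" "{a. f a \<noteq> \<zero>} \<subseteq> S" for S f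
      using that
    proof (induction S arbitrary: f)
      case empty
      then have "f = \<zero>\<^bsub>?F\<^esub>" by (auto simp: free_module_def)
      then show ?case using F.submodule_zero[OF N(1)] by simp
    next
      case (insert s S)
      show ?case
      proof (cases "s \<in> A")
        case True
        have f': "f(s := \<zero>) \<in> carrier ?F"
          using insert.prems(1)
          by (auto simp: free_module_def intro: finite_subset[of _ "{a. f a \<noteq> \<zero>}"])
        moreover have "{a. (f(s := \<zero>)) a \<noteq> \<zero>} \<subseteq> S" using insert.prems(2) by auto
        ultimately have "f(s := \<zero>) \<in> N" by (rule insert.IH)
        moreover have "f s \<odot>\<^bsub>?F\<^esub> free_gen R s \<in> N"
          using F.submoduleE(4)[OF N(1)] N(2) True free_module_closed[OF insert.prems(1)] by blast
        ultimately have "f(s := \<zero>) \<oplus>\<^bsub>?F\<^esub> f s \<odot>\<^bsub>?F\<^esub> free_gen R s \<in> N"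
          by (rule F.submoduleE(5)[OF N(1)])
        moreover have "f(s := \<zero>) \<oplus>\<^bsub>?F\<^esub> f s \<odot>\<^bsub>?F\<^esub> free_gen R s = f"
          using free_module_closed[OF insert.prems(1)]
          by (auto simp: free_module_def free_gen_def fun_eq_iff)
        ultimately show ?thesis by simp
      next
        case False
        then have "f s = \<zero>" by (rule free_moduleD(1)[OF insert.prems(1)])
        then have "{a. f a \<noteq> \<zero>} \<subseteq> S" using insert.prems(2) by auto
        then show ?thesis by (rule insert.IH[OF insert.prems(1)])
      qed
    qed
    then show "carrier ?F \<subseteq> N" using free_moduleD(2) by blast
  qed
qed

lemma free_module_lift:
  fixes M :: "('k, 'b, 'n) module_scheme"
  assumes "module K M" and g: "g \<in> A \<rightarrow> carrier M"
  defines "h \<equiv> \<lambda>f. finsum M (\<lambda>a. f a \<odot>\<^bsub>M\<^esub> g a) {a. f a \<noteq> \<zero>\<^bsub>K\<^esub>}"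
  shows "linear_map K (free_module K A) M h"
    and "a \<in> A \<Longrightarrow> h (free_gen K a) = g a"
proof -
  interpret M: module K M by fact
  let ?F = "free_module K A"
  interpret F: module K ?F by (rule M.R.module_free_module)
  have supp: "{a. f a \<noteq> \<zero>\<^bsub>K\<^esub>} \<subseteq> A" if "f \<in> carrier ?F" for f
    using free_moduleD(1)[OF that] by auto
  have g': "(\<lambda>a. f a \<odot>\<^bsub>M\<^esub> g a) \<in> S \<rightarrow> carrier M" if "f \<in> carrier ?F" "S \<subseteq> A" for f S
    using M.R.free_module_closed[OF that(1)] g that(2) by auto
  \<comment> \<open>The sum in h runs over the support of its argument. Enlarging it to any finite S
    inside A lets x, y and their sum be evaluated over one common index set.\<close>
  have h: "h f = finsum M (\<lambda>a. f a \<odot>\<^bsub>M\<^esub> g a) S"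
    if f: "f \<in> carrier ?F" and S: "finite S" "S \<subseteq> A" "{a. f a \<noteq> \<zero>\<^bsub>K\<^esub>} \<subseteq> S" for f S
    unfolding h_def
    by (rule M.add.finprod_mono_neutral_cong_left) (use S g g'[OF f S(2)] in \<open>auto simp: Pi_def\<close>)
  show "linear_map K ?F M h"
  proof (intro linear_map.intro linear_map_axioms.intro M.module_axioms F.module_axioms)
    fix x assume x: "x \<in> carrier ?F"
    show "h x \<in> carrier M"
      unfolding h_def by (rule M.finsum_closed[OF g'[OF x supp[OF x]]])
  next
    fix x y assume x: "x \<in> carrier ?F" and y: "y \<in> carrier ?F"
    let ?S = "{a. x a \<noteq> \<zero>\<^bsub>K\<^esub>} \<union> {a. y a \<noteq> \<zero>\<^bsub>K\<^esub>}"
    have S: "finite ?S" "?S \<subseteq> A"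
      using x y free_moduleD(2) supp by blast+
    have xy: "x \<oplus>\<^bsub>?F\<^esub> y = (\<lambda>a. x a \<oplus>\<^bsub>K\<^esub> y a)" by (simp add: free_module_def)
    have "h (x \<oplus>\<^bsub>?F\<^esub> y) = finsum M (\<lambda>a. (x a \<oplus>\<^bsub>K\<^esub> y a) \<odot>\<^bsub>M\<^esub> g a) ?S"
      using h[OF F.a_closed[OF x y] S] unfolding xy by fastforce
    also have "\<dots> = finsum M (\<lambda>a. x a \<odot>\<^bsub>M\<^esub> g a \<oplus>\<^bsub>M\<^esub> y a \<odot>\<^bsub>M\<^esub> g a) ?S"
    proof (rule M.finsum_cong')
      fix a assume "a \<in> ?S"
      then have "g a \<in> carrier M" using S(2) g by blast
      then show "(x a \<oplus>\<^bsub>K\<^esub> y a) \<odot>\<^bsub>M\<^esub> g a = x a \<odot>\<^bsub>M\<^esub> g a \<oplus>\<^bsub>M\<^esub> y a \<odot>\<^bsub>M\<^esub> g a"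
        using M.R.free_module_closed x y M.smult_l_distr by metis
    qed (use g'[OF x S(2)] g'[OF y S(2)] in \<open>auto simp: Pi_def\<close>)
    also have "\<dots> = h x \<oplus>\<^bsub>M\<^esub> h y"
      using h[OF x S] h[OF y S] M.finsum_addf[OF g'[OF x S(2)] g'[OF y S(2)]] by simp
    finally show "h (x \<oplus>\<^bsub>?F\<^esub> y) = h x \<oplus>\<^bsub>M\<^esub> h y" .
  next
    fix c x assume c: "c \<in> carrier K" and x: "x \<in> carrier ?F"
    let ?S = "{a. x a \<noteq> \<zero>\<^bsub>K\<^esub>}"
    have S: "finite ?S" "?S \<subseteq> A" using free_moduleD(2)[OF x] supp[OF x] by auto
    have cx: "c \<odot>\<^bsub>?F\<^esub> x = (\<lambda>a. c \<otimes>\<^bsub>K\<^esub> x a)" by (simp add: free_module_def)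
    have "h (c \<odot>\<^bsub>?F\<^esub> x) = finsum M (\<lambda>a. (c \<otimes>\<^bsub>K\<^esub> x a) \<odot>\<^bsub>M\<^esub> g a) ?S"
    proof -
      have "{a. c \<otimes>\<^bsub>K\<^esub> x a \<noteq> \<zero>\<^bsub>K\<^esub>} \<subseteq> ?S" using c by auto
      then show ?thesis using h[OF F.smult_closed[OF c x] S] unfolding cx by blast
    qed
    also have "\<dots> = finsum M (\<lambda>a. c \<odot>\<^bsub>M\<^esub> (x a \<odot>\<^bsub>M\<^esub> g a)) ?S"
    proof (rule M.finsum_cong')
      fix a assume "a \<in> ?S"
      then have "g a \<in> carrier M" using S(2) g by blast
      then show "(c \<otimes>\<^bsub>K\<^esub> x a) \<odot>\<^bsub>M\<^esub> g a = c \<odot>\<^bsub>M\<^esub> (x a \<odot>\<^bsub>M\<^esub> g a)"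
        using M.R.free_module_closed[OF x] c M.smult_assoc1 by blast
    qed (use g'[OF x S(2)] c in \<open>auto simp: Pi_def\<close>)
    also have "\<dots> = c \<odot>\<^bsub>M\<^esub> h x"
      unfolding h_def using M.finsum_smult_ldistr[OF S(1) c g'[OF x S(2)]] by simp
    finally show "h (c \<odot>\<^bsub>?F\<^esub> x) = c \<odot>\<^bsub>M\<^esub> h x" .
  qed
  show "h (free_gen K a) = g a" if a: "a \<in> A"
  proof -
    have "h (free_gen K a) = finsum M (\<lambda>b. free_gen K a b \<odot>\<^bsub>M\<^esub> g b) {a}"
      by (rule h) (use a M.R.free_gen_closed in \<open>auto simp: free_gen_def\<close>)
    also have "\<dots> = g a" using a g by (auto simp: free_gen_def Pi_def)
    finally show ?thesis .
  qed
qed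

text \<open>K as a module over itself, so that linear functionals are instances of
  \<open>linear_map\<close> and the universal properties apply to them.\<close>

definition scalar_module :: "('k, 'm) ring_scheme \<Rightarrow> ('k, 'k) module" where
  "scalar_module K = \<lparr>carrier = carrier K, monoid.mult = (\<otimes>\<^bsub>K\<^esub>), one = \<one>\<^bsub>K\<^esub>,
     zero = \<zero>\<^bsub>K\<^esub>, add = (\<oplus>\<^bsub>K\<^esub>), smult = (\<otimes>\<^bsub>K\<^esub>)\<rparr>"

lemma scalar_module_simps [simp]:
  "carrier (scalar_module K) = carrier K" "\<zero>\<^bsub>scalar_module K\<^esub> = \<zero>\<^bsub>K\<^esub>"
  "x \<oplus>\<^bsub>scalar_module K\<^esub> y = x \<oplus>\<^bsub>K\<^esub> y" "x \<odot>\<^bsub>scalar_module K\<^esub> y = x \<otimes>\<^bsub>K\<^esub> y"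
  by (simp_all add: scalar_module_def)

lemma (in cring) module_scalar_module: "module R (scalar_module R)"
proof (rule moduleI)
  show "abelian_group (scalar_module R)"
    by (rule abelian_groupI) (auto simp: a_ac intro: exI[of _ "\<ominus> _"] l_neg)
qed (auto simp: is_cring l_distr r_distr m_assoc)

lemma linear_map_inv:
  assumes "linear_map K M N h" and bij: "bij_betw h (carrier M) (carrier N)"
  shows "linear_map K N M (inv_into (carrier M) h)"
proof -
  interpret h: linear_map K M N h by fact
  let ?k = "inv_into (carrier M) h"
  have k: "?k (h x) = x" if "x \<in> carrier M" for x
    using bij that by (simp add: bij_betw_def)
  have onto: "carrier N = h ` carrier M" using bij by (simp add: bij_betw_def)
  show ?thesis
    by unfold_locales (auto simp: onto k simp flip: h.add h.smult)
qed

text \<open>Forming linear combinations maps the free module on L bijectively onto E: independence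
  gives injectivity, generation surjectivity. The functional \<phi> l is the l-th coordinate of the
  inverse. For l outside L this coordinate is zero, so linearity holds for all l without a side
  condition.\<close>

lemma module_basis_dual:
  fixes E :: "('k, 'e, 'n) module_scheme"
  assumes "module_basis K E L b"
  obtains \<phi> where "\<And>l. linear_map K E (scalar_module K) (\<phi> l)"
    "\<And>l l'. l' \<in> L \<Longrightarrow> \<phi> l (b l') = (if l = l' then \<one>\<^bsub>K\<^esub> else \<zero>\<^bsub>K\<^esub>)"
proof -
  interpret E: module_basis K E L b by fact
  let ?F = "free_module K L"
  define h where "h = (\<lambda>f. finsum E (\<lambda>l. f l \<odot>\<^bsub>E\<^esub> b l) {l. f l \<noteq> \<zero>\<^bsub>K\<^esub>})"
  have hl: "linear_map K ?F E h" and hb: "\<And>l. l \<in> L \<Longrightarrow> h (free_gen K l) = b l"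
    using free_module_lift[OF E.module_axioms E.in_carrier] unfolding h_def by blast+
  interpret h: linear_map K ?F E h by (rule hl)
  have "f = \<zero>\<^bsub>?F\<^esub>" if f: "f \<in> carrier ?F" and "h f = \<zero>\<^bsub>E\<^esub>" for f
  proof -
    have "f l = \<zero>\<^bsub>K\<^esub>" if "f l \<noteq> \<zero>\<^bsub>K\<^esub>" for l
      using E.independent[of "{l. f l \<noteq> \<zero>\<^bsub>K\<^esub>}" f l] \<open>h f = \<zero>\<^bsub>E\<^esub>\<close> free_moduleD[OF f] that
        E.R.free_module_closed[OF f] unfolding h_def by auto
    then show ?thesis by (auto simp: free_module_def)
  qed
  then have "inj_on h (carrier ?F)"
    using h.minus h.M.minus_eq_zero_iff E.minus_eq_zero_iff h.M.minus_closed h.closed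
    by (intro inj_onI) metis
  moreover have "b ` L \<subseteq> h ` carrier ?F"
    using hb E.R.free_gen_closed by force
  then have "carrier E \<subseteq> h ` carrier ?F"
    using E.generated_submodule_least[OF h.image_submodule] unfolding E.generates[symmetric] by blast
  ultimately have "bij_betw h (carrier ?F) (carrier E)"
    using h.closed by (auto simp: bij_betw_def)
  then interpret k: linear_map K E ?F "inv_into (carrier ?F) h"
    by (rule linear_map_inv[OF hl])
  have kb: "inv_into (carrier ?F) h (b l) = free_gen K l" if "l \<in> L" for l
    using \<open>inj_on h (carrier ?F)\<close> E.R.free_gen_closed[OF that] hb[OF that]
    by (metis inv_into_f_f)
  show thesis
  proof
    fix l
    show "linear_map K E (scalar_module K) (\<lambda>x. inv_into (carrier ?F) h x l)"
      by (intro linear_map.intro linear_map_axioms.intro E.module_axioms E.R.module_scalar_module)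
        (use E.R.free_module_closed[OF k.closed] in \<open>auto simp: k.add k.smult, auto simp: free_module_def\<close>)
    fix l' assume "l' \<in> L"
    then show "inv_into (carrier ?F) h (b l') l = (if l = l' then \<one>\<^bsub>K\<^esub> else \<zero>\<^bsub>K\<^esub>)"
      by (simp add: kb free_gen_def)
  qed
qed

text \<open>Applying the functional of i to the relation leaves c i times its value at b i, which is
  cancelled in the domain. Nonvanishing is asked for instead of the value 1, because the averaged
  functionals take the order of a stabilizer.\<close>

lemma independent_by_functionals:
  assumes "domain K" and M: "module K M" and b: "b \<in> I \<rightarrow> carrier M"
    and "\<And>i. i \<in> I \<Longrightarrow> \<exists>h. linear_map K M (scalar_module K) h \<and> h (b i) \<noteq> \<zero>\<^bsub>K\<^esub> \<and>
      (\<forall>j\<in>I. j \<noteq> i \<longrightarrow> h (b j) = \<zero>\<^bsub>K\<^esub>)"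
    and F: "finite F" "F \<subseteq> I" and c: "c \<in> F \<rightarrow> carrier K"
    and sum: "finsum M (\<lambda>j. c j \<odot>\<^bsub>M\<^esub> b j) F = \<zero>\<^bsub>M\<^esub>" and i: "i \<in> F"
  shows "c i = \<zero>\<^bsub>K\<^esub>"
proof -
  interpret domain K by fact
  obtain h where "linear_map K M (scalar_module K) h" and hi: "h (b i) \<noteq> \<zero>\<^bsub>K\<^esub>"
    and hj: "\<And>j. j \<in> I \<Longrightarrow> j \<noteq> i \<Longrightarrow> h (b j) = \<zero>\<^bsub>K\<^esub>"
    using assms(4) F(2) i by blast
  interpret h: linear_map K M "scalar_module K" h by fact
  have bF: "b j \<in> carrier M" "c j \<in> carrier K" if "j \<in> F" for j using that b c F(2) by auto
  have hb: "h (b j) \<in> carrier K" if "j \<in> F" for j using h.closed[OF bF(1)[OF that]] by simp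
  have "\<zero>\<^bsub>K\<^esub> = finsum (scalar_module K) (\<lambda>j. h (c j \<odot>\<^bsub>M\<^esub> b j)) F"
    using h.finsum[of "\<lambda>j. c j \<odot>\<^bsub>M\<^esub> b j" F] bF h.zero sum by (simp add: Pi_def)
  also have "\<dots> = finsum (scalar_module K) (\<lambda>j. if i = j then c j \<otimes>\<^bsub>K\<^esub> h (b j) else \<zero>\<^bsub>scalar_module K\<^esub>) F"
    by (rule h.N.finsum_cong') (use bF hb hj F(2) in \<open>auto simp: h.smult Pi_def\<close>)
  also have "\<dots> = c i \<otimes>\<^bsub>K\<^esub> h (b i)"
    by (rule h.N.finsum_singleton[OF i F(1)]) (use bF hb in \<open>auto simp: Pi_def\<close>)
  finally have "c i \<otimes>\<^bsub>K\<^esub> h (b i) = \<zero>\<^bsub>K\<^esub>" ..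
  then show ?thesis using integral hi hb bF i by blast
qed

section \<open>Permutations of tuples\<close>

lemma length_perm_tuple [simp]: "length (perm_tuple \<sigma> xs) = length xs"
  by (simp add: perm_tuple_def del: upt_Suc)

lemma nth_perm_tuple:
  "t < length xs \<Longrightarrow> perm_tuple \<sigma> xs ! t = xs ! (inv' \<sigma> (Suc t) - 1)"
  by (simp add: perm_tuple_def del: upt_Suc)

lemma perm_tuple_id [simp]: "perm_tuple id xs = xs"
  by (rule nth_equalityI) (simp_all add: nth_perm_tuple)

text \<open>Positions run from 1 to d, list indices from 0. As \<sigma> maps {1..d} to itself,
  \<sigma> (Suc t) is positive and the truncated subtraction loses nothing.\<close>

lemma permutes_index:
  assumes "\<sigma> permutes {1..d}" "t < d"
  shows "\<sigma> (Suc t) - 1 < d" "Suc (\<sigma> (Suc t) - 1) = \<sigma> (Suc t)"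
  using permutes_in_image[OF assms(1), of "Suc t"] assms(2) by auto

text \<open>Inversion reverses the order of a composition, and reading entries through positions
  reverses it once more; the inverse in \<open>perm_tuple\<close> thus makes this a left
  action.\<close>

lemma perm_tuple_comp:
  assumes "\<sigma> permutes {1..length xs}" "\<tau> permutes {1..length xs}"
  shows "perm_tuple \<sigma> (perm_tuple \<tau> xs) = perm_tuple (\<sigma> \<circ> \<tau>) xs"
proof (rule nth_equalityI)
  fix t assume "t < length (perm_tuple \<sigma> (perm_tuple \<tau> xs))"
  then have "t < length xs" by simp
  note i = permutes_index[OF permutes_inv[OF assms(1)] this]
  have "inv' (\<sigma> \<circ> \<tau>) = inv' \<tau> \<circ> inv' \<sigma>"
    using assms permutes_bij by (intro o_inv_distrib) auto
  then show "perm_tuple \<sigma> (perm_tuple \<tau> xs) ! t = perm_tuple (\<sigma> \<circ> \<tau>) xs ! t"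
    using i \<open>t < length xs\<close> by (simp add: nth_perm_tuple)
qed simp

lemma perm_tuple_inv:
  assumes "\<sigma> permutes {1..length xs}"
  shows "perm_tuple (inv' \<sigma>) (perm_tuple \<sigma> xs) = xs" "perm_tuple \<sigma> (perm_tuple (inv' \<sigma>) xs) = xs"
  using assms by (simp_all add: perm_tuple_comp permutes_inv permutes_inv_o)

lemma tuples_list_update:
  "xs \<in> tuples A d \<Longrightarrow> x \<in> A \<Longrightarrow> xs[t := x] \<in> tuples A d"
  using set_update_subset_insert[of xs t x] by (auto simp: tuples_def)

lemma tuples_append: "xs \<in> tuples A p \<Longrightarrow> ys \<in> tuples A q \<Longrightarrow> xs @ ys \<in> tuples A (p + q)"
  by (auto simp: tuples_def)

lemma tuples_perm_tuple_iff:
  assumes "\<sigma> permutes {1..d}"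
  shows "perm_tuple \<sigma> xs \<in> tuples A d \<longleftrightarrow> xs \<in> tuples A d"
proof -
  have *: "perm_tuple \<tau> ys \<in> tuples A d" if "\<tau> permutes {1..d}" "ys \<in> tuples A d" for \<tau> ys
  proof -
    have "set (perm_tuple \<tau> ys) \<subseteq> set ys"
    proof
      fix y assume "y \<in> set (perm_tuple \<tau> ys)"
      then obtain t where "t < d" "y = ys ! (inv' \<tau> (Suc t) - 1)"
        using \<open>ys \<in> _\<close> by (auto simp: in_set_conv_nth nth_perm_tuple tuples_def)
      then show "y \<in> set ys"
        using permutes_index(1)[OF permutes_inv[OF \<open>\<tau> permutes _\<close>]] \<open>ys \<in> _\<close>
        by (auto simp: tuples_def)
    qed
    then show ?thesis using \<open>ys \<in> _\<close> by (auto simp: tuples_def)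
  qed
  show ?thesis
  proof
    assume "perm_tuple \<sigma> xs \<in> tuples A d"
    then have "perm_tuple (inv' \<sigma>) (perm_tuple \<sigma> xs) \<in> tuples A d" and "length xs = d"
      using *[OF permutes_inv[OF assms]] by (auto simp: tuples_def)
    then show "xs \<in> tuples A d" using assms by (simp add: perm_tuple_inv)
  qed (rule *[OF assms])
qed

lemma perm_tuple_map:
  assumes "\<sigma> permutes {1..length xs}"
  shows "perm_tuple \<sigma> (map f xs) = map f (perm_tuple \<sigma> xs)"
  using permutes_index(1)[OF permutes_inv[OF assms]]
  by (intro nth_equalityI) (simp_all add: nth_perm_tuple)

text \<open>The entry at index t has position t + 1 and is carried to position \<sigma> (Suc t),
  that is, to index \<sigma> (Suc t) - 1. This is why permuting slots preserves tensor relators and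
  multilinearity.\<close>

lemma perm_tuple_list_update:
  assumes "\<sigma> permutes {1..length xs}" "t < length xs"
  shows "perm_tuple \<sigma> (xs[t := x]) = (perm_tuple \<sigma> xs)[\<sigma> (Suc t) - 1 := x]"
proof (rule nth_equalityI)
  fix s assume "s < length (perm_tuple \<sigma> (xs[t := x]))"
  then have s: "s < length xs" by simp
  note i = permutes_index[OF permutes_inv[OF assms(1)] s] and j = permutes_index[OF assms]
  have "inv' \<sigma> (Suc s) - 1 = t \<longleftrightarrow> s = \<sigma> (Suc t) - 1"
    using i j permutes_inverses[OF assms(1)] by (metis diff_Suc_1)
  then show "perm_tuple \<sigma> (xs[t := x]) ! s = (perm_tuple \<sigma> xs)[\<sigma> (Suc t) - 1 := x] ! s"
    using s i j by (auto simp: nth_perm_tuple nth_list_update)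
qed simp

text \<open>\<sigma> fixes every position beyond the first block. With
  \<open>perm_tuple_omega_pow\<close> for the last block, this describes how permutations of either
  factor act on a product.\<close>

lemma perm_tuple_append:
  assumes "\<sigma> permutes {1..length xs}"
  shows "perm_tuple \<sigma> (xs @ ys) = perm_tuple \<sigma> xs @ ys"
proof (rule nth_equalityI)
  fix t assume t: "t < length (perm_tuple \<sigma> (xs @ ys))"
  show "perm_tuple \<sigma> (xs @ ys) ! t = (perm_tuple \<sigma> xs @ ys) ! t"
  proof (cases "t < length xs")
    case True
    then show ?thesis using t permutes_index[OF permutes_inv[OF assms] True]
      by (simp add: nth_perm_tuple nth_append)
  next
    case False
    then have "inv' \<sigma> (Suc t) = Suc t" by (intro permutes_not_in[OF permutes_inv[OF assms]]) simp
    then show ?thesis using t False by (simp add: nth_perm_tuple nth_append)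
  qed
qed simp

section \<open>The shift \<omega> and its iterates\<close>

lemma omega_comp: "omega (\<sigma> \<circ> \<tau>) = omega \<sigma> \<circ> omega \<tau>" if "\<tau> permutes {1..d}"
proof
  fix t
  \<comment> \<open>\<tau> fixes 0 and is injective, so \<tau> (t - 1) + 1 exceeds 1 and the outer
    \<open>omega\<close> takes its shifting branch.\<close>
  have "\<tau> (t - 1) \<noteq> 0" if "\<not> t \<le> 1"
    using permutes_not_in[OF \<open>\<tau> permutes {1..d}\<close>, of 0] that
      permutes_inj[OF \<open>\<tau> permutes {1..d}\<close>, THEN injD, of "t - 1" 0] by auto
  then show "omega (\<sigma> \<circ> \<tau>) t = (omega \<sigma> \<circ> omega \<tau>) t"
    by (auto simp: omega_def)
qed

lemma omega_id [simp]: "omega id = id"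
  by (auto simp: omega_def fun_eq_iff)

lemma inv_omega:
  assumes "\<sigma> permutes {1..d}" shows "inv' (omega \<sigma>) = omega (inv' \<sigma>)"
  using omega_comp[OF assms, of "inv' \<sigma>"] omega_comp[OF permutes_inv[OF assms], of \<sigma>]
  by (intro inv_unique_comp) (simp_all add: permutes_inv_o[OF assms])

lemma omega_permutes:
  assumes "\<sigma> permutes {1..d}" shows "omega \<sigma> permutes {1..Suc d}"
  unfolding permutes_def bij_iff[symmetric]
proof (intro conjI allI impI)
  show "bij (omega \<sigma>)"
    using omega_comp[OF assms, of "inv' \<sigma>"] omega_comp[OF permutes_inv[OF assms], of \<sigma>]
    by (intro o_bij[of "omega (inv' \<sigma>)"]) (simp_all add: permutes_inv_o[OF assms])
  fix t assume "t \<notin> {1..Suc d}"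
  then have "t = 0 \<or> t - 1 \<notin> {1..d} \<and> t > 1" by auto
  then show "omega \<sigma> t = t" using permutes_not_in[OF assms, of "t - 1"]
    by (auto simp: omega_def)
qed

lemma omega_pow_permutes:
  "\<sigma> permutes {1..d} \<Longrightarrow> (omega ^^ p) \<sigma> permutes {1..p + d}"
  by (induction p) (use omega_permutes in \<open>simp_all del: One_nat_def\<close>)

lemma inv_omega_pow:
  "\<sigma> permutes {1..d} \<Longrightarrow> inv' ((omega ^^ p) \<sigma>) = (omega ^^ p) (inv' \<sigma>)"
  by (induction p) (simp_all add: inv_omega[OF omega_pow_permutes])

lemma perm_tuple_omega:
  assumes "\<sigma> permutes {1..length xs}"
  shows "perm_tuple (omega \<sigma>) (x # xs) = x # perm_tuple \<sigma> xs"
proof (rule nth_equalityI)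
  fix t assume "t < length (perm_tuple (omega \<sigma>) (x # xs))"
  then show "perm_tuple (omega \<sigma>) (x # xs) ! t = (x # perm_tuple \<sigma> xs) ! t"
    using permutes_index[OF permutes_inv[OF assms], of "t - 1"]
    by (cases t) (simp_all add: nth_perm_tuple inv_omega[OF assms] omega_def[of "inv' \<sigma>"] nth_Cons')
qed simp

text \<open>Every entry put in front is absorbed by one more shift, by
  \<open>perm_tuple_omega\<close>.\<close>

lemma perm_tuple_omega_pow:
  assumes "\<sigma> permutes {1..length ys}"
  shows "perm_tuple ((omega ^^ length xs) \<sigma>) (xs @ ys) = xs @ perm_tuple \<sigma> ys"
  using assms
proof (induction xs)
  case (Cons x xs)
  then show ?case
    using omega_pow_permutes[OF assms, of "length xs"] by (simp add: perm_tuple_omega)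
qed simp

section \<open>Tensor powers\<close>

locale tensor = E: module K E for K :: "('k, 'm) ring_scheme" and E :: "('k, 'e, 'n) module_scheme"
begin

abbreviation F where "F d \<equiv> free_module K (tuples (carrier E) d)"
abbreviation T where "T d \<equiv> tensor_power K E d"

sublocale F: module K "F d" for d by (rule E.R.module_free_module)

lemma F_closed: "f \<in> carrier (F d) \<Longrightarrow> f xs \<in> carrier K"
  by (rule E.R.free_module_closed)

lemma F_length: "f \<in> carrier (F d) \<Longrightarrow> length xs \<noteq> d \<Longrightarrow> f xs = \<zero>\<^bsub>K\<^esub>"
  by (rule free_moduleD(1)) (auto simp: tuples_def)

lemma free_gen_F: "xs \<in> tuples (carrier E) d \<Longrightarrow> free_gen K xs \<in> carrier (F d)"
  by (rule E.R.free_gen_closed)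

lemma F_generated:
  "submodule N K (F d) \<Longrightarrow> (\<And>xs. xs \<in> tuples (carrier E) d \<Longrightarrow> free_gen K xs \<in> N) \<Longrightarrow>
    f \<in> carrier (F d) \<Longrightarrow> f \<in> N"
  using F.generated_submodule_least[of N d "free_gen K ` tuples (carrier E) d"]
  unfolding E.R.free_module_generated by blast

lemma tensor_relators_add:
  "xs \<in> tuples (carrier E) d \<Longrightarrow> t < d \<Longrightarrow> x \<in> carrier E \<Longrightarrow> y \<in> carrier E \<Longrightarrow>
    free_gen K (xs[t := x \<oplus>\<^bsub>E\<^esub> y]) \<ominus>\<^bsub>F d\<^esub>
      (free_gen K (xs[t := x]) \<oplus>\<^bsub>F d\<^esub> free_gen K (xs[t := y])) \<in> tensor_relators K E d"
  unfolding tensor_relators_def Let_def by blast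

lemma tensor_relators_smult:
  "xs \<in> tuples (carrier E) d \<Longrightarrow> t < d \<Longrightarrow> c \<in> carrier K \<Longrightarrow> x \<in> carrier E \<Longrightarrow>
    free_gen K (xs[t := c \<odot>\<^bsub>E\<^esub> x]) \<ominus>\<^bsub>F d\<^esub>
      (c \<odot>\<^bsub>F d\<^esub> free_gen K (xs[t := x])) \<in> tensor_relators K E d"
  unfolding tensor_relators_def Let_def by blast

lemma tensor_relators_cases:
  assumes "r \<in> tensor_relators K E d"
  obtains (add) xs t x y where "xs \<in> tuples (carrier E) d" "t < d" "x \<in> carrier E" "y \<in> carrier E"
      "r = free_gen K (xs[t := x \<oplus>\<^bsub>E\<^esub> y]) \<ominus>\<^bsub>F d\<^esub>
        (free_gen K (xs[t := x]) \<oplus>\<^bsub>F d\<^esub> free_gen K (xs[t := y]))"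
    | (smult) xs t c x where "xs \<in> tuples (carrier E) d" "t < d" "c \<in> carrier K" "x \<in> carrier E"
      "r = free_gen K (xs[t := c \<odot>\<^bsub>E\<^esub> x]) \<ominus>\<^bsub>F d\<^esub> (c \<odot>\<^bsub>F d\<^esub> free_gen K (xs[t := x]))"
  using assms unfolding tensor_relators_def Let_def by blast

lemma tensor_relators_closed: "tensor_relators K E d \<subseteq> carrier (F d)"
  by (auto elim!: tensor_relators_cases simp: free_gen_F tuples_list_update)

definition multilinear :: "nat \<Rightarrow> ('k, 'x, 'y) module_scheme \<Rightarrow> ('e list \<Rightarrow> 'x) \<Rightarrow> bool" where
  "multilinear d X g \<longleftrightarrow> g \<in> tuples (carrier E) d \<rightarrow> carrier X \<and>
    (\<forall>xs\<in>tuples (carrier E) d. \<forall>t<d. linear_map K E X (\<lambda>x. g (xs[t := x])))"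

text \<open>A relator records the failure of additivity or homogeneity in one slot. Read from left
  to right, this makes pure tensors multilinear; from right to left, it lets multilinear maps factor
  through the tensor power.\<close>

lemma vanish_on_relators_iff:
  assumes "linear_map K (F d) X h"
  shows "(\<forall>r\<in>tensor_relators K E d. h r = \<zero>\<^bsub>X\<^esub>) \<longleftrightarrow> multilinear d X (\<lambda>xs. h (free_gen K xs))"
    (is "?L \<longleftrightarrow> ?R")
proof -
  interpret h: linear_map K "F d" X h by fact
  note [simp] = free_gen_F tuples_list_update h.minus h.add h.smult h.closed h.N.minus_eq_zero_iff
  show ?thesis
  proof
    assume L: ?L
    have "linear_map K E X (\<lambda>x. h (free_gen K (xs[t := x])))"
      if "xs \<in> tuples (carrier E) d" "t < d" for xs t
    proof (intro linear_map.intro linear_map_axioms.intro E.module_axioms h.N.module_axioms)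
      show "h (free_gen K (xs[t := x \<oplus>\<^bsub>E\<^esub> y])) =
          h (free_gen K (xs[t := x])) \<oplus>\<^bsub>X\<^esub> h (free_gen K (xs[t := y]))"
        if "x \<in> carrier E" "y \<in> carrier E" for x y
        using bspec[OF L tensor_relators_add[OF \<open>xs \<in> _\<close> \<open>t < d\<close> that]] that \<open>xs \<in> _\<close> by simp
      show "h (free_gen K (xs[t := c \<odot>\<^bsub>E\<^esub> x])) = c \<odot>\<^bsub>X\<^esub> h (free_gen K (xs[t := x]))"
        if "c \<in> carrier K" "x \<in> carrier E" for c x
        using bspec[OF L tensor_relators_smult[OF \<open>xs \<in> _\<close> \<open>t < d\<close> that]] that \<open>xs \<in> _\<close> by simp
    qed (use that in simp)
    then show ?R by (auto simp: multilinear_def)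
  next
    assume ?R
    then have R: "linear_map K E X (\<lambda>x. h (free_gen K (xs[t := x])))"
      if "xs \<in> tuples (carrier E) d" "t < d" for xs t
      using that by (auto simp: multilinear_def)
    show ?L
    proof
      fix r assume "r \<in> tensor_relators K E d"
      then show "h r = \<zero>\<^bsub>X\<^esub>"
      proof (cases rule: tensor_relators_cases)
        case (add xs t x y)
        then show ?thesis using linear_map.add[OF R[OF add(1,2)] add(3,4)] by simp
      next
        case (smult xs t c x)
        then show ?thesis using linear_map.smult[OF R[OF smult(1,2)] smult(3,4)] by simp
      qed
    qed
  qed
qed

lemma tensor_rel_submodule: "submodule (tensor_rel K E d) K (F d)"
  unfolding tensor_rel_def by (rule F.generated_submodule_submodule[OF tensor_relators_closed])

sublocale T: module K "T d" for d
  using quot_module_linear[OF F.module_axioms tensor_rel_submodule, of d]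
  unfolding tensor_power_def by (rule linear_map.axioms(2))

lemma tensor_coset_linear: "linear_map K (F d) (T d) (tensor_coset K E d)"
  using quot_module_linear[OF F.module_axioms tensor_rel_submodule, of d]
  unfolding tensor_power_def tensor_coset_def .

sublocale tc: linear_map K "F d" "T d" "tensor_coset K E d" for d
  by (rule tensor_coset_linear)

lemma carrier_T: "carrier (T d) = tensor_coset K E d ` carrier (F d)"
  unfolding tensor_power_def carrier_quot_module tensor_coset_def ..

lemma pure_tensor_multilinear: "multilinear d (T d) (\<lambda>xs. tensor_coset K E d (free_gen K xs))"
proof -
  have "tensor_coset K E d r = \<zero>\<^bsub>T d\<^esub>" if "r \<in> tensor_relators K E d" for r
    using F.coset_eq_self_iff[OF tensor_rel_submodule] that tensor_relators_closed
      F.generated_submodule_incl[OF that]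
    unfolding tensor_rel_def tensor_power_def zero_quot_module tensor_coset_def by blast
  then show ?thesis using vanish_on_relators_iff[OF tensor_coset_linear] by blast
qed

section \<open>Permutations and products on representatives, and the operations they induce on
  tensor powers\<close>

definition fperm :: "(nat \<Rightarrow> nat) \<Rightarrow> ('e list \<Rightarrow> 'k) \<Rightarrow> 'e list \<Rightarrow> 'k" where
  "fperm \<sigma> f = (\<lambda>xs. f (perm_tuple (inv' \<sigma>) xs))"

definition fmult :: "nat \<Rightarrow> ('e list \<Rightarrow> 'k) \<Rightarrow> ('e list \<Rightarrow> 'k) \<Rightarrow> 'e list \<Rightarrow> 'k" where
  "fmult p f g = (\<lambda>xs. f (take p xs) \<otimes>\<^bsub>K\<^esub> g (drop p xs))"

lemma fperm_linear:
  assumes \<sigma>: "\<sigma> permutes {1..d}" shows "linear_map K (F d) (F d) (fperm \<sigma>)"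
proof (intro linear_map.intro linear_map_axioms.intro F.module_axioms)
  fix f assume f: "f \<in> carrier (F d)"
  \<comment> \<open>Finiteness of the support: it lies in the image under \<sigma> of the old one.
    Lists of length other than d do not occur, since f vanishes on them and
    \<open>perm_tuple\<close> preserves length.\<close>
  have "{xs. f (perm_tuple (inv' \<sigma>) xs) \<noteq> \<zero>\<^bsub>K\<^esub>} \<subseteq> perm_tuple \<sigma> ` {xs. f xs \<noteq> \<zero>\<^bsub>K\<^esub>}"
  proof
    fix xs assume "xs \<in> {xs. f (perm_tuple (inv' \<sigma>) xs) \<noteq> \<zero>\<^bsub>K\<^esub>}"
    moreover from this have "length xs = d" using F_length[OF f, of "perm_tuple (inv' \<sigma>) xs"] by auto
    then have "xs = perm_tuple \<sigma> (perm_tuple (inv' \<sigma>) xs)" using \<sigma> by (simp add: perm_tuple_inv)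
    ultimately show "xs \<in> perm_tuple \<sigma> ` {xs. f xs \<noteq> \<zero>\<^bsub>K\<^esub>}" by blast
  qed
  then have "finite {xs. f (perm_tuple (inv' \<sigma>) xs) \<noteq> \<zero>\<^bsub>K\<^esub>}"
    using free_moduleD(2)[OF f] finite_surj by blast
  then show "fperm \<sigma> f \<in> carrier (F d)"
    using f tuples_perm_tuple_iff[OF permutes_inv[OF \<sigma>]] by (auto simp: fperm_def free_module_def)
qed (auto simp: fperm_def free_module_def)

lemma fperm_free_gen:
  assumes "\<sigma> permutes {1..length xs}"
  shows "fperm \<sigma> (free_gen K xs) = free_gen K (perm_tuple \<sigma> xs)"
proof
  fix ys
  have "perm_tuple (inv' \<sigma>) ys = xs \<longleftrightarrow> ys = perm_tuple \<sigma> xs"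
    using assms perm_tuple_inv[of \<sigma> xs] perm_tuple_inv[of \<sigma> ys] length_perm_tuple by metis
  then show "fperm \<sigma> (free_gen K xs) ys = free_gen K (perm_tuple \<sigma> xs) ys"
    by (simp add: fperm_def free_gen_def)
qed

lemma fperm_relators:
  assumes \<sigma>: "\<sigma> permutes {1..d}" and r: "r \<in> tensor_relators K E d"
  shows "fperm \<sigma> r \<in> tensor_relators K E d"
proof -
  interpret l: linear_map K "F d" "F d" "fperm \<sigma>" by (rule fperm_linear[OF \<sigma>])
  \<comment> \<open>A relator for slot t is thereby sent to a relator of the permuted tuple for slot
    \<sigma> (Suc t) - 1.\<close>
  have gen: "fperm \<sigma> (free_gen K (xs[t := x])) = free_gen K ((perm_tuple \<sigma> xs)[\<sigma> (Suc t) - 1 := x])"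
    if "xs \<in> tuples (carrier E) d" "t < d" for xs t x
  proof -
    have "length xs = d" using that by (simp add: tuples_def)
    then show ?thesis using \<sigma> that by (simp add: fperm_free_gen perm_tuple_list_update)
  qed
  note [simp] = free_gen_F tuples_list_update l.minus l.add l.smult gen
  from r show ?thesis
  proof (cases rule: tensor_relators_cases)
    case (add xs t x y)
    then show ?thesis
      using tensor_relators_add[of "perm_tuple \<sigma> xs" d "\<sigma> (Suc t) - 1" x y]
        permutes_index[OF \<sigma> add(2)] by (simp add: tuples_perm_tuple_iff[OF \<sigma>])
  next
    case (smult xs t c x)
    then show ?thesis
      using tensor_relators_smult[of "perm_tuple \<sigma> xs" d "\<sigma> (Suc t) - 1" c x]
        permutes_index[OF \<sigma> smult(2)] by (simp add: tuples_perm_tuple_iff[OF \<sigma>])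
  qed
qed

lemma perm_tensor_linear:
  assumes "\<sigma> permutes {1..d}"
  shows "linear_map K (T d) (T d) (perm_tensor K E d \<sigma>)"
    and "f \<in> carrier (F d) \<Longrightarrow>
      perm_tensor K E d \<sigma> (tensor_coset K E d f) = tensor_coset K E d (fperm \<sigma> f)"
  using linear_map_quot[OF fperm_linear[OF assms] tensor_relators_closed tensor_rel_submodule]
    fperm_relators[OF assms] F.generated_submodule_incl
  unfolding tensor_rel_def[symmetric] tensor_power_def[symmetric]
  by (simp_all add: perm_tensor_def[abs_def] tensor_coset_def fperm_def tensor_rel_def)

lemma fmult_bilinear: "bilinear_map K (F p) (F q) (F (p + q)) (fmult p)"
proof -
  have closed: "fmult p f g \<in> carrier (F (p + q))"
    if f: "f \<in> carrier (F p)" and g: "g \<in> carrier (F q)" for f g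
  proof -
    \<comment> \<open>A nonzero product needs both factors nonzero, so the support consists of
      concatenations from two finite supports.\<close>
    have "{xs. fmult p f g xs \<noteq> \<zero>\<^bsub>K\<^esub>} \<subseteq> 
        (\<lambda>(ys, zs). ys @ zs) ` ({ys. f ys \<noteq> \<zero>\<^bsub>K\<^esub>} \<times> {zs. g zs \<noteq> \<zero>\<^bsub>K\<^esub>})"
    proof
      fix xs assume "xs \<in> {xs. fmult p f g xs \<noteq> \<zero>\<^bsub>K\<^esub>}"
      then have "f (take p xs) \<noteq> \<zero>\<^bsub>K\<^esub>" "g (drop p xs) \<noteq> \<zero>\<^bsub>K\<^esub>"
        using F_closed[OF f] F_closed[OF g] by (auto simp: fmult_def)
      then show "xs \<in> (\<lambda>(ys, zs). ys @ zs) ` ({ys. f ys \<noteq> \<zero>\<^bsub>K\<^esub>} \<times> {zs. g zs \<noteq> \<zero>\<^bsub>K\<^esub>})"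
        by (intro image_eqI[of _ _ "(take p xs, drop p xs)"]) auto
    qed
    then have "finite {xs. fmult p f g xs \<noteq> \<zero>\<^bsub>K\<^esub>}"
      using free_moduleD(2)[OF f] free_moduleD(2)[OF g] by (meson finite_SigmaI finite_surj)
    moreover have "fmult p f g xs = \<zero>\<^bsub>K\<^esub>" if "xs \<notin> tuples (carrier E) (p + q)" for xs
    proof -
      have "take p xs \<notin> tuples (carrier E) p \<or> drop p xs \<notin> tuples (carrier E) q"
      proof (rule ccontr)
        assume "\<not> ?thesis"
        then have "take p xs @ drop p xs \<in> tuples (carrier E) (p + q)"
          by (intro tuples_append) auto
        then show False using that by simp
      qed
      then show ?thesis using free_moduleD(1)[OF f] free_moduleD(1)[OF g] F_closed[OF f] F_closed[OF g]
        by (auto simp: fmult_def)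
    qed
    ultimately show ?thesis using F_closed[OF f] F_closed[OF g]
      by (auto simp: free_module_def fmult_def)
  qed
  show ?thesis
  proof (intro bilinear_map.intro bilinear_map_axioms.intro F.module_axioms)
    fix g assume g: "g \<in> carrier (F q)"
    show "linear_map K (F p) (F (p + q)) (\<lambda>f. fmult p f g)"
    proof (intro linear_map.intro linear_map_axioms.intro F.module_axioms closed g)
      fix f f' assume f: "f \<in> carrier (F p)" "f' \<in> carrier (F p)"
      show "fmult p (f \<oplus>\<^bsub>F p\<^esub> f') g = fmult p f g \<oplus>\<^bsub>F (p + q)\<^esub> fmult p f' g"
        using F_closed[OF g] F_closed[OF f(1)] F_closed[OF f(2)]
        by (simp add: fmult_def free_module_def E.R.l_distr)
    next
      fix c f assume c: "c \<in> carrier K" and f: "f \<in> carrier (F p)"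
      show "fmult p (c \<odot>\<^bsub>F p\<^esub> f) g = c \<odot>\<^bsub>F (p + q)\<^esub> fmult p f g"
        using F_closed[OF g] F_closed[OF f] c
        by (simp add: fmult_def free_module_def E.R.m_assoc)
    qed
  next
    fix f assume f: "f \<in> carrier (F p)"
    show "linear_map K (F q) (F (p + q)) (fmult p f)"
    proof (intro linear_map.intro linear_map_axioms.intro F.module_axioms closed f)
      fix g g' assume g: "g \<in> carrier (F q)" "g' \<in> carrier (F q)"
      show "fmult p f (g \<oplus>\<^bsub>F q\<^esub> g') = fmult p f g \<oplus>\<^bsub>F (p + q)\<^esub> fmult p f g'"
        using F_closed[OF f] F_closed[OF g(1)] F_closed[OF g(2)]
        by (simp add: fmult_def free_module_def E.R.r_distr)
    next
      fix c g assume c: "c \<in> carrier K" and g: "g \<in> carrier (F q)"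
      show "fmult p f (c \<odot>\<^bsub>F q\<^esub> g) = c \<odot>\<^bsub>F (p + q)\<^esub> fmult p f g"
        using F_closed[OF f] F_closed[OF g] c
        by (simp add: fmult_def free_module_def E.R.m_lcomm)
    qed
  qed
qed

lemma fmult_free_gen:
  assumes "length xs = p"
  shows "fmult p (free_gen K xs) (free_gen K ys) = free_gen K (xs @ ys)"
proof
  fix zs
  have "take p zs = xs \<and> drop p zs = ys \<longleftrightarrow> zs = xs @ ys"
    using assms by (metis append_eq_conv_conj)
  then show "fmult p (free_gen K xs) (free_gen K ys) zs = free_gen K (xs @ ys) zs"
    by (auto simp: fmult_def free_gen_def)
qed

text \<open>Multiplied by a generator on the right, a relator becomes a relator for the same slot of
  the concatenation. Linearity in g extends this to all g, with membership in the generated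
  submodule in place of being a relator.\<close>

lemma fmult_relator_left:
  assumes r: "r \<in> tensor_relators K E p" and g: "g \<in> carrier (F q)"
  shows "fmult p r g \<in> tensor_rel K E (p + q)"
proof -
  interpret B: bilinear_map K "F p" "F q" "F (p + q)" "fmult p" by (rule fmult_bilinear)
  have rF: "r \<in> carrier (F p)" using r tensor_relators_closed by blast
  have "fmult p r (free_gen K ys) \<in> tensor_relators K E (p + q)"
    if ys: "ys \<in> tuples (carrier E) q" for ys
  proof -
    interpret l: linear_map K "F p" "F (p + q)" "\<lambda>x. fmult p x (free_gen K ys)"
      by (rule B.lin_left[OF free_gen_F[OF ys]])
    have gen: "fmult p (free_gen K (xs[t := x])) (free_gen K ys) = free_gen K ((xs @ ys)[t := x])"
      if "xs \<in> tuples (carrier E) p" "t < p" for xs t x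
      using that by (simp add: fmult_free_gen tuples_def list_update_append)
    note [simp] = free_gen_F tuples_list_update l.minus l.add l.smult gen
    from r show ?thesis
    proof (cases rule: tensor_relators_cases)
      case (add xs t x y)
      then show ?thesis using tensor_relators_add[OF tuples_append[OF add(1) ys], of t x y] by simp
    next
      case (smult xs t c x)
      then show ?thesis using tensor_relators_smult[OF tuples_append[OF smult(1) ys], of t c x] by simp
    qed
  qed
  then have "free_gen K ys \<in> {g \<in> carrier (F q). fmult p r g \<in> tensor_rel K E (p + q)}"
    if "ys \<in> tuples (carrier E) q" for ys
    using that free_gen_F F.generated_submodule_incl unfolding tensor_rel_def by blast
  then show ?thesis
    using F_generated[OF linear_map.vimage_submodule[OF B.lin_right[OF rF] tensor_rel_submodule] _ g]
    by blast
qed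

lemma fmult_relator_right:
  assumes r: "r \<in> tensor_relators K E q" and f: "f \<in> carrier (F p)"
  shows "fmult p f r \<in> tensor_rel K E (p + q)"
proof -
  interpret B: bilinear_map K "F p" "F q" "F (p + q)" "fmult p" by (rule fmult_bilinear)
  have rF: "r \<in> carrier (F q)" using r tensor_relators_closed by blast
  have "fmult p (free_gen K ys) r \<in> tensor_relators K E (p + q)"
    if ys: "ys \<in> tuples (carrier E) p" for ys
  proof -
    interpret l: linear_map K "F q" "F (p + q)" "fmult p (free_gen K ys)"
      by (rule B.lin_right[OF free_gen_F[OF ys]])
    \<comment> \<open>The slot moves by p, the length of the left factor.\<close>
    have gen: "fmult p (free_gen K ys) (free_gen K (xs[t := x])) = free_gen K ((ys @ xs)[p + t := x])"
      if "xs \<in> tuples (carrier E) q" "t < q" for xs t x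
      using that ys by (simp add: fmult_free_gen tuples_def list_update_append)
    note [simp] = free_gen_F tuples_list_update l.minus l.add l.smult gen
    from r show ?thesis
    proof (cases rule: tensor_relators_cases)
      case (add xs t x y)
      then show ?thesis
        using tensor_relators_add[OF tuples_append[OF ys add(1)], of "p + t" x y] by simp
    next
      case (smult xs t c x)
      then show ?thesis
        using tensor_relators_smult[OF tuples_append[OF ys smult(1)], of "p + t" c x] by simp
    qed
  qed
  then have "free_gen K ys \<in> {f \<in> carrier (F p). fmult p f r \<in> tensor_rel K E (p + q)}"
    if "ys \<in> tuples (carrier E) p" for ys
    using that free_gen_F F.generated_submodule_incl unfolding tensor_rel_def by blast
  then show ?thesis
    using F_generated[OF linear_map.vimage_submodule[OF B.lin_left[OF rF] tensor_rel_submodule] _ f]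
    by blast
qed

lemma tensor_mult_bilinear:
  shows "bilinear_map K (T p) (T q) (T (p + q)) (tensor_mult K E p q)"
    and "f \<in> carrier (F p) \<Longrightarrow> g \<in> carrier (F q) \<Longrightarrow>
      tensor_mult K E p q (tensor_coset K E p f) (tensor_coset K E q g) =
        tensor_coset K E (p + q) (fmult p f g)"
  using bilinear_map_quot[OF fmult_bilinear tensor_relators_closed tensor_relators_closed
      tensor_rel_submodule fmult_relator_left fmult_relator_right, of p q]
  unfolding tensor_rel_def[symmetric] tensor_power_def[symmetric]
  by (simp_all add: tensor_mult_def[abs_def] tensor_coset_def fmult_def)

lemma perm_tensor_mult_left:
  assumes \<sigma>: "\<sigma> permutes {1..p}" and y: "y \<in> carrier (T p)" and z: "z \<in> carrier (T q)"
  shows "perm_tensor K E (p + q) \<sigma> (tensor_mult K E p q y z) =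
    tensor_mult K E p q (perm_tensor K E p \<sigma> y) z"
proof -
  obtain f g where f: "f \<in> carrier (F p)" "y = tensor_coset K E p f"
    and g: "g \<in> carrier (F q)" "z = tensor_coset K E q g" using y z by (auto simp: carrier_T)
  have \<sigma>': "\<sigma> permutes {1..p + q}" using \<sigma> by (rule permutes_subset) auto
  have eq: "fperm \<sigma> (fmult p f g) = fmult p (fperm \<sigma> f) g"
  proof
    fix xs
    show "fperm \<sigma> (fmult p f g) xs = fmult p (fperm \<sigma> f) g xs"
    \<comment> \<open>The action of \<sigma> splits along the blocks only if the first block is
      complete. For shorter lists f vanishes and both sides are zero.\<close>
    proof (cases "length (take p xs) = p")
      case True
      have "perm_tuple (inv' \<sigma>) (take p xs @ drop p xs) = perm_tuple (inv' \<sigma>) (take p xs) @ drop p xs"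
        by (rule perm_tuple_append) (simp only: True permutes_inv[OF \<sigma>])
      then show ?thesis using True by (simp add: fperm_def fmult_def)
    next
      case False
      then show ?thesis using F_length[OF f(1)] F_closed[OF g(1)] by (simp add: fperm_def fmult_def)
    qed
  qed
  interpret B: bilinear_map K "F p" "F q" "F (p + q)" "fmult p" by (rule fmult_bilinear)
  show ?thesis
    using f g eq linear_map.closed[OF B.lin_left[OF g(1)] f(1)] linear_map.closed[OF fperm_linear[OF \<sigma>] f(1)]
    by (simp add: tensor_mult_bilinear(2) perm_tensor_linear(2)[OF \<sigma>] perm_tensor_linear(2)[OF \<sigma>'])
qed

lemma perm_tensor_mult_right:
  assumes \<sigma>: "\<sigma> permutes {1..q}" and y: "y \<in> carrier (T p)" and z: "z \<in> carrier (T q)"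
  shows "perm_tensor K E (p + q) ((omega ^^ p) \<sigma>) (tensor_mult K E p q y z) =
    tensor_mult K E p q y (perm_tensor K E q \<sigma> z)"
proof -
  obtain f g where f: "f \<in> carrier (F p)" "y = tensor_coset K E p f"
    and g: "g \<in> carrier (F q)" "z = tensor_coset K E q g" using y z by (auto simp: carrier_T)
  note \<sigma>' = omega_pow_permutes[OF \<sigma>, of p]
  have eq: "fperm ((omega ^^ p) \<sigma>) (fmult p f g) = fmult p f (fperm \<sigma> g)"
  proof
    fix xs
    show "fperm ((omega ^^ p) \<sigma>) (fmult p f g) xs = fmult p f (fperm \<sigma> g) xs"
    \<comment> \<open>The shifted permutation moves exactly the last q positions of a list of this
      length; on any other list one of the two factors vanishes.\<close>
    proof (cases "length xs = p + q")
      case True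
      have "perm_tuple ((omega ^^ length (take p xs)) (inv' \<sigma>)) (take p xs @ drop p xs) =
          take p xs @ perm_tuple (inv' \<sigma>) (drop p xs)"
        by (rule perm_tuple_omega_pow) (use True permutes_inv[OF \<sigma>] in simp)
      then show ?thesis using True by (simp add: fperm_def fmult_def inv_omega_pow[OF \<sigma>])
    next
      case False
      then have "length (take p xs) \<noteq> p \<or> length (drop p xs) \<noteq> q" by auto
      then show ?thesis
      proof
        assume "length (take p xs) \<noteq> p"
        then show ?thesis
          using F_length[OF f(1)] F_closed[OF g(1)] by (simp add: fperm_def fmult_def)
      next
        assume "length (drop p xs) \<noteq> q"
        then show ?thesis
          using F_length[OF g(1)] F_closed[OF f(1)] by (simp add: fperm_def fmult_def)
      qed
    qed
  qed
  interpret B: bilinear_map K "F p" "F q" "F (p + q)" "fmult p" by (rule fmult_bilinear)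
  show ?thesis
    using f g eq linear_map.closed[OF B.lin_left[OF g(1)] f(1)] linear_map.closed[OF fperm_linear[OF \<sigma>] g(1)]
    by (simp add: tensor_mult_bilinear(2) perm_tensor_linear(2)[OF \<sigma>] perm_tensor_linear(2)[OF \<sigma>'])
qed

end

text \<open>Induction on the number k of leading slots that may hold arbitrary vectors while all
  later ones hold basis vectors. To free one more slot: the x admissible there form a submodule
  containing the basis, hence all of E.\<close>

lemma (in tensor) multilinear_in_submodule:
  assumes X: "module K X" and g: "multilinear d X g" and N: "submodule N K X"
    and b: "module_basis K E L b"
    and gN: "\<And>i. i \<in> tuples L d \<Longrightarrow> g (map b i) \<in> N"
    and xs: "xs \<in> tuples (carrier E) d"
  shows "g xs \<in> N"
proof -
  interpret b: module_basis K E L b by fact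
  have step: "g xs \<in> N" if "k \<le> d" "xs \<in> tuples (carrier E) d" "\<forall>t. k \<le> t \<and> t < d \<longrightarrow> xs ! t \<in> b ` L" for k xs
    using that
  proof (induction k arbitrary: xs)
    case 0
    then have "xs \<in> lists (b ` L)" by (auto simp: tuples_def in_set_conv_nth)
    then obtain i where "xs = map b i" "set i \<subseteq> L"
      by (auto simp: lists_image)
    then show ?case using gN 0 by (auto simp: tuples_def)
  next
    case (Suc k)
    let ?N = "{x \<in> carrier E. g (xs[k := x]) \<in> N}"
    have lin: "linear_map K E X (\<lambda>x. g (xs[k := x]))"
      using g Suc.prems by (auto simp: multilinear_def)
    have "b ` L \<subseteq> ?N"
    proof
      fix x assume x: "x \<in> b ` L"
      then have xE: "x \<in> carrier E" using b.in_carrier by auto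
      have "(xs[k := x]) ! t \<in> b ` L" if "k \<le> t" "t < d" for t
        using Suc.prems that x by (cases "t = k") (auto simp: tuples_def)
      then have "g (xs[k := x]) \<in> N"
        using Suc.prems tuples_list_update[OF Suc.prems(2) xE] by (intro Suc.IH) auto
      then show "x \<in> ?N" using xE by simp
    qed
    then have "carrier E \<subseteq> ?N"
      using E.generated_submodule_least[OF linear_map.vimage_submodule[OF lin N]] b.generates by blast
    moreover have "xs ! k \<in> carrier E" using Suc.prems by (auto simp: tuples_def)
    ultimately have "g (xs[k := xs ! k]) \<in> N" by blast
    then show ?case by simp
  qed
  show ?thesis by (rule step[OF order_refl xs]) (meson not_le)
qed

text \<open>The witness s is 1 + z + ... + z^(n-1). The telescoping identity s (z - 1) = z^n - 1 is
  written without subtraction, and s acts on x as n because every power of z fixes x.\<close>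

lemma (in module) geometric_sum_smult:
  assumes z: "z \<in> carrier R" and x: "x \<in> carrier M" and zx: "z \<odot>\<^bsub>M\<^esub> x = x"
  shows "\<exists>s\<in>carrier R. s \<otimes> z \<oplus> \<one> = s \<oplus> z [^] (n::nat) \<and>
    s \<odot>\<^bsub>M\<^esub> x = ([n] \<cdot> \<one>) \<odot>\<^bsub>M\<^esub> x"
proof (induction n)
  case 0
  show ?case using z x by (intro bexI[of _ "\<zero>"]) (auto simp: a_minus_def R.r_neg)
next
  case (Suc n)
  obtain s where s: "s \<in> carrier R" "s \<otimes> z \<oplus> \<one> = s \<oplus> z [^] n"
    "s \<odot>\<^bsub>M\<^esub> x = ([n] \<cdot> \<one>) \<odot>\<^bsub>M\<^esub> x" using Suc by blast
  let ?y = "z [^] n"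
  have y: "?y \<in> carrier R" using z by simp
  have yx: "(z [^] m) \<odot>\<^bsub>M\<^esub> x = x" for m :: nat
    by (induction m) (use z x zx in \<open>simp_all add: smult_assoc1\<close>)
  have "(s \<oplus> ?y) \<otimes> z \<oplus> \<one> = (s \<otimes> z \<oplus> \<one>) \<oplus> ?y \<otimes> z"
    using s(1) y z by (simp add: R.l_distr R.a_ac)
  then have "(s \<oplus> ?y) \<otimes> z \<oplus> \<one> = (s \<oplus> ?y) \<oplus> z [^] Suc n"
    unfolding s(2) by simp
  moreover have "(s \<oplus> ?y) \<odot>\<^bsub>M\<^esub> x = ([Suc n] \<cdot> \<one>) \<odot>\<^bsub>M\<^esub> x"
    using s y x yx by (simp add: smult_l_distr)
  ultimately show ?case using s(1) y by (intro bexI[of _ "s \<oplus> ?y"]) auto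
qed

section \<open>Semi-symmetric powers\<close>

locale semisym = tensor K E + R: domain K
  for K :: "('k, 'm) ring_scheme" and E :: "('k, 'e, 'n) module_scheme" +
  fixes W :: "nat \<Rightarrow> (nat \<Rightarrow> nat) set" and chi :: "nat \<Rightarrow> (nat \<Rightarrow> nat) \<Rightarrow> 'k"
  assumes rat: "rat_algebra K" and inv: "omega_invariant K W chi"
begin

text \<open>The inverse is the image of 1/n under the homomorphism from the rationals, which sends
  the integer n to n times the unit element.\<close>

lemma nat_Units:
  fixes n :: nat assumes "n > 0" shows "[n] \<cdot>\<^bsub>K\<^esub> \<one>\<^bsub>K\<^esub> \<in> Units K"
proof -
  obtain \<phi> where \<phi>: "\<phi> \<in> ring_hom rat_ring K" using rat by (auto simp: rat_algebra_def)
  have cl: "\<phi> x \<in> carrier K" for x using \<phi> by (auto simp: ring_hom_def rat_ring_def)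
  have add: "\<phi> (x + y) = \<phi> x \<oplus>\<^bsub>K\<^esub> \<phi> y" and mult: "\<phi> (x * y) = \<phi> x \<otimes>\<^bsub>K\<^esub> \<phi> y" for x y
    using \<phi> by (auto simp: ring_hom_def rat_ring_def)
  have one: "\<phi> 1 = \<one>\<^bsub>K\<^esub>" using \<phi> by (auto simp: ring_hom_def rat_ring_def)
  have "\<phi> 0 = \<zero>\<^bsub>K\<^esub>" using add[of 0 0] cl[of 0] by (metis E.R.add.r_cancel_one' add_0)
  then have nat: "\<phi> (of_nat m) = [m] \<cdot>\<^bsub>K\<^esub> \<one>\<^bsub>K\<^esub>" for m
    by (induction m) (simp_all add: add one E.R.a_comm cl)
  have "[n] \<cdot>\<^bsub>K\<^esub> \<one>\<^bsub>K\<^esub> \<otimes>\<^bsub>K\<^esub> \<phi> (1 / of_nat n) = \<phi> (of_nat n * (1 / of_nat n))"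
    by (simp only: mult nat)
  also have "\<dots> = \<one>\<^bsub>K\<^esub>" using assms one by simp
  finally have "[n] \<cdot>\<^bsub>K\<^esub> \<one>\<^bsub>K\<^esub> \<otimes>\<^bsub>K\<^esub> \<phi> (1 / of_nat n) = \<one>\<^bsub>K\<^esub>" .
  moreover from this have "\<phi> (1 / of_nat n) \<otimes>\<^bsub>K\<^esub> [n] \<cdot>\<^bsub>K\<^esub> \<one>\<^bsub>K\<^esub> = \<one>\<^bsub>K\<^esub>"
    by (subst E.R.m_comm) (simp_all add: cl)
  ultimately show ?thesis unfolding Units_def
    by (intro CollectI conjI bexI[of _ "\<phi> (1 / of_nat n)"]) (simp_all add: cl)
qed

lemma W_permutes: "\<sigma> \<in> W d \<Longrightarrow> \<sigma> permutes {1..d}"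
  using inv subgroup.subset sym_group_carrier unfolding omega_invariant_def by blast

lemma W_subgroup: "subgroup (W d) (sym_group d)"
  using inv by (simp add: omega_invariant_def)

lemma W_id: "id \<in> W d"
  using subgroup.one_closed[OF W_subgroup, of d] by (simp add: sym_group_one)

lemma W_comp: "\<sigma> \<in> W d \<Longrightarrow> \<tau> \<in> W d \<Longrightarrow> \<sigma> \<circ> \<tau> \<in> W d"
  using subgroup.m_closed[OF W_subgroup, of \<sigma> d \<tau>] by (simp add: sym_group_mult)

lemma W_inv:
  assumes "\<sigma> \<in> W d" shows "inv' \<sigma> \<in> W d"
proof -
  have "inv\<^bsub>sym_group d\<^esub> \<sigma> = inv' \<sigma>"
    by (rule sym_group_inv_equality) (simp only: sym_group_carrier W_permutes[OF assms])
  then show ?thesis using subgroup.m_inv_closed[OF W_subgroup assms] by (simp only:)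
qed

lemma finite_W: "finite (W d)"
  by (rule finite_subset[OF _ finite_permutations[of "{1..d}"]]) (use W_permutes in auto)

lemma chi_Units: "\<sigma> \<in> W d \<Longrightarrow> chi d \<sigma> \<in> Units K"
  using inv by (auto simp: omega_invariant_def hom_def units_of_def)

lemma chi_closed [simp]: "\<sigma> \<in> W d \<Longrightarrow> chi d \<sigma> \<in> carrier K"
  using chi_Units by blast

lemma chi_inv_closed [simp]: "\<sigma> \<in> W d \<Longrightarrow> inv\<^bsub>K\<^esub> (chi d \<sigma>) \<in> carrier K"
  using chi_Units by blast

lemma chi_comp: "\<sigma> \<in> W d \<Longrightarrow> \<tau> \<in> W d \<Longrightarrow> chi d (\<sigma> \<circ> \<tau>) = chi d \<sigma> \<otimes>\<^bsub>K\<^esub> chi d \<tau>"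
  using inv by (auto simp: omega_invariant_def hom_def units_of_def sym_group_mult)

lemma chi_id: "chi d id = \<one>\<^bsub>K\<^esub>"
  using chi_comp[OF W_id W_id, of d] chi_Units[OF W_id, of d]
  by (metis E.R.Units_l_cancel E.R.Units_closed E.R.one_closed E.R.r_one comp_id)

text \<open>With \<open>W_omega_pow\<close>, extends \<omega>-invariance from one step to all
  degrees: \<open>W p\<close> acts on the first p of p + q positions, the shifted \<open>W q\<close>
  on the last q, with unchanged character values.\<close>

lemma W_extend: "\<sigma> \<in> W p \<Longrightarrow> \<sigma> \<in> W (p + q) \<and> chi (p + q) \<sigma> = chi p \<sigma>"
  by (induction q) (use inv in \<open>auto simp: omega_invariant_def\<close>)

lemma W_omega_pow:
  "\<sigma> \<in> W q \<Longrightarrow> (omega ^^ p) \<sigma> \<in> W (p + q) \<and> chi (p + q) ((omega ^^ p) \<sigma>) = chi q \<sigma>"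
  by (induction p) (use inv in \<open>auto simp: omega_invariant_def\<close>)

lemma chi_pow:
  assumes "\<sigma> \<in> W d"
  shows "\<sigma> ^^ k \<in> W d \<and> chi d (\<sigma> ^^ k) = chi d \<sigma> [^]\<^bsub>K\<^esub> k"
proof (induction k)
  case 0 then show ?case using W_id chi_id by (simp add: id_def[symmetric])
next
  case (Suc k)
  have "\<sigma> ^^ Suc k = \<sigma> \<circ> \<sigma> ^^ k" by simp
  then show ?case
    using Suc assms W_comp[OF assms] chi_comp[OF assms] by (metis E.R.nat_pow_Suc E.R.m_comm chi_closed)
qed

lemma chi_finite_order:
  assumes "\<sigma> \<in> W d" obtains n where "n > 0" "chi d \<sigma> [^]\<^bsub>K\<^esub> (n::nat) = \<one>\<^bsub>K\<^esub>"
proof -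
  have "permutation \<sigma>" using W_permutes[OF assms] permutation_permutes by blast
  then obtain n where "n > 0" "\<sigma> ^^ n = id" using permutation_is_nilpotent by blast
  then show thesis using that[of n] chi_pow[OF assms, of n] chi_id by simp
qed

section \<open>Generators, relations and universal property of a semi-symmetric power\<close>

abbreviation P where "P d \<equiv> semisym_power K W chi E d"

definition semisym_relators :: "nat \<Rightarrow> ('e list \<Rightarrow> 'k) set set" where
  "semisym_relators d = {(inv\<^bsub>K\<^esub> (chi d \<sigma>) \<odot>\<^bsub>T d\<^esub> z) \<ominus>\<^bsub>T d\<^esub> perm_tensor K E d \<sigma> z | \<sigma> z.
     \<sigma> \<in> W d \<and> z \<in> carrier (T d)}"

lemma semisym_rel_eq: "semisym_rel K W chi E d = generated_submodule K (T d) (semisym_relators d)"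
  by (simp add: semisym_rel_def semisym_relators_def Let_def)

lemma perm_tensor_closed:
  "\<sigma> \<in> W d \<Longrightarrow> z \<in> carrier (T d) \<Longrightarrow> perm_tensor K E d \<sigma> z \<in> carrier (T d)"
  using linear_map.closed[OF perm_tensor_linear(1)[OF W_permutes]] .

lemma semisym_relators_closed: "semisym_relators d \<subseteq> carrier (T d)"
  by (auto simp: semisym_relators_def perm_tensor_closed)

lemma semisym_rel_submodule: "submodule (semisym_rel K W chi E d) K (T d)"
  unfolding semisym_rel_eq by (rule T.generated_submodule_submodule[OF semisym_relators_closed])

sublocale P: module K "P d" for d
  using quot_module_linear[OF T.module_axioms semisym_rel_submodule, of d]
  unfolding semisym_power_def by (rule linear_map.axioms(2))

sublocale sc: linear_map K "T d" "P d" "semisym_coset K W chi E d" for d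
  using quot_module_linear[OF T.module_axioms semisym_rel_submodule, of d]
  unfolding semisym_power_def semisym_coset_def[abs_def] .

lemma carrier_P: "carrier (P d) = semisym_coset K W chi E d ` carrier (T d)"
  unfolding semisym_power_def carrier_quot_module semisym_coset_def ..

text \<open>The component of \<open>semisym_prod\<close> in degree \<open>length xs\<close>. It is
  kept in its own power, so that generation, vanishing and functionals can be treated one degree at
  a time.\<close>

definition e :: "'e list \<Rightarrow> ('e list \<Rightarrow> 'k) set set" where
  "e xs = semisym_coset K W chi E (length xs) (pure_tensor K E xs)"

lemma e_eq:
  "xs \<in> tuples A d \<Longrightarrow> e xs = semisym_coset K W chi E d (tensor_coset K E d (free_gen K xs))"
  by (auto simp: e_def tuples_def pure_tensor_def)

lemma coset_linear: "linear_map K (F d) (P d) (\<lambda>f. semisym_coset K W chi E d (tensor_coset K E d f))"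
  by (rule linear_map_comp[OF tc.linear_map_axioms sc.linear_map_axioms])

lemma e_closed [simp]: "xs \<in> tuples (carrier E) d \<Longrightarrow> e xs \<in> carrier (P d)"
  using linear_map.closed[OF coset_linear free_gen_F] by (simp add: e_eq)

lemma e_multilinear: "multilinear d (P d) e"
  unfolding multilinear_def
proof (intro conjI ballI allI impI)
  fix xs t assume xs: "xs \<in> tuples (carrier E) d" "t < d"
  have "linear_map K E (P d) (\<lambda>x. semisym_coset K W chi E d (tensor_coset K E d (free_gen K (xs[t := x]))))"
    using linear_map_comp[OF _ sc.linear_map_axioms, of E d] pure_tensor_multilinear[of d] xs
    by (auto simp: multilinear_def)
  moreover have "length (xs[t := x]) = d" for x using xs by (simp add: tuples_def)
  then have "e (xs[t := x]) = semisym_coset K W chi E d (tensor_coset K E d (free_gen K (xs[t := x])))" for x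
    by (intro e_eq[of _ UNIV]) (simp add: tuples_def)
  ultimately show "linear_map K E (P d) (\<lambda>x. e (xs[t := x]))" by simp
qed simp

lemma P_generated:
  assumes N: "submodule N K (P d)" and e: "\<And>xs. xs \<in> tuples (carrier E) d \<Longrightarrow> e xs \<in> N"
    and u: "u \<in> carrier (P d)"
  shows "u \<in> N"
proof -
  let ?\<pi> = "\<lambda>f. semisym_coset K W chi E d (tensor_coset K E d f)"
  obtain f where f: "f \<in> carrier (F d)" "u = ?\<pi> f" using u by (auto simp: carrier_P carrier_T)
  have "f \<in> {f \<in> carrier (F d). ?\<pi> f \<in> N}"
    by (rule F_generated[OF linear_map.vimage_submodule[OF coset_linear N]])
      (use e e_eq free_gen_F f in auto)
  then show ?thesis using f by simp
qed

lemma semisym_coset_perm: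
  assumes "\<sigma> \<in> W d" "z \<in> carrier (T d)"
  shows "semisym_coset K W chi E d (perm_tensor K E d \<sigma> z) =
    inv\<^bsub>K\<^esub> (chi d \<sigma>) \<odot>\<^bsub>P d\<^esub> semisym_coset K W chi E d z"
proof -
  have "inv\<^bsub>K\<^esub> (chi d \<sigma>) \<odot>\<^bsub>T d\<^esub> z \<ominus>\<^bsub>T d\<^esub> perm_tensor K E d \<sigma> z \<in> semisym_rel K W chi E d"
    unfolding semisym_rel_eq
    by (rule T.generated_submodule_incl) (use assms in \<open>auto simp: semisym_relators_def\<close>)
  then have "semisym_coset K W chi E d (inv\<^bsub>K\<^esub> (chi d \<sigma>) \<odot>\<^bsub>T d\<^esub> z) =
      semisym_coset K W chi E d (perm_tensor K E d \<sigma> z)"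
    using T.coset_eq_iff[OF semisym_rel_submodule] assms perm_tensor_closed[OF assms]
    by (simp add: semisym_coset_def)
  then show ?thesis using assms by (simp add: sc.smult)
qed

lemma e_perm:
  assumes "\<sigma> \<in> W d" "xs \<in> tuples (carrier E) d"
  shows "e (perm_tuple \<sigma> xs) = inv\<^bsub>K\<^esub> (chi d \<sigma>) \<odot>\<^bsub>P d\<^esub> e xs"
proof -
  note \<sigma> = W_permutes[OF assms(1)]
  have "perm_tensor K E d \<sigma> (tensor_coset K E d (free_gen K xs)) =
      tensor_coset K E d (free_gen K (perm_tuple \<sigma> xs))"
    using perm_tensor_linear(2)[OF \<sigma> free_gen_F[OF assms(2)]] fperm_free_gen[of \<sigma> xs] \<sigma> assms(2)
    by (simp add: tuples_def)
  moreover have "perm_tuple \<sigma> xs \<in> tuples (carrier E) d"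
    using assms(2) tuples_perm_tuple_iff[OF \<sigma>] by blast
  ultimately show ?thesis
    using semisym_coset_perm[OF assms(1) tc.closed[OF free_gen_F[OF assms(2)]]] assms(2)
    by (simp add: e_eq)
qed

lemma e_perm':
  assumes "\<sigma> \<in> W d" "xs \<in> tuples (carrier E) d"
  shows "e xs = chi d \<sigma> \<odot>\<^bsub>P d\<^esub> e (perm_tuple \<sigma> xs)"
  using e_perm[OF assms] chi_Units[OF assms(1)] assms
  by (simp flip: P.smult_assoc1)

text \<open>The value \<open>\<zeta> = \<chi>(\<sigma>)\<close> is a root of unity different from \<open>1\<close> which fixes \<open>e xs\<close>, so
  \<open>n e xs = (1 + \<zeta> + \<dots> + \<zeta>\<^bsup>n - 1\<^esup>) e xs = 0\<close> if \<open>\<zeta>\<^sup>n = 1\<close>.\<close>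

lemma e_eq_zero:
  assumes \<sigma>: "\<sigma> \<in> W d" and xs: "xs \<in> tuples (carrier E) d"
    and fixed: "perm_tuple \<sigma> xs = xs" and chi: "chi d \<sigma> \<noteq> \<one>\<^bsub>K\<^esub>"
  shows "e xs = \<zero>\<^bsub>P d\<^esub>"
proof -
  obtain n where n: "n > 0" "chi d \<sigma> [^]\<^bsub>K\<^esub> (n::nat) = \<one>\<^bsub>K\<^esub>" by (rule chi_finite_order[OF \<sigma>])
  have "chi d \<sigma> \<odot>\<^bsub>P d\<^esub> e xs = e xs" using e_perm'[OF \<sigma> xs] fixed by simp
  from P.geometric_sum_smult[OF chi_closed[OF \<sigma>] e_closed[OF xs] this, of n]
  obtain s where s: "s \<in> carrier K" "s \<otimes>\<^bsub>K\<^esub> chi d \<sigma> \<oplus>\<^bsub>K\<^esub> \<one>\<^bsub>K\<^esub> = s \<oplus>\<^bsub>K\<^esub> \<one>\<^bsub>K\<^esub>"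
    "s \<odot>\<^bsub>P d\<^esub> e xs = ([n] \<cdot>\<^bsub>K\<^esub> \<one>\<^bsub>K\<^esub>) \<odot>\<^bsub>P d\<^esub> e xs" using n(2) by auto
  have "s \<otimes>\<^bsub>K\<^esub> chi d \<sigma> = s \<otimes>\<^bsub>K\<^esub> \<one>\<^bsub>K\<^esub>" using s(1,2) chi_closed[OF \<sigma>] by simp
  \<comment> \<open>A nonzero s could be cancelled in the domain, giving \<chi>(\<sigma>) =
    1.\<close>
  then have "s = \<zero>\<^bsub>K\<^esub>" using R.m_lcancel[of s "chi d \<sigma>" "\<one>\<^bsub>K\<^esub>"] s(1) chi chi_closed[OF \<sigma>] by auto
  then have nz: "([n] \<cdot>\<^bsub>K\<^esub> \<one>\<^bsub>K\<^esub>) \<odot>\<^bsub>P d\<^esub> e xs = \<zero>\<^bsub>P d\<^esub>" using s(3) xs by simp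
  let ?n = "[n] \<cdot>\<^bsub>K\<^esub> \<one>\<^bsub>K\<^esub>"
  \<comment> \<open>n annihilates \<open>e xs\<close> and is a unit, so multiplying by its inverse
    finishes the argument.\<close>
  have "e xs = (inv\<^bsub>K\<^esub> ?n \<otimes>\<^bsub>K\<^esub> ?n) \<odot>\<^bsub>P d\<^esub> e xs" using nat_Units[OF n(1)] xs by simp
  also have "\<dots> = inv\<^bsub>K\<^esub> ?n \<odot>\<^bsub>P d\<^esub> (?n \<odot>\<^bsub>P d\<^esub> e xs)"
    using nat_Units[OF n(1)] xs by (intro P.smult_assoc1) auto
  also have "\<dots> = \<zero>\<^bsub>P d\<^esub>" unfolding nz using nat_Units[OF n(1)] by simp
  finally show ?thesis .
qed

text \<open>g is extended linearly to the free module and then pushed through both quotients: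
  multilinearity kills the tensor relators, the symmetry condition the semi-symmetric ones.\<close>

lemma semisym_power_universal:
  fixes X :: "('k, 'x, 'y) module_scheme"
  assumes X: "module K X" and g: "multilinear d X g"
    and sym: "\<And>\<sigma> xs. \<sigma> \<in> W d \<Longrightarrow> xs \<in> tuples (carrier E) d \<Longrightarrow>
      g (perm_tuple \<sigma> xs) = inv\<^bsub>K\<^esub> (chi d \<sigma>) \<odot>\<^bsub>X\<^esub> g xs"
  obtains k where "linear_map K (P d) X k" "\<And>xs. xs \<in> tuples (carrier E) d \<Longrightarrow> k (e xs) = g xs"
proof -
  have "g \<in> tuples (carrier E) d \<rightarrow> carrier X" using g by (simp add: multilinear_def)
  from free_module_lift[OF X this]
  obtain h where hl: "linear_map K (F d) X h"
    and hg: "\<And>xs. xs \<in> tuples (carrier E) d \<Longrightarrow> h (free_gen K xs) = g xs" by blast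
  interpret h: linear_map K "F d" X h by fact
  have "linear_map K E X (\<lambda>x. h (free_gen K (xs[t := x])))"
    if "xs \<in> tuples (carrier E) d" "t < d" for xs t
  proof -
    interpret l: linear_map K E X "\<lambda>x. g (xs[t := x])" using g that by (auto simp: multilinear_def)
    show ?thesis using that l.add l.smult l.closed
      by (intro linear_map.intro linear_map_axioms.intro E.module_axioms X)
        (simp_all add: hg tuples_list_update)
  qed
  then have "multilinear d X (\<lambda>xs. h (free_gen K xs))"
    using h.closed free_gen_F by (auto simp: multilinear_def)
  then have "h r = \<zero>\<^bsub>X\<^esub>" if "r \<in> tensor_relators K E d" for r
    using that vanish_on_relators_iff[OF hl] by blast
  from quot_module_universal[OF hl tensor_relators_closed this]
  obtain k1 where k1l: "linear_map K (T d) X k1"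
    and k1: "\<And>f. f \<in> carrier (F d) \<Longrightarrow> k1 (tensor_coset K E d f) = h f"
    unfolding tensor_power_def tensor_coset_def tensor_rel_def by blast
  interpret k1: linear_map K "T d" X k1 by fact
  have "k1 s = \<zero>\<^bsub>X\<^esub>" if s: "s \<in> semisym_relators d" for s
  proof -
    obtain \<sigma> z where \<sigma>: "\<sigma> \<in> W d" and z: "z \<in> carrier (T d)"
      and s': "s = inv\<^bsub>K\<^esub> (chi d \<sigma>) \<odot>\<^bsub>T d\<^esub> z \<ominus>\<^bsub>T d\<^esub> perm_tensor K E d \<sigma> z"
      using s unfolding semisym_relators_def by blast
    note \<sigma>' = W_permutes[OF \<sigma>]
    obtain f where f: "f \<in> carrier (F d)" "z = tensor_coset K E d f" using z by (auto simp: carrier_T)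
    interpret l: linear_map K "F d" "F d" "fperm \<sigma>" by (rule fperm_linear[OF \<sigma>'])
    let ?c = "inv\<^bsub>K\<^esub> (chi d \<sigma>)"
    \<comment> \<open>The symmetry is given on tuples only. Both sides are linear in f, so the f
      satisfying it form a submodule, and it extends from generators to all representatives.\<close>
    have "submodule {f \<in> carrier (F d). h (fperm \<sigma> f) = ?c \<odot>\<^bsub>X\<^esub> h f} K (F d)"
    proof (rule F.submoduleI')
      fix c x assume cx: "c \<in> carrier K" "x \<in> {f \<in> carrier (F d). h (fperm \<sigma> f) = ?c \<odot>\<^bsub>X\<^esub> h f}"
      then have "c \<odot>\<^bsub>X\<^esub> (?c \<odot>\<^bsub>X\<^esub> h x) = ?c \<odot>\<^bsub>X\<^esub> (c \<odot>\<^bsub>X\<^esub> h x)"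
        using \<sigma> h.closed by (simp add: E.R.m_comm flip: h.N.smult_assoc1)
      then show "c \<odot>\<^bsub>F d\<^esub> x \<in> {f \<in> carrier (F d). h (fperm \<sigma> f) = ?c \<odot>\<^bsub>X\<^esub> h f}"
        using cx l.closed by (simp add: l.smult h.smult)
    qed (use \<sigma> l.closed h.closed in \<open>auto simp: l.add h.add l.zero h.zero h.N.smult_r_distr\<close>)
    then have "f \<in> {f \<in> carrier (F d). h (fperm \<sigma> f) = ?c \<odot>\<^bsub>X\<^esub> h f}"
    proof (rule F_generated[OF _ _ f(1)])
      fix xs assume xs: "xs \<in> tuples (carrier E) d"
      then have "length xs = d" by (simp add: tuples_def)
      then show "free_gen K xs \<in> {f \<in> carrier (F d). h (fperm \<sigma> f) = ?c \<odot>\<^bsub>X\<^esub> h f}"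
        using xs \<sigma>' tuples_perm_tuple_iff[OF \<sigma>', of xs "carrier E"]
        by (simp add: fperm_free_gen hg sym \<sigma> free_gen_F)
    qed
    then have "k1 (perm_tensor K E d \<sigma> z) = ?c \<odot>\<^bsub>X\<^esub> k1 z"
      using f l.closed by (simp add: perm_tensor_linear(2)[OF \<sigma>'] k1)
    then show ?thesis
      using s' z \<sigma> perm_tensor_closed[OF \<sigma> z] k1.closed[OF z] X
      by (simp add: k1.minus k1.smult h.N.minus_eq_zero_iff)
  qed
  from quot_module_universal[OF k1l semisym_relators_closed this]
  obtain k where k: "linear_map K (P d) X k"
    "\<And>z. z \<in> carrier (T d) \<Longrightarrow> k (semisym_coset K W chi E d z) = k1 z"
    unfolding semisym_power_def semisym_coset_def semisym_rel_eq by blast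
  show thesis
    by (rule that[OF k(1)]) (simp add: e_eq k(2) k1 hg free_gen_F tc.closed)
qed

text \<open>Here \<omega>-invariance enters. A relator of \<sigma> in \<open>W p\<close>, multiplied
  on the right, is the relator of the same \<sigma> in degree p + q; a relator of \<sigma> in
  \<open>W q\<close>, multiplied on the left, is the relator of its p-fold shift. Equal character
  values make the coefficients match.\<close>

lemma semisym_mult_bilinear:
  shows "bilinear_map K (P p) (P q) (P (p + q)) (semisym_mult K W chi E p q)" (is ?bil)
    and "y \<in> carrier (T p) \<Longrightarrow> z \<in> carrier (T q) \<Longrightarrow>
      semisym_mult K W chi E p q (semisym_coset K W chi E p y) (semisym_coset K W chi E q z) =
        semisym_coset K W chi E (p + q) (tensor_mult K E p q y z)" (is "PROP ?val")
proof -
  interpret B: bilinear_map K "T p" "T q" "T (p + q)" "tensor_mult K E p q"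
    by (rule tensor_mult_bilinear(1))
  have cl: "tensor_mult K E p q y z \<in> carrier (T (p + q))"
    if "y \<in> carrier (T p)" "z \<in> carrier (T q)" for y z
    using linear_map.closed[OF B.lin_left] that by blast
  have 1: "tensor_mult K E p q s z \<in> semisym_rel K W chi E (p + q)"
    if s: "s \<in> semisym_relators p" and z: "z \<in> carrier (T q)" for s z
  proof -
    interpret l: linear_map K "T p" "T (p + q)" "\<lambda>y. tensor_mult K E p q y z" by (rule B.lin_left[OF z])
    obtain \<sigma> y where \<sigma>: "\<sigma> \<in> W p" and y: "y \<in> carrier (T p)"
      and s: "s = inv\<^bsub>K\<^esub> (chi p \<sigma>) \<odot>\<^bsub>T p\<^esub> y \<ominus>\<^bsub>T p\<^esub> perm_tensor K E p \<sigma> y"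
      using s unfolding semisym_relators_def by blast
    have "tensor_mult K E p q s z = inv\<^bsub>K\<^esub> (chi (p + q) \<sigma>) \<odot>\<^bsub>T (p + q)\<^esub> tensor_mult K E p q y z
        \<ominus>\<^bsub>T (p + q)\<^esub> perm_tensor K E (p + q) \<sigma> (tensor_mult K E p q y z)"
      using \<sigma> y z perm_tensor_closed[OF \<sigma> y] W_extend[OF \<sigma>]
      by (simp add: s l.minus l.smult perm_tensor_mult_left[OF W_permutes])
    then show ?thesis
      unfolding semisym_rel_eq
      using W_extend[OF \<sigma>, of q] cl[OF y z]
      by (intro T.generated_submodule_incl) (unfold semisym_relators_def, blast)
  qed
  have 2: "tensor_mult K E p q y s \<in> semisym_rel K W chi E (p + q)"
    if y: "y \<in> carrier (T p)" and s: "s \<in> semisym_relators q" for s y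
  proof -
    interpret l: linear_map K "T q" "T (p + q)" "tensor_mult K E p q y" by (rule B.lin_right[OF y])
    obtain \<sigma> z where \<sigma>: "\<sigma> \<in> W q" and z: "z \<in> carrier (T q)"
      and s: "s = inv\<^bsub>K\<^esub> (chi q \<sigma>) \<odot>\<^bsub>T q\<^esub> z \<ominus>\<^bsub>T q\<^esub> perm_tensor K E q \<sigma> z"
      using s unfolding semisym_relators_def by blast
    let ?\<sigma> = "(omega ^^ p) \<sigma>"
    have "tensor_mult K E p q y s = inv\<^bsub>K\<^esub> (chi (p + q) ?\<sigma>) \<odot>\<^bsub>T (p + q)\<^esub> tensor_mult K E p q y z
        \<ominus>\<^bsub>T (p + q)\<^esub> perm_tensor K E (p + q) ?\<sigma> (tensor_mult K E p q y z)"
      using \<sigma> y z perm_tensor_closed[OF \<sigma> z] W_omega_pow[OF \<sigma>]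
      by (simp add: s l.minus l.smult perm_tensor_mult_right[OF W_permutes])
    then show ?thesis
      unfolding semisym_rel_eq
      using W_omega_pow[OF \<sigma>, of p] cl[OF y z]
      by (intro T.generated_submodule_incl) (unfold semisym_relators_def, blast)
  qed
  note * = bilinear_map_quot[OF B.bilinear_map_axioms semisym_relators_closed semisym_relators_closed
      semisym_rel_submodule 1 2]
  show ?bil "PROP ?val"
    using * unfolding semisym_rel_eq[symmetric] semisym_power_def[symmetric]
    by (simp_all add: semisym_mult_def[abs_def] semisym_coset_def)
qed

lemma semisym_mult_e:
  assumes "xs \<in> tuples (carrier E) p" "ys \<in> tuples (carrier E) q"
  shows "semisym_mult K W chi E p q (e xs) (e ys) = e (xs @ ys)"
  using assms
  by (simp add: e_eq[OF assms(1)] e_eq[OF assms(2)] e_eq[OF tuples_append[OF assms]]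
      semisym_mult_bilinear(2) tensor_mult_bilinear(2) tc.closed free_gen_F)
    (simp add: fmult_free_gen tuples_def)

end

section \<open>Coordinate functionals on semi-symmetric powers\<close>

lemma linear_functionalI:
  assumes "module K M" "\<And>x. x \<in> carrier M \<Longrightarrow> h x \<in> carrier K"
    and "\<And>x y. x \<in> carrier M \<Longrightarrow> y \<in> carrier M \<Longrightarrow> h (x \<oplus>\<^bsub>M\<^esub> y) = h x \<oplus>\<^bsub>K\<^esub> h y"
    and "\<And>c x. c \<in> carrier K \<Longrightarrow> x \<in> carrier M \<Longrightarrow> h (c \<odot>\<^bsub>M\<^esub> x) = c \<otimes>\<^bsub>K\<^esub> h x"
  shows "linear_map K M (scalar_module K) h"
  using assms cring.module_scalar_module[OF module.axioms(1)[OF assms(1)]]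
  by (intro linear_map.intro linear_map_axioms.intro) simp_all

lemma linear_functional_scale:
  assumes "linear_map K M (scalar_module K) h" "c \<in> carrier K"
  shows "linear_map K M (scalar_module K) (\<lambda>x. c \<otimes>\<^bsub>K\<^esub> h x)"
proof -
  interpret h: linear_map K M "scalar_module K" h by fact
  have "h x \<in> carrier K" if "x \<in> carrier M" for x using h.closed[OF that] by simp
  then show ?thesis using assms(2)
    by (intro linear_functionalI h.M.module_axioms)
      (simp_all add: h.add h.smult h.M.R.r_distr h.M.R.m_lcomm)
qed

lemma linear_functional_sum:
  assumes "module K M" and lin: "\<And>a. a \<in> A \<Longrightarrow> linear_map K M (scalar_module K) (h a)" and "finite A"
  shows "linear_map K M (scalar_module K) (\<lambda>x. finsum K (\<lambda>a. h a x) A)"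
proof -
  interpret M: module K M by fact
  have cl: "(\<lambda>a. h a x) \<in> A \<rightarrow> carrier K" if "x \<in> carrier M" for x
    using linear_map.closed[OF lin] that by auto
  show ?thesis
  proof (rule linear_functionalI[OF \<open>module K M\<close>])
    fix x y assume xy: "x \<in> carrier M" "y \<in> carrier M"
    have "finsum K (\<lambda>a. h a (x \<oplus>\<^bsub>M\<^esub> y)) A = finsum K (\<lambda>a. h a x \<oplus>\<^bsub>K\<^esub> h a y) A"
      by (rule M.R.finsum_cong')
        (use cl[OF xy(1)] cl[OF xy(2)] xy linear_map.add[OF lin] in \<open>auto simp: Pi_def\<close>)
    then show "finsum K (\<lambda>a. h a (x \<oplus>\<^bsub>M\<^esub> y)) A = finsum K (\<lambda>a. h a x) A \<oplus>\<^bsub>K\<^esub> finsum K (\<lambda>a. h a y) A"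
      using M.R.finsum_addf[OF cl[OF xy(1)] cl[OF xy(2)]] by simp
  next
    fix c x assume c: "c \<in> carrier K" and x: "x \<in> carrier M"
    have "finsum K (\<lambda>a. h a (c \<odot>\<^bsub>M\<^esub> x)) A = finsum K (\<lambda>a. c \<otimes>\<^bsub>K\<^esub> h a x) A"
      by (rule M.R.finsum_cong')
        (use cl[OF x] c x linear_map.smult[OF lin] in \<open>auto simp: Pi_def\<close>)
    then show "finsum K (\<lambda>a. h a (c \<odot>\<^bsub>M\<^esub> x)) A = c \<otimes>\<^bsub>K\<^esub> finsum K (\<lambda>a. h a x) A"
      using M.R.finsum_rdistr[OF \<open>finite A\<close> c cl[OF x]] by simp
  qed (rule M.R.finsum_closed[OF cl])
qed

text \<open>For a dual basis \<phi>, the coordinate at i of the pure tensor of xs. Lists of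
  different length give the product over the common prefix, so that the value lies in K without a
  condition on lengths.\<close>

fun tensor_form :: "('k, 'm) ring_scheme \<Rightarrow> ('l \<Rightarrow> 'e \<Rightarrow> 'k) \<Rightarrow> 'l list \<Rightarrow> 'e list \<Rightarrow> 'k" where
  "tensor_form K \<phi> (l # i) (x # xs) = \<phi> l x \<otimes>\<^bsub>K\<^esub> tensor_form K \<phi> i xs"
| "tensor_form K \<phi> _ _ = \<one>\<^bsub>K\<^esub>"

lemma (in tensor) tensor_form_closed:
  assumes \<phi>: "\<And>l. linear_map K E (scalar_module K) (\<phi> l)"
  shows "set xs \<subseteq> carrier E \<Longrightarrow> tensor_form K \<phi> i xs \<in> carrier K"
  using linear_map.closed[OF \<phi>] by (induction i xs rule: list_induct2') auto

lemma (in tensor) tensor_form_linear: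
  assumes \<phi>: "\<And>l. linear_map K E (scalar_module K) (\<phi> l)"
    and "length i = length xs" "t < length xs" "set xs \<subseteq> carrier E"
  shows "linear_map K E (scalar_module K) (\<lambda>x. tensor_form K \<phi> i (xs[t := x]))"
  using assms(2-)
proof (induction i xs arbitrary: t rule: list_induct2)
  case (Cons l i y xs)
  have y: "\<phi> l y \<in> carrier K" using linear_map.closed[OF \<phi>] Cons.prems by simp
  have c: "tensor_form K \<phi> i xs \<in> carrier K" using tensor_form_closed[where \<phi> = \<phi>, OF \<phi>] Cons.prems by simp
  show ?case
  proof (cases t)
    case 0
    have "linear_map K E (scalar_module K) (\<lambda>x. tensor_form K \<phi> i xs \<otimes>\<^bsub>K\<^esub> \<phi> l x)"
      by (rule linear_functional_scale[OF \<phi> c])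
    then show ?thesis using 0 linear_map.closed[OF \<phi>] c
      by (intro linear_functionalI E.module_axioms)
        (simp_all add: linear_map.add[OF \<phi>] linear_map.smult[OF \<phi>] E.R.l_distr E.R.m_assoc)
  next
    case (Suc t')
    then have "linear_map K E (scalar_module K) (\<lambda>x. tensor_form K \<phi> i (xs[t' := x]))"
      using Cons by simp
    from linear_functional_scale[OF this y] show ?thesis by (simp add: Suc)
  qed
qed simp

lemma (in tensor) tensor_form_basis:
  assumes \<phi>: "\<And>l l'. l' \<in> L \<Longrightarrow> \<phi> l (b l') = (if l = l' then \<one>\<^bsub>K\<^esub> else \<zero>\<^bsub>K\<^esub>)"
    and "length i = length j" "set j \<subseteq> L"
  shows "tensor_form K \<phi> i (map b j) = (if i = j then \<one>\<^bsub>K\<^esub> else \<zero>\<^bsub>K\<^esub>)"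
  using assms(2-) by (induction i j rule: list_induct2) (auto simp: \<phi>)

context semisym
begin

lemma map_basis_tuples:
  "module_basis K E L b \<Longrightarrow> i \<in> tuples L d \<Longrightarrow> map b i \<in> tuples (carrier E) d"
  using module_basis.in_carrier[of K E L b] by (auto simp: tuples_def)

lemma map_perm_tuple:
  "\<sigma> \<in> W d \<Longrightarrow> i \<in> tuples A d \<Longrightarrow> map f (perm_tuple \<sigma> i) = perm_tuple \<sigma> (map f i)"
  using perm_tuple_map[of \<sigma> i f] W_permutes[of \<sigma> d] by (simp add: tuples_def)

text \<open>Every \<tau> is (\<tau> \<circ> \<sigma>^-1) \<circ> \<sigma>. The right translation
  serves to reindex both the averaging sum and orbits.\<close>

lemma W_comp_image: "\<sigma> \<in> W d \<Longrightarrow> (\<lambda>\<tau>. \<tau> \<circ> \<sigma>) ` W d = W d"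
proof (intro equalityI subsetI)
  fix \<tau> assume "\<sigma> \<in> W d" "\<tau> \<in> W d"
  then have "\<tau> = (\<tau> \<circ> inv' \<sigma>) \<circ> \<sigma>" "\<tau> \<circ> inv' \<sigma> \<in> W d"
    using W_permutes[of \<sigma> d] W_comp W_inv by (simp_all add: comp_assoc permutes_inv_o)
  then show "\<tau> \<in> (\<lambda>\<tau>. \<tau> \<circ> \<sigma>) ` W d" by blast
qed (auto intro: W_comp)

text \<open>At \<sigma> x the average is the sum of \<chi>(\<tau>) \<Phi>(\<tau> \<sigma> x). Since
  \<chi>(\<tau>) = \<chi>(\<sigma>)^-1 \<chi>(\<tau> \<sigma>), reindexing by \<tau> \<sigma> gives
  \<chi>(\<sigma>)^-1 times the average at x, as the universal property demands. On basis tuples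
  \<Phi> singles out the \<tau> that carry i to j.\<close>

lemma coordinate_functional:
  assumes b: "module_basis K E L b" and j: "j \<in> tuples L d"
  obtains h where "linear_map K (P d) (scalar_module K) h"
    "\<And>i. i \<in> tuples L d \<Longrightarrow> h (e (map b i)) =
      finsum K (\<lambda>\<tau>. if perm_tuple \<tau> i = j then chi d \<tau> else \<zero>\<^bsub>K\<^esub>) (W d)"
proof -
  obtain \<phi> where \<phi>: "\<And>l. linear_map K E (scalar_module K) (\<phi> l)"
    "\<And>l l'. l' \<in> L \<Longrightarrow> \<phi> l (b l') = (if l = l' then \<one>\<^bsub>K\<^esub> else \<zero>\<^bsub>K\<^esub>)"
    by (rule module_basis_dual[OF b]) blast
  have perm: "perm_tuple \<tau> xs \<in> tuples A d" if "\<tau> \<in> W d" "xs \<in> tuples A d" for \<tau> xs and A :: "'x set"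
    using that tuples_perm_tuple_iff[OF W_permutes] by blast
  have form: "tensor_form K \<phi> j (perm_tuple \<tau> xs) \<in> carrier K"
    if "\<tau> \<in> W d" "xs \<in> tuples (carrier E) d" for \<tau> xs
    using tensor_form_closed[where \<phi> = \<phi>, OF \<phi>(1)] perm[OF that] by (simp add: tuples_def)
  define g where "g = (\<lambda>xs. finsum K (\<lambda>\<tau>. chi d \<tau> \<otimes>\<^bsub>K\<^esub> tensor_form K \<phi> j (perm_tuple \<tau> xs)) (W d))"
  have g_closed: "g xs \<in> carrier K" if "xs \<in> tuples (carrier E) d" for xs
    unfolding g_def by (rule E.R.finsum_closed) (use form that in auto)
  have "multilinear d (scalar_module K) g"
    unfolding multilinear_def
  proof (intro conjI ballI allI impI)
    fix xs t assume xs: "xs \<in> tuples (carrier E) d" and t: "t < d"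
    show "linear_map K E (scalar_module K) (\<lambda>x. g (xs[t := x]))"
      unfolding g_def
    proof (intro linear_functional_sum linear_functional_scale E.module_axioms finite_W)
      fix \<tau> assume \<tau>: "\<tau> \<in> W d"
      then have "perm_tuple \<tau> (xs[t := x]) = (perm_tuple \<tau> xs)[\<tau> (Suc t) - 1 := x]" for x
        using perm_tuple_list_update[of \<tau> xs t x] W_permutes[OF \<tau>] xs t by (simp add: tuples_def)
      moreover have "\<tau> (Suc t) - 1 < d" using permutes_index(1)[OF W_permutes[OF \<tau>] t] .
      ultimately show "linear_map K E (scalar_module K) (\<lambda>x. tensor_form K \<phi> j (perm_tuple \<tau> (xs[t := x])))"
        using tensor_form_linear[where \<phi> = \<phi>, OF \<phi>(1), of j "perm_tuple \<tau> xs" "\<tau> (Suc t) - 1"] perm[OF \<tau> xs] j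
        by (simp add: tuples_def)
    qed simp
  qed (use g_closed in auto)
  moreover have "g (perm_tuple \<sigma> xs) = inv\<^bsub>K\<^esub> (chi d \<sigma>) \<odot>\<^bsub>scalar_module K\<^esub> g xs"
    if \<sigma>: "\<sigma> \<in> W d" and xs: "xs \<in> tuples (carrier E) d" for \<sigma> xs
  proof -
    let ?f = "\<lambda>\<tau>. chi d \<tau> \<otimes>\<^bsub>K\<^esub> tensor_form K \<phi> j (perm_tuple \<tau> xs)"
    let ?c = "inv\<^bsub>K\<^esub> (chi d \<sigma>)"
    have f: "?f \<in> W d \<rightarrow> carrier K" using form xs by auto
    \<comment> \<open>Composition with \<sigma> on the right is injective because \<sigma> is
      onto.\<close>
    have "inj_on (\<lambda>\<tau>. \<tau> \<circ> \<sigma>) (W d)"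
      using permutes_surj[OF W_permutes[OF \<sigma>]] by (intro inj_onI) (metis surj_fun_eq fun_cong comp_apply surjD ext)
    then have "g xs = finsum K (\<lambda>\<tau>. ?f (\<tau> \<circ> \<sigma>)) (W d)"
      using E.R.finsum_reindex[of ?f "\<lambda>\<tau>. \<tau> \<circ> \<sigma>" "W d"] f W_comp_image[OF \<sigma>] by (simp add: g_def)
    then have "?c \<otimes>\<^bsub>K\<^esub> g xs = finsum K (\<lambda>\<tau>. ?c \<otimes>\<^bsub>K\<^esub> ?f (\<tau> \<circ> \<sigma>)) (W d)"
      using E.R.finsum_rdistr[of "W d" ?c "\<lambda>\<tau>. ?f (\<tau> \<circ> \<sigma>)"] f finite_W W_comp[OF _ \<sigma>] \<sigma>
      by (simp add: Pi_def)
    also have "\<dots> = g (perm_tuple \<sigma> xs)"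
      unfolding g_def
    proof (rule E.R.finsum_cong')
      fix \<tau> assume \<tau>: "\<tau> \<in> W d"
      have "perm_tuple \<tau> (perm_tuple \<sigma> xs) = perm_tuple (\<tau> \<circ> \<sigma>) xs"
        using perm_tuple_comp[of \<tau> xs \<sigma>] W_permutes[OF \<sigma>] W_permutes[OF \<tau>] xs
        by (simp add: tuples_def)
      moreover have "chi d \<tau> = ?c \<otimes>\<^bsub>K\<^esub> chi d (\<tau> \<circ> \<sigma>)"
        using \<sigma> \<tau> chi_Units[OF \<sigma>] by (simp add: chi_comp E.R.m_lcomm)
      ultimately show "?c \<otimes>\<^bsub>K\<^esub> ?f (\<tau> \<circ> \<sigma>) = chi d \<tau> \<otimes>\<^bsub>K\<^esub> tensor_form K \<phi> j (perm_tuple \<tau> (perm_tuple \<sigma> xs))"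
        using \<sigma> \<tau> xs form[OF W_comp[OF \<tau> \<sigma>] xs] W_comp[OF \<tau> \<sigma>] by (simp add: E.R.m_assoc)
    qed (use form[OF _ perm[OF \<sigma> xs]] in auto)
    finally show ?thesis by simp
  qed
  ultimately obtain h where h: "linear_map K (P d) (scalar_module K) h"
    "\<And>xs. xs \<in> tuples (carrier E) d \<Longrightarrow> h (e xs) = g xs"
    using semisym_power_universal[OF E.R.module_scalar_module] by blast
  have "g (map b i) = finsum K (\<lambda>\<tau>. if perm_tuple \<tau> i = j then chi d \<tau> else \<zero>\<^bsub>K\<^esub>) (W d)"
    if i: "i \<in> tuples L d" for i
    unfolding g_def
  proof (rule E.R.finsum_cong')
    fix \<tau> assume \<tau>: "\<tau> \<in> W d"
    show "chi d \<tau> \<otimes>\<^bsub>K\<^esub> tensor_form K \<phi> j (perm_tuple \<tau> (map b i)) =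
        (if perm_tuple \<tau> i = j then chi d \<tau> else \<zero>\<^bsub>K\<^esub>)"
      using tensor_form_basis[of L \<phi> b j "perm_tuple \<tau> i", OF \<phi>(2)] perm[OF \<tau> i] j \<tau>
      by (auto simp: map_perm_tuple[OF \<tau> i, symmetric] tuples_def)
  qed (use chi_closed in auto)
  then show thesis using that[OF h(1)] h(2) map_basis_tuples[OF b] by simp
qed

section \<open>The semi-symmetric algebra\<close>

abbreviation A where "A \<equiv> semisym_algebra K W chi E"

lemma A_simps:
  "carrier A = {u. (\<forall>d. u d \<in> carrier (P d)) \<and> finite {d. u d \<noteq> \<zero>\<^bsub>P d\<^esub>}}"
  "\<zero>\<^bsub>A\<^esub> = (\<lambda>d. \<zero>\<^bsub>P d\<^esub>)" "u \<oplus>\<^bsub>A\<^esub> v = (\<lambda>d. u d \<oplus>\<^bsub>P d\<^esub> v d)" "c \<odot>\<^bsub>A\<^esub> u = (\<lambda>d. c \<odot>\<^bsub>P d\<^esub> u d)"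
  "u \<otimes>\<^bsub>A\<^esub> v = (\<lambda>d. \<Oplus>\<^bsub>P d\<^esub>p\<in>{..d}. semisym_mult K W chi E p (d - p) (u p) (v (d - p)))"
  by (simp_all add: semisym_algebra_def Let_def)

lemma A_closed: "u \<in> carrier A \<Longrightarrow> u d \<in> carrier (P d)"
  by (simp add: A_simps)

lemma A_module: "module K A"
proof (rule moduleI)
  show "abelian_group A"
  proof (rule abelian_groupI)
    fix u v assume u: "u \<in> carrier A" and v: "v \<in> carrier A"
    have "finite {d. u d \<oplus>\<^bsub>P d\<^esub> v d \<noteq> \<zero>\<^bsub>P d\<^esub>}"
      by (rule finite_subset[of _ "{d. u d \<noteq> \<zero>\<^bsub>P d\<^esub>} \<union> {d. v d \<noteq> \<zero>\<^bsub>P d\<^esub>}"])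
        (use u v in \<open>auto simp: A_simps\<close>)
    then show "u \<oplus>\<^bsub>A\<^esub> v \<in> carrier A" using u v by (simp add: A_simps)
    show "u \<oplus>\<^bsub>A\<^esub> v = v \<oplus>\<^bsub>A\<^esub> u"
      using A_closed[OF u] A_closed[OF v] by (simp add: A_simps P.M.a_comm)
  next
    fix u v w assume "u \<in> carrier A" "v \<in> carrier A" "w \<in> carrier A"
    then show "u \<oplus>\<^bsub>A\<^esub> v \<oplus>\<^bsub>A\<^esub> w = u \<oplus>\<^bsub>A\<^esub> (v \<oplus>\<^bsub>A\<^esub> w)"
      by (simp add: A_simps P.M.a_assoc)
  next
    fix u assume u: "u \<in> carrier A"
    have "finite {d. \<ominus>\<^bsub>P d\<^esub> u d \<noteq> \<zero>\<^bsub>P d\<^esub>}"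
      by (rule finite_subset[of _ "{d. u d \<noteq> \<zero>\<^bsub>P d\<^esub>}"]) (use u in \<open>auto simp: A_simps\<close>)
    then have "(\<lambda>d. \<ominus>\<^bsub>P d\<^esub> u d) \<in> carrier A" using u by (simp add: A_simps)
    moreover have "(\<lambda>d. \<ominus>\<^bsub>P d\<^esub> u d) \<oplus>\<^bsub>A\<^esub> u = \<zero>\<^bsub>A\<^esub>"
      using A_closed[OF u] by (simp add: A_simps P.M.l_neg)
    ultimately show "\<exists>v\<in>carrier A. v \<oplus>\<^bsub>A\<^esub> u = \<zero>\<^bsub>A\<^esub>" by blast
  qed (simp_all add: A_simps)
next
  fix c u assume c: "c \<in> carrier K" and u: "u \<in> carrier A"
  have "finite {d. c \<odot>\<^bsub>P d\<^esub> u d \<noteq> \<zero>\<^bsub>P d\<^esub>}"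
    by (rule finite_subset[of _ "{d. u d \<noteq> \<zero>\<^bsub>P d\<^esub>}"]) (use c u in \<open>auto simp: A_simps\<close>)
  then show "c \<odot>\<^bsub>A\<^esub> u \<in> carrier A" using c u by (simp add: A_simps)
qed (simp_all add: A_simps E.R.is_cring P.smult_l_distr P.smult_r_distr P.smult_assoc1)

sublocale A: module K A by (rule A_module)

lemma component_linear: "linear_map K A (P d) (\<lambda>u. u d)"
  by (intro linear_map.intro linear_map_axioms.intro A_module P.module_axioms)
    (simp_all add: A_simps)

definition inc :: "nat \<Rightarrow> ('e list \<Rightarrow> 'k) set set \<Rightarrow> nat \<Rightarrow> ('e list \<Rightarrow> 'k) set set" where
  "inc d x = (\<lambda>d'. if d' = d then x else \<zero>\<^bsub>P d'\<^esub>)"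

lemma inc_linear: "linear_map K (P d) A (inc d)"
proof (intro linear_map.intro linear_map_axioms.intro A_module P.module_axioms)
  fix x assume "x \<in> carrier (P d)"
  moreover have "finite {d'. inc d x d' \<noteq> \<zero>\<^bsub>P d'\<^esub>}"
    by (rule finite_subset[of _ "{d}"]) (auto simp: inc_def)
  ultimately show "inc d x \<in> carrier A" by (simp add: A_simps) (simp add: inc_def)
qed (simp_all add: A_simps inc_def fun_eq_iff)

sublocale inc: linear_map K "P d" A "inc d" for d by (rule inc_linear)

lemma semisym_prod_eq: "semisym_prod K W chi E xs = inc (length xs) (e xs)"
  by (simp add: semisym_prod_def inc_def e_def fun_eq_iff)

text \<open>An element of the direct sum has finitely many nonzero components, which are split off
  one degree at a time.\<close>

lemma A_generated:
  assumes N: "submodule N K A" and inc: "\<And>d x. x \<in> carrier (P d) \<Longrightarrow> inc d x \<in> N"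
  shows "carrier A \<subseteq> N"
proof -
  have "u \<in> N" if "finite S" "u \<in> carrier A" "{d. u d \<noteq> \<zero>\<^bsub>P d\<^esub>} \<subseteq> S" for S u
    using that
  proof (induction S arbitrary: u)
    case empty
    then have "u = \<zero>\<^bsub>A\<^esub>" by (auto simp: A_simps)
    then show ?case using A.submodule_zero[OF N] by simp
  next
    case (insert s S)
    note u = A_closed[OF insert.prems(1)]
    have "finite {d. (u(s := \<zero>\<^bsub>P s\<^esub>)) d \<noteq> \<zero>\<^bsub>P d\<^esub>}"
      by (rule finite_subset[of _ "{d. u d \<noteq> \<zero>\<^bsub>P d\<^esub>}"]) (use insert.prems(1) in \<open>auto simp: A_simps\<close>)
    then have "u(s := \<zero>\<^bsub>P s\<^esub>) \<in> carrier A" using u by (simp add: A_simps(1))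
    moreover have "{d. (u(s := \<zero>\<^bsub>P s\<^esub>)) d \<noteq> \<zero>\<^bsub>P d\<^esub>} \<subseteq> S" using insert.prems(2) by auto
    ultimately have "u(s := \<zero>\<^bsub>P s\<^esub>) \<in> N" by (rule insert.IH)
    then have "u(s := \<zero>\<^bsub>P s\<^esub>) \<oplus>\<^bsub>A\<^esub> inc s (u s) \<in> N"
      using inc[OF u] by (rule A.submoduleE(5)[OF N])
    moreover have "u(s := \<zero>\<^bsub>P s\<^esub>) \<oplus>\<^bsub>A\<^esub> inc s (u s) = u"
      using u by (simp add: A_simps inc_def fun_eq_iff)
    ultimately show ?case by simp
  qed
  then show ?thesis by (auto simp: A_simps(1))
qed

lemma inc_mult:
  assumes x: "x \<in> carrier (P p)" and y: "y \<in> carrier (P q)"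
  shows "inc p x \<otimes>\<^bsub>A\<^esub> inc q y = inc (p + q) (semisym_mult K W chi E p q x y)"
proof
  fix d
  let ?f = "\<lambda>r. semisym_mult K W chi E r (d - r) (inc p x r) (inc q y (d - r))"
  have cl: "inc d' z r \<in> carrier (P r)" if "z \<in> carrier (P d')" for d' z r
    using that by (auto simp: inc_def)
  \<comment> \<open>Only the summand r = p with d - r = q survives in the convolution. The bound r
    \<le> d gives r + (d - r) = d in spite of truncated subtraction, so each summand lies in
    \<open>P d\<close>.\<close>
  have zero: "?f r = \<zero>\<^bsub>P d\<^esub>" if r: "r \<le> d" and "r \<noteq> p \<or> d - r \<noteq> q" for r
  proof -
    interpret B: bilinear_map K "P r" "P (d - r)" "P d" "semisym_mult K W chi E r (d - r)"
      using semisym_mult_bilinear(1)[of r "d - r"] r by simp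
    show ?thesis
      using that(2) linear_map.zero[OF B.lin_left[OF cl[OF y]]] linear_map.zero[OF B.lin_right[OF cl[OF x]]]
      by (auto simp: inc_def split: if_splits)
  qed
  have "(\<Oplus>\<^bsub>P d\<^esub>r\<in>{..d}. ?f r) = inc (p + q) (semisym_mult K W chi E p q x y) d"
  proof (cases "d = p + q")
    case True
    interpret B: bilinear_map K "P p" "P q" "P (p + q)" "semisym_mult K W chi E p q"
      by (rule semisym_mult_bilinear(1))
    let ?s = "semisym_mult K W chi E p q x y"
    have s: "?s \<in> carrier (P d)" using linear_map.closed[OF B.lin_left[OF y] x] True by simp
    have "(\<Oplus>\<^bsub>P d\<^esub>r\<in>{..d}. ?f r) = (\<Oplus>\<^bsub>P d\<^esub>r\<in>{..d}. if p = r then ?s else \<zero>\<^bsub>P d\<^esub>)"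
      by (rule P.M.finsum_cong') (use zero s True in \<open>auto simp: inc_def\<close>)
    also have "\<dots> = ?s" by (rule P.M.finsum_singleton) (use s True in auto)
    finally show ?thesis using True by (simp add: inc_def)
  next
    case False
    have "?f r = \<zero>\<^bsub>P d\<^esub>" if "r \<le> d" for r
      by (rule zero[OF that]) (use False that in auto)
    then have "(\<Oplus>\<^bsub>P d\<^esub>r\<in>{..d}. ?f r) = (\<Oplus>\<^bsub>P d\<^esub>r\<in>{..d}. \<zero>\<^bsub>P d\<^esub>)"
      by (intro P.M.finsum_cong') simp_all
    then show ?thesis using False by (simp add: inc_def)
  qed
  then show "(inc p x \<otimes>\<^bsub>A\<^esub> inc q y) d = inc (p + q) (semisym_mult K W chi E p q x y) d"
    by (simp add: A_simps)
qed

section \<open>The basis and the multiplication table\<close>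

lemma orbit_eq: "orbit (perm_group W d) perm_tuple i = (\<lambda>\<sigma>. perm_tuple \<sigma> i) ` W d"
  by (auto simp: orbit_def)

lemma mem_index_I:
  "i \<in> index_I K W chi L d \<longleftrightarrow>
    i \<in> tuples L d \<and> (\<forall>\<sigma>\<in>W d. perm_tuple \<sigma> i = i \<longrightarrow> chi d \<sigma> = \<one>\<^bsub>K\<^esub>)"
  by (auto simp: index_I_def stabilizer_def)

lemma perm_comp: "\<sigma> \<in> W d \<Longrightarrow> \<tau> \<in> W d \<Longrightarrow> i \<in> tuples L d \<Longrightarrow>
    perm_tuple \<sigma> (perm_tuple \<tau> i) = perm_tuple (\<sigma> \<circ> \<tau>) i"
  using perm_tuple_comp[of \<sigma> i \<tau>] W_permutes by (simp add: tuples_def)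

lemma perm_inv: "\<sigma> \<in> W d \<Longrightarrow> i \<in> tuples L d \<Longrightarrow> perm_tuple (inv' \<sigma>) (perm_tuple \<sigma> i) = i"
  using perm_tuple_inv[of \<sigma> i] W_permutes[of \<sigma> d] by (simp add: tuples_def)

lemma perm_closed: "\<sigma> \<in> W d \<Longrightarrow> perm_tuple \<sigma> i \<in> tuples L d \<longleftrightarrow> i \<in> tuples L d"
  using tuples_perm_tuple_iff[OF W_permutes] .

lemma orbit_perm:
  assumes "\<sigma> \<in> W d" "i \<in> tuples L d"
  shows "orbit (perm_group W d) perm_tuple (perm_tuple \<sigma> i) = orbit (perm_group W d) perm_tuple i"
proof -
  have "(\<lambda>\<tau>. perm_tuple \<tau> (perm_tuple \<sigma> i)) ` W d = (\<lambda>\<tau>. perm_tuple \<tau> i) ` (\<lambda>\<tau>. \<tau> \<circ> \<sigma>) ` W d"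
    unfolding image_image using perm_comp assms by (intro image_cong) auto
  then show ?thesis by (simp only: orbit_eq W_comp_image[OF assms(1)])
qed

text \<open>The two stabilizers are conjugate, and a character with values in a commutative ring is
  constant on conjugacy classes. Hence an orbit that meets I lies in I, which provides every element
  of I with a representative in J.\<close>

lemma index_I_perm:
  assumes i: "i \<in> index_I K W chi L d" and \<sigma>: "\<sigma> \<in> W d"
  shows "perm_tuple \<sigma> i \<in> index_I K W chi L d"
  unfolding mem_index_I
proof (intro conjI ballI impI)
  have iL: "i \<in> tuples L d" using i by (simp add: mem_index_I)
  then show "perm_tuple \<sigma> i \<in> tuples L d" using perm_closed[OF \<sigma>] by blast
  fix \<tau> assume \<tau>: "\<tau> \<in> W d" and fixed: "perm_tuple \<tau> (perm_tuple \<sigma> i) = perm_tuple \<sigma> i"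
  let ?\<rho> = "inv' \<sigma> \<circ> (\<tau> \<circ> \<sigma>)"
  have \<rho>: "?\<rho> \<in> W d" using \<sigma> \<tau> by (intro W_comp W_inv)
  have "perm_tuple ?\<rho> i = perm_tuple (inv' \<sigma>) (perm_tuple \<tau> (perm_tuple \<sigma> i))"
    using \<sigma> \<tau> iL by (simp add: perm_comp[OF _ _ iL] W_comp W_inv)
  also have "\<dots> = i" using perm_inv[OF \<sigma> iL] fixed by simp
  finally have "chi d ?\<rho> = \<one>\<^bsub>K\<^esub>" using i \<rho> by (auto simp: mem_index_I)
  moreover have "\<sigma> \<circ> ?\<rho> = \<tau> \<circ> \<sigma>"
    using W_permutes[OF \<sigma>] by (simp add: o_assoc permutes_inv_o)
  then have "chi d \<sigma> \<otimes>\<^bsub>K\<^esub> chi d ?\<rho> = chi d \<tau> \<otimes>\<^bsub>K\<^esub> chi d \<sigma>"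
    using chi_comp[OF \<sigma> \<rho>] chi_comp[OF \<tau> \<sigma>] by simp
  ultimately have "chi d \<sigma> \<otimes>\<^bsub>K\<^esub> chi d \<tau> = chi d \<sigma> \<otimes>\<^bsub>K\<^esub> \<one>\<^bsub>K\<^esub>"
    using \<sigma> \<tau> E.R.m_comm by simp
  then show "chi d \<tau> = \<one>\<^bsub>K\<^esub>" using chi_Units[OF \<sigma>] \<tau> E.R.Units_l_cancel by simp
qed

lemma semisym_basis:
  assumes b: "module_basis K E L b" and J: "\<And>d. is_index_J K W chi L d (J d)"
  shows "module_basis K A (\<Union>d. J d) (\<lambda>j. semisym_prod K W chi E (map b j))"
proof (intro module_basis.intro module_basis_axioms.intro A_module)
  let ?v = "\<lambda>j. semisym_prod K W chi E (map b j)"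
  have v: "?v i = inc d (e (map b i))" if "i \<in> tuples L d" for i d
    using that by (simp add: semisym_prod_eq tuples_def)
  have JI: "j \<in> index_I K W chi L d" and JL: "j \<in> tuples L d" if "j \<in> J d" for j d
    using that J[of d] by (auto simp: is_index_J_def mem_index_I)
  have J_uniq: "j = k" if "j \<in> J d" "k \<in> J d" "\<sigma> \<in> W d" "perm_tuple \<sigma> k = j" for j k d \<sigma>
  proof -
    let ?B = "orbit (perm_group W d) perm_tuple k"
    have "?B \<subseteq> index_I K W chi L d"
      using index_I_perm[OF JI[OF that(2)]] by (auto simp: orbit_eq)
    moreover have "?B \<in> orbits (perm_group W d) (tuples L d) perm_tuple"
      using JL[OF that(2)] by (auto simp: orbits_def)
    ultimately have "\<exists>!j. j \<in> J d \<inter> ?B" using J[of d] by (auto simp: is_index_J_def)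
    moreover have "j \<in> ?B" using that by (auto simp: orbit_eq)
    moreover have "k \<in> ?B" unfolding orbit_eq using W_id[of d] by (intro image_eqI[of _ _ id]) auto
    ultimately show ?thesis using that by blast
  qed
  have in_A: "?v j \<in> carrier A" if "j \<in> tuples L d" for j d
    using v[OF that] inc.closed e_closed map_basis_tuples[OF b that] by metis
  then show vA: "?v \<in> (\<Union>d. J d) \<rightarrow> carrier A" using JL by auto
  have functional: "\<exists>h. linear_map K A (scalar_module K) h \<and> h (?v i) \<noteq> \<zero>\<^bsub>K\<^esub> \<and>
      (\<forall>j\<in>\<Union>d. J d. j \<noteq> i \<longrightarrow> h (?v j) = \<zero>\<^bsub>K\<^esub>)" if "i \<in> (\<Union>d. J d)" for i
  proof -
    obtain d where i: "i \<in> J d" using \<open>i \<in> (\<Union>d. J d)\<close> by blast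
    obtain h where hl: "linear_map K (P d) (scalar_module K) h"
      and h: "\<And>k. k \<in> tuples L d \<Longrightarrow> h (e (map b k)) =
        finsum K (\<lambda>\<tau>. if perm_tuple \<tau> k = i then chi d \<tau> else \<zero>\<^bsub>K\<^esub>) (W d)"
      by (rule coordinate_functional[OF b JL[OF i]]) blast
    \<comment> \<open>The stabilizer of i. As i lies in I, \<chi> is 1 on it and the sum counts its
      elements; it contains \<open>id\<close>, so the count is positive and a unit of K.\<close>
    let ?S = "{\<tau> \<in> W d. perm_tuple \<tau> i = i}"
    have "finsum K (\<lambda>\<tau>. if perm_tuple \<tau> i = i then chi d \<tau> else \<zero>\<^bsub>K\<^esub>) (W d) = finsum K (\<lambda>\<tau>. \<one>\<^bsub>K\<^esub>) ?S"
      by (rule E.R.add.finprod_mono_neutral_cong_right)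
        (use finite_W JI[OF i] in \<open>auto simp: mem_index_I\<close>)
    also have "\<dots> = [card ?S] \<cdot>\<^bsub>K\<^esub> \<one>\<^bsub>K\<^esub>" by (rule E.R.add.finprod_const) simp
    finally have "h (e (map b i)) = [card ?S] \<cdot>\<^bsub>K\<^esub> \<one>\<^bsub>K\<^esub>" using h[OF JL[OF i]] by simp
    moreover have "id \<in> ?S" using W_id by simp
    then have "card ?S > 0" using finite_W[of d] by (auto simp: card_gt_0_iff)
    ultimately have "h (e (map b i)) \<in> Units K" using nat_Units[of "card ?S"] by simp
    then have "h (e (map b i)) \<noteq> \<zero>\<^bsub>K\<^esub>"
      using R.zero_not_one by (metis E.R.Units_r_inv E.R.Units_inv_closed E.R.l_null)
    then have "h (?v i d) \<noteq> \<zero>\<^bsub>K\<^esub>" using v[OF JL[OF i]] by (simp add: inc_def)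
    moreover have "h (?v j d) = \<zero>\<^bsub>K\<^esub>" if "j \<in> J d'" "j \<noteq> i" for j d'
    proof (cases "d' = d")
      case True
      then have "h (?v j d) = finsum K (\<lambda>\<tau>. if perm_tuple \<tau> j = i then chi d \<tau> else \<zero>\<^bsub>K\<^esub>) (W d)"
        using h[of j] v[OF JL] JL that by (simp add: inc_def)
      also have "\<dots> = finsum K (\<lambda>\<tau>. \<zero>\<^bsub>K\<^esub>) (W d)"
      proof (rule E.R.finsum_cong')
        fix \<tau> assume "\<tau> \<in> W d"
        \<comment> \<open>Otherwise i and j would be two members of J in the same orbit.\<close>
        then have "perm_tuple \<tau> j \<noteq> i" using J_uniq[OF i _ \<open>\<tau> \<in> W d\<close>, of j] that True by auto
        then show "(if perm_tuple \<tau> j = i then chi d \<tau> else \<zero>\<^bsub>K\<^esub>) = \<zero>\<^bsub>K\<^esub>" by simp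
      qed auto
      finally show ?thesis by simp
    next
      case False
      then show ?thesis using v[OF JL[OF that(1)]] linear_map.zero[OF hl] by (simp add: inc_def)
    qed
    ultimately show ?thesis
      using linear_map_comp[OF component_linear hl] by blast
  qed
  show "c i = \<zero>\<^bsub>K\<^esub>"
    if "finite F" "F \<subseteq> (\<Union>d. J d)" "c \<in> F \<rightarrow> carrier K"
      "(\<Oplus>\<^bsub>A\<^esub>j\<in>F. c j \<odot>\<^bsub>A\<^esub> ?v j) = \<zero>\<^bsub>A\<^esub>" "i \<in> F" for F c i
    by (rule independent_by_functionals[OF R.domain_axioms A_module vA functional that])
  show "generated_submodule K A (?v ` (\<Union>d. J d)) = carrier A"
  proof (rule A.generated_submodule_eqI)
    show "?v ` (\<Union>d. J d) \<subseteq> carrier A" using vA by auto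
    fix N assume N: "submodule N K A" and vN: "?v ` (\<Union>d. J d) \<subseteq> N"
    \<comment> \<open>Basis tuples suffice: \<open>multilinear_in_submodule\<close> passes from them
      to all tuples, whose products generate each power.\<close>
    have basisN: "e (map b i) \<in> {x \<in> carrier (P d). inc d x \<in> N}" (is "_ \<in> ?N d")
      if i: "i \<in> tuples L d" for i d
    proof -
      note eP = e_closed[OF map_basis_tuples[OF b i]]
      show ?thesis
      proof (cases "i \<in> index_I K W chi L d")
        case True
        let ?B = "orbit (perm_group W d) perm_tuple i"
        have "?B \<subseteq> index_I K W chi L d" using index_I_perm[OF True] by (auto simp: orbit_eq)
        moreover have "?B \<in> orbits (perm_group W d) (tuples L d) perm_tuple"
          using i by (auto simp: orbits_def)
        ultimately have "\<exists>!j. j \<in> J d \<inter> ?B" using J[of d] by (auto simp: is_index_J_def)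
        then obtain \<sigma> where \<sigma>: "\<sigma> \<in> W d" "perm_tuple \<sigma> i \<in> J d" by (auto simp: orbit_eq)
        have "e (map b i) = chi d \<sigma> \<odot>\<^bsub>P d\<^esub> e (map b (perm_tuple \<sigma> i))"
          using e_perm'[OF \<sigma>(1) map_basis_tuples[OF b i]] map_perm_tuple[OF \<sigma>(1) i, of b] by simp
        moreover have "inc d (e (map b (perm_tuple \<sigma> i))) \<in> N"
          unfolding v[OF JL[OF \<sigma>(2)], symmetric] using vN \<sigma>(2) by blast
        ultimately have "inc d (e (map b i)) \<in> N"
          using inc.smult[OF chi_closed[OF \<sigma>(1)] e_closed[OF map_basis_tuples[OF b JL[OF \<sigma>(2)]]]]
            A.submoduleE(4)[OF N chi_closed[OF \<sigma>(1)]] by simp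
        then show ?thesis using eP by simp
      next
        case False
        then obtain \<sigma> where \<sigma>: "\<sigma> \<in> W d" "perm_tuple \<sigma> i = i" "chi d \<sigma> \<noteq> \<one>\<^bsub>K\<^esub>"
          using i by (auto simp: mem_index_I)
        then have "e (map b i) = \<zero>\<^bsub>P d\<^esub>"
          using e_eq_zero[OF \<sigma>(1) map_basis_tuples[OF b i]] map_perm_tuple[OF \<sigma>(1) i, of b] by simp
        then show ?thesis using inc.zero A.submodule_zero[OF N] by simp
      qed
    qed
    show "carrier A \<subseteq> N"
    proof (rule A_generated[OF N])
      fix d x assume x: "x \<in> carrier (P d)"
      have sub: "submodule (?N d) K (P d)" by (rule inc.vimage_submodule[OF N])
      have "e xs \<in> ?N d" if "xs \<in> tuples (carrier E) d" for xs
        by (rule multilinear_in_submodule[OF P.module_axioms e_multilinear sub b basisN that])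
      then have "x \<in> ?N d" by (rule P_generated[OF sub _ x])
      then show "inc d x \<in> N" by simp
    qed
  qed
qed

section \<open>Lexicographically minimal representatives and the multiplication table\<close>

lemma lex_min_props:
  assumes "i \<in> tuples L d"
  shows "lex_min W i \<in> orbit (perm_group W d) perm_tuple i"
    and "\<sigma> \<in> W d \<Longrightarrow> lex_min W (perm_tuple \<sigma> i) = lex_min W i"
proof -
  let ?O = "orbit (perm_group W d) perm_tuple i"
  have len: "length k = d" if "k \<in> ?O" for k using that assms by (auto simp: orbit_eq tuples_def)
  have "i \<in> ?O" unfolding orbit_eq using W_id[of d] by (intro image_eqI[of _ _ id]) auto
  from \<open>i \<in> ?O\<close> obtain m where m: "m \<in> ?O" "\<And>k. (k, m) \<in> lex less_than \<Longrightarrow> k \<notin> ?O"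
    using wf_lex[OF wf_less_than] unfolding wf_eq_minimal by metis
  have least: "k = m \<or> (m, k) \<in> lex less_than" if "k \<in> ?O" for k
  proof (rule ccontr)
    assume *: "\<not> ?thesis"
    \<comment> \<open>\<open>lex\<close> relates only lists of equal length and is not total.
      \<open>lenlex\<close> is total, and the two agree on an orbit, where all lengths are
      d.\<close>
    have "(m, k) \<in> lenlex less_than \<or> (k, m) \<in> lenlex less_than"
      using total_lenlex[OF total_less_than] * by (auto simp: total_on_def)
    then show False using m(2) that * len[OF that] len[OF m(1)] by (auto simp: lenlex_def)
  qed
  have "asym (lex less_than)" by (rule asym_lex) (simp add: asym_less_than)
  then have "k = m" if "k \<in> ?O" "\<forall>l\<in>?O. l = k \<or> (k, l) \<in> lex less_than" for k
    using that least[OF that(1)] m(1) by (metis asymD)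
  then have "lex_min W i = m"
    unfolding lex_min_def using len[OF \<open>i \<in> ?O\<close>] m(1) least by (intro the_equality) blast+
  then show "lex_min W i \<in> ?O" using m(1) by simp
  show "lex_min W (perm_tuple \<sigma> i) = lex_min W i" if "\<sigma> \<in> W d"
    using orbit_perm[OF that assms] assms by (simp add: lex_min_def tuples_def)
qed

text \<open>\<open>lex_min\<close> is constant on an orbit with its value in that orbit, so this
  value is its only fixed point there.\<close>

lemma is_index_J_lex: "is_index_J K W chi {1..n} d (lex_J K W chi n d)"
  unfolding is_index_J_def
proof (intro conjI ballI impI)
  show "lex_J K W chi n d \<subseteq> index_I K W chi {1..n} d" by (auto simp: lex_J_def)
  fix B assume "B \<in> orbits (perm_group W d) (tuples {1..n} d) perm_tuple"
    and BI: "B \<subseteq> index_I K W chi {1..n} d"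
  then obtain i where i: "i \<in> tuples {1..n} d" and B: "B = orbit (perm_group W d) perm_tuple i"
    by (auto simp: orbits_def)
  have same: "lex_min W k = lex_min W i" if "k \<in> B" for k
    using that lex_min_props(2)[OF i] by (auto simp: B orbit_eq)
  have "lex_min W i \<in> B" using lex_min_props(1)[OF i] B by simp
  then show "\<exists>!j. j \<in> lex_J K W chi n d \<inter> B"
    using same BI by (intro ex1I[of _ "lex_min W i"]) (auto simp: lex_J_def)
qed

lemma semisym_prod_mult:
  assumes "xs \<in> tuples (carrier E) p" "ys \<in> tuples (carrier E) q"
  shows "semisym_prod K W chi E xs \<otimes>\<^bsub>A\<^esub> semisym_prod K W chi E ys = semisym_prod K W chi E (xs @ ys)"
proof -
  have "length xs = p" "length ys = q" using assms by (simp_all add: tuples_def)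
  then show ?thesis
    using inc_mult[OF e_closed[OF assms(1)] e_closed[OF assms(2)]] semisym_mult_e[OF assms]
    by (simp add: semisym_prod_eq)
qed

lemma semisym_prod_index_I0:
  assumes b: "module_basis K E L b" and i: "i \<in> index_I0 K W chi L d"
  shows "semisym_prod K W chi E (map b i) = \<zero>\<^bsub>A\<^esub>"
proof -
  have iL: "i \<in> tuples L d" using i by (simp add: index_I0_def)
  obtain \<sigma> where \<sigma>: "\<sigma> \<in> W d" "perm_tuple \<sigma> i = i" "chi d \<sigma> \<noteq> \<one>\<^bsub>K\<^esub>"
    using i by (auto simp: index_I0_def mem_index_I)
  then have "e (map b i) = \<zero>\<^bsub>P d\<^esub>"
    using e_eq_zero[OF \<sigma>(1) map_basis_tuples[OF b iL]] map_perm_tuple[OF \<sigma>(1) iL, of b] by simp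
  then show ?thesis using iL inc.zero by (simp add: semisym_prod_eq tuples_def)
qed

text \<open>\<open>e_perm'\<close> gives this relation with factor \<chi>(\<sigma>) for every
  \<sigma> in the group that carries i to its minimum, in particular for the one picked by
  \<open>SOME\<close> in \<open>zeta\<close>.\<close>

lemma semisym_prod_lex_min:
  assumes b: "module_basis K E L b" and i: "i \<in> tuples L d"
  shows "semisym_prod K W chi E (map b i) =
    zeta W chi i \<odot>\<^bsub>A\<^esub> semisym_prod K W chi E (map b (lex_min W i))"
proof -
  have len: "length i = d" using i by (simp add: tuples_def)
  define \<sigma> where "\<sigma> = (SOME \<sigma>. \<sigma> \<in> W d \<and> perm_tuple \<sigma> i = lex_min W i)"
  have "\<exists>\<sigma>. \<sigma> \<in> W d \<and> perm_tuple \<sigma> i = lex_min W i"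
    using lex_min_props(1)[OF i] by (auto simp: orbit_eq)
  then have \<sigma>: "\<sigma> \<in> W d" "perm_tuple \<sigma> i = lex_min W i"
    unfolding \<sigma>_def by (metis (mono_tags, lifting) someI_ex)+
  have lm: "lex_min W i \<in> tuples L d" using perm_closed[OF \<sigma>(1)] i \<sigma>(2) by metis
  have "e (map b i) = chi d \<sigma> \<odot>\<^bsub>P d\<^esub> e (map b (lex_min W i))"
    using e_perm'[OF \<sigma>(1) map_basis_tuples[OF b i]] map_perm_tuple[OF \<sigma>(1) i, of b] \<sigma>(2) by simp
  then have "inc d (e (map b i)) = chi d \<sigma> \<odot>\<^bsub>A\<^esub> inc d (e (map b (lex_min W i)))"
    using inc.smult[OF chi_closed[OF \<sigma>(1)] e_closed[OF map_basis_tuples[OF b lm]]] by simp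
  moreover have "zeta W chi i = chi d \<sigma>" by (simp add: zeta_def len \<sigma>_def)
  ultimately show ?thesis using len lm by (simp add: semisym_prod_eq tuples_def)
qed

end

theorem corollary9:
  fixes K :: "('k, 'm) ring_scheme"
    and W :: "nat \<Rightarrow> (nat \<Rightarrow> nat) set"
    and chi :: "nat \<Rightarrow> (nat \<Rightarrow> nat) \<Rightarrow> 'k"
    and E :: "('k, 'e, 'n) module_scheme"
  assumes "domain K" and "rat_algebra K" and "omega_invariant K W chi"
  shows
    "(\<forall>(L :: 'l set) (b :: 'l \<Rightarrow> 'e) (J :: nat \<Rightarrow> 'l list set).
        module_basis K E L b \<longrightarrow> (\<forall>d. is_index_J K W chi L d (J d)) \<longrightarrow>
        module_basis K (semisym_algebra K W chi E) (\<Union>d. J d)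
          (\<lambda>j. semisym_prod K W chi E (map b j)))
     \<and>
     (\<forall>(n :: nat) (b :: nat \<Rightarrow> 'e).
        module_basis K E {1..n} b \<longrightarrow>
        module_basis K (semisym_algebra K W chi E) (\<Union>d. lex_J K W chi n d)
          (\<lambda>j. semisym_prod K W chi E (map b j))
        \<and>
        (\<forall>p q. \<forall>j\<in>lex_J K W chi n p. \<forall>k\<in>lex_J K W chi n q.
           (j @ k \<in> index_I0 K W chi {1..n} (p + q) \<longrightarrow>
              semisym_prod K W chi E (map b j) \<otimes>\<^bsub>semisym_algebra K W chi E\<^esub>
                semisym_prod K W chi E (map b k)
              = \<zero>\<^bsub>semisym_algebra K W chi E\<^esub>)
         \<and> (j @ k \<in> index_I K W chi {1..n} (p + q) \<longrightarrow>
              semisym_prod K W chi E (map b j) \<otimes>\<^bsub>semisym_algebra K W chi E\<^esub>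
                semisym_prod K W chi E (map b k)
              = zeta W chi (j @ k) \<odot>\<^bsub>semisym_algebra K W chi E\<^esub>
                  semisym_prod K W chi E (map b (lex_min W (j @ k))))))"
proof -
  \<comment> \<open>The module structure of E comes from the basis assumption. The index type is
    left general to serve both L and {1..n}.\<close>
  have semisym: "semisym K E W chi" if "module_basis K E L b" for L :: "'i set" and b
    using that assms
    by (intro semisym.intro tensor.intro semisym_axioms.intro) (auto dest: module_basis.axioms(1))
  show ?thesis
  proof (intro conjI allI impI ballI)
    fix L :: "'l set" and b J
    assume b: "module_basis K E L b" and J: "\<forall>d. is_index_J K W chi L d (J d)"
    show "module_basis K (semisym_algebra K W chi E) (\<Union>d. J d)
        (\<lambda>j. semisym_prod K W chi E (map b j))"
      using semisym.semisym_basis[OF semisym[OF b] b] J by blast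
  next
    fix n :: nat and b assume b: "module_basis K E {1..n} b"
    interpret semisym K E W chi by (rule semisym[OF b])
    show "module_basis K (semisym_algebra K W chi E) (\<Union>d. lex_J K W chi n d)
        (\<lambda>j. semisym_prod K W chi E (map b j))"
      by (rule semisym_basis[OF b is_index_J_lex])
    fix p q j k assume jk: "j \<in> lex_J K W chi n p" "k \<in> lex_J K W chi n q"
    then have jk_tuples: "j \<in> tuples {1..n} p" "k \<in> tuples {1..n} q"
      by (auto simp: lex_J_def mem_index_I)
    \<comment> \<open>Both cases of the table evaluate this single monomial of the concatenated
      index.\<close>
    have prod: "semisym_prod K W chi E (map b j) \<otimes>\<^bsub>A\<^esub> semisym_prod K W chi E (map b k) =
        semisym_prod K W chi E (map b (j @ k))"
      using semisym_prod_mult[OF map_basis_tuples[OF b jk_tuples(1)] map_basis_tuples[OF b jk_tuples(2)]]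
      by simp
    show "semisym_prod K W chi E (map b j) \<otimes>\<^bsub>A\<^esub> semisym_prod K W chi E (map b k) = \<zero>\<^bsub>A\<^esub>"
      if "j @ k \<in> index_I0 K W chi {1..n} (p + q)"
      unfolding prod by (rule semisym_prod_index_I0[OF b that])
    show "semisym_prod K W chi E (map b j) \<otimes>\<^bsub>A\<^esub> semisym_prod K W chi E (map b k) =
        zeta W chi (j @ k) \<odot>\<^bsub>A\<^esub> semisym_prod K W chi E (map b (lex_min W (j @ k)))"
      unfolding prod by (rule semisym_prod_lex_min[OF b tuples_append[OF jk_tuples]])
  qed
qed

end
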